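(* Fix $r_c,r_s,\rho>0$ and define $$\delta_1=2r_c+(1+2\rho)r_s,\qquad \delta_2=2r_c+2(1+\rho)r_s,$$ $$\delta_3=2\left(\rho(r_c+\rho r_s)+r_s\right),\qquad \delta_4=2(r_c+2\rho r_s+r_s),$$ $$\lambda=\frac{2\left(\rho(r_c+\rho r_s)+r_s\right)2r_s}{(\mu-\delta_1)(\mu-\delta_4)}+\frac{2(r_c+\rho r_s)}{\mu-\delta_1}.$$ If $$\delta_1,\delta_2,\delta_4<\mu,\qquad \frac{\delta_3}{\mu-\delta_2}<\rho,\qquad \lambda<1,$$ then there is a unique map $\alpha\in\mathcal{B}$ such that $\Psi[\alpha]=\alpha$.
   Context: Fix $\theta\in(-\pi/2,\pi/2)$, $\omega=2\pi$ and $\mu=\omega^2\cos\theta$. $\ell^1$ is the space of complex sequences $a=(a_k)_{k\in\mathbb{Z}}$ with $\|a\|_{\ell^1}=\sum_k|a_k|<\infty$. Consider the differential equation in $\ell^1$ $$\dot a_k=e^{\mathrm{i}\theta}\Big[-k^2\omega^2a_k+\sum_{k_1+k_2=k}a_{k_1}a_{k_2}\Big]\quad(k\in\mathbb{Z}).$$ Let $X_c=\{a\in\ell^1:a_k=0\ \forall k\ne0\}$ (identified with $\mathbb{C}$) and $X_s=\{a\in\ell^1:a_0=0\}$. Writing $a=(\mathrm{x}_c,\mathrm{x}_s)\in X_c\times X_s$, the equation becomes $\dot{\mathrm{x}}_c=\mathcal{N}_c(\mathrm{x}_c,\mathrm{x}_s)$, $\dot{\mathrm{x}}_s=\mathfrak{L}\mathrm{x}_s+\mathcal{N}_s(\mathrm{x}_c,\mathrm{x}_s)$,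 where $$(\mathfrak{L}a)_k=-e^{\mathrm{i}\theta}k^2\omega^2a_k,\qquad \mathcal{N}_c(\mathrm{x}_c,\mathrm{x}_s)=e^{\mathrm{i}\theta}\sum_{k\in\mathbb{Z}}a_ka_{-k},\qquad (\mathcal{N}_s(\mathrm{x}_c,\mathrm{x}_s))_k=e^{\mathrm{i}\theta}\sum_{k_1+k_2=k}a_{k_1}a_{k_2}\ (k\neq0).$$ For $\phi\in\mathbb{C}$ let $\Phi(t,\phi)=\dfrac{\phi}{1-\phi te^{\mathrm{i}\theta}}$, the solution of $\dot{\mathrm{x}}_c=e^{\mathrm{i}\theta}\mathrm{x}_c^2$ with $\mathrm{x}_c(0)=\phi$. For $r_c,r_s>0$ let $$B_c(r_c)=\{\mathrm{x}_c\in X_c:|\mathrm{x}_c|\le r_c,\ \mathrm{Re}(e^{\mathrm{i}\theta}\mathrm{x}_c)\le0\},\qquad B_s(r_s)=\{\mathrm{x}_s\in X_s:\|\mathrm{x}_s\|_{\ell^1}\le r_s\}.$$ For fixed $\rho>0$, $\mathcal{B}$ is the set of Lipschitz maps $\alpha:B_c(r_c)\times B_s(r_s)\to X_c$ (with some Lipschitz constant) such that $\alpha(\mathrm{x}_c,0)=\mathrm{x}_c$ and $|\alpha(\mathrm{x}_c,\mathrm{x}_1)-\alpha(\mathrm{x}_c,\mathrm{x}_2)|\le\rho\|\mathrm{x}_1-\mathrm{x}_2\|_{\ell^1}$ for all $\mathrm{x}_c\in B_c(r_c)$, $\mathrm{x}_1,\mathrm{x}_2\in B_s(r_s)$. For $\alpha\in\mathcal{B}$,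 $\phi\in B_c(r_c)$, $\xi\in B_s(r_s)$, let $x(t,\phi,\xi,\alpha)\in X_s$ be the (mild, i.e. variation-of-constants) solution of $$\dot{\mathrm{x}}_s=\mathfrak{L}\mathrm{x}_s+\mathcal{N}_s\left(\alpha(\Phi(t,\phi),\mathrm{x}_s),\mathrm{x}_s\right),\qquad \mathrm{x}_s(0)=\xi .$$ The Lyapunov-Perron operator is $$\Psi[\alpha](\phi,\xi)=-\int_0^\infty\mathcal{N}_c\left(\alpha\big(\Phi(t,\phi),x(t,\phi,\xi,\alpha)\big),x(t,\phi,\xi,\alpha)\right)dt .$$ *)

theory Defs
  imports "HOL-Analysis.Analysis"
begin

(* From here on the notation is the one of Infinite_Sum only. *)
no_notation Infinite_Set_Sum.abs_summable_on (infix "abs'_summable'_on" 50)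

section \<open>The Banach space of absolutely summable bi-infinite complex sequences\<close>

typedef ell1 = "{a :: int \<Rightarrow> complex. a abs_summable_on UNIV}"
  morphisms coeff Abs_ell1
  by (rule exI[of _ "\<lambda>_. 0"]) simp

setup_lifting type_definition_ell1

lemma coeff_summable: "coeff a abs_summable_on UNIV"
  using coeff[of a] by simp

lemma ell1_eqI: "(\<And>k. coeff a k = coeff b k) \<Longrightarrow> a = b"
  by (rule coeff_inject[THEN iffD1]) (rule ext)

lemma abs_summable_add:
  fixes a b :: "int \<Rightarrow> complex"
  assumes "a abs_summable_on UNIV" "b abs_summable_on UNIV"
  shows "(\<lambda>k. a k + b k) abs_summable_on UNIV"
  by (rule Infinite_Sum.abs_summable_on_comparison_test'[OF summable_on_add[OF assms]])
     (rule norm_triangle_ineq)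

instantiation ell1 :: real_normed_vector
begin

lift_definition zero_ell1 :: ell1 is "\<lambda>_. 0" by simp

lift_definition plus_ell1 :: "ell1 \<Rightarrow> ell1 \<Rightarrow> ell1" is "\<lambda>a b k. a k + b k"
  by (rule abs_summable_add)

lift_definition uminus_ell1 :: "ell1 \<Rightarrow> ell1" is "\<lambda>a k. - a k" by simp

definition minus_ell1 :: "ell1 \<Rightarrow> ell1 \<Rightarrow> ell1" where
  "minus_ell1 a b = a + (- b)"

lift_definition scaleR_ell1 :: "real \<Rightarrow> ell1 \<Rightarrow> ell1" is "\<lambda>r a k. r *\<^sub>R a k"
  by (simp add: summable_on_cmult_right)

lift_definition norm_ell1 :: "ell1 \<Rightarrow> real" is "\<lambda>a. \<Sum>\<^sub>\<infinity>k. cmod (a k)" .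

definition sgn_ell1 :: "ell1 \<Rightarrow> ell1" where "sgn_ell1 a = inverse (norm a) *\<^sub>R a"

definition dist_ell1 :: "ell1 \<Rightarrow> ell1 \<Rightarrow> real" where "dist_ell1 a b = norm (a - b)"

definition uniformity_ell1 :: "(ell1 \<times> ell1) filter" where
  "uniformity_ell1 = (INF e\<in>{0<..}. principal {(a, b). dist a b < e})"

definition open_ell1 :: "ell1 set \<Rightarrow> bool" where
  "open_ell1 U \<longleftrightarrow> (\<forall>a\<in>U. \<forall>\<^sub>F (a', b) in uniformity. a' = a \<longrightarrow> b \<in> U)"

instance
proof
  fix a b c :: ell1 and r s :: real
  show "a + b + c = a + (b + c)" by transfer (simp add: add.assoc)
  show "a + b = b + a" by transfer (simp add: add.commute)
  show "0 + a = a" by transfer simp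
  show "- a + a = 0" by transfer simp
  show "a - b = a + - b" by (rule minus_ell1_def)
  show "r *\<^sub>R (a + b) = r *\<^sub>R a + r *\<^sub>R b" by transfer (simp add: scaleR_add_right)
  show "(r + s) *\<^sub>R a = r *\<^sub>R a + s *\<^sub>R a" by transfer (simp add: scaleR_add_left)
  show "r *\<^sub>R s *\<^sub>R a = (r * s) *\<^sub>R a" by transfer simp
  show "1 *\<^sub>R a = a" by transfer simp
  show "dist a b = norm (a - b)" by (rule dist_ell1_def)
  show "sgn a = inverse (norm a) *\<^sub>R a" by (rule sgn_ell1_def)
  show "uniformity = (INF e\<in>{0<..}. principal {(x :: ell1, y). dist x y < e})"
    by (rule uniformity_ell1_def)
  show "open U \<longleftrightarrow> (\<forall>x\<in>U. \<forall>\<^sub>F (x', y) in uniformity. x' = x \<longrightarrow> y \<in> U)" for U :: "ell1 set"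
    by (rule open_ell1_def)
  show "norm a = 0 \<longleftrightarrow> a = 0"
  proof transfer
    fix a :: "int \<Rightarrow> complex" assume a: "a abs_summable_on UNIV"
    show "(\<Sum>\<^sub>\<infinity>k. cmod (a k)) = 0 \<longleftrightarrow> a = (\<lambda>_. 0)"
    proof
      assume "(\<Sum>\<^sub>\<infinity>k. cmod (a k)) = 0"
      then have "cmod (a k) = 0" for k
        using nonneg_infsum_le_0D[of "\<lambda>k. cmod (a k)" UNIV k] a by simp
      then show "a = (\<lambda>_. 0)" by auto
    qed simp
  qed
  show "norm (a + b) \<le> norm a + norm b"
  proof transfer
    fix a b :: "int \<Rightarrow> complex"
    assume ab: "a abs_summable_on UNIV" "b abs_summable_on UNIV"
    have "(\<Sum>\<^sub>\<infinity>k. cmod (a k + b k)) \<le> (\<Sum>\<^sub>\<infinity>k. cmod (a k) + cmod (b k))"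
      by (intro infsum_mono abs_summable_add ab summable_on_add norm_triangle_ineq)
    also have "\<dots> = (\<Sum>\<^sub>\<infinity>k. cmod (a k)) + (\<Sum>\<^sub>\<infinity>k. cmod (b k))"
      by (intro infsum_add ab)
    finally show "(\<Sum>\<^sub>\<infinity>k. cmod (a k + b k)) \<le> (\<Sum>\<^sub>\<infinity>k. cmod (a k)) + (\<Sum>\<^sub>\<infinity>k. cmod (b k))" .
  qed
  show "norm (r *\<^sub>R a) = \<bar>r\<bar> * norm a"
    by transfer (simp add: infsum_cmult_right')
qed

end

lemma coeff_simps [simp]:
  "coeff 0 k = 0" "coeff (a + b) k = coeff a k + coeff b k" "coeff (- a) k = - coeff a k"
  "coeff (a - b) k = coeff a k - coeff b k" "coeff (r *\<^sub>R a) k = r *\<^sub>R coeff a k"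
  unfolding minus_ell1_def zero_ell1.rep_eq plus_ell1.rep_eq uminus_ell1.rep_eq scaleR_ell1.rep_eq
  by simp_all

lemma norm_ell1_eq: "norm a = (\<Sum>\<^sub>\<infinity>k. cmod (coeff a k))"
  by (rule norm_ell1.rep_eq)

lemma sum_coeff_le_norm: "finite F \<Longrightarrow> (\<Sum>k\<in>F. cmod (coeff a k)) \<le> norm a"
  unfolding norm_ell1_eq by (intro finite_sum_le_infsum coeff_summable) auto

lemma coeff_le_norm: "cmod (coeff a k) \<le> norm a"
  using sum_coeff_le_norm[of "{k}" a] by simp

instance ell1 :: banach
proof
  fix X :: "nat \<Rightarrow> ell1" assume X: "Cauchy X"
  have "Cauchy (\<lambda>n. coeff (X n) k)" for k
  proof (rule metric_CauchyI)
    fix e :: real assume "0 < e"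
    then obtain M where "\<forall>m\<ge>M. \<forall>n\<ge>M. dist (X m) (X n) < e"
      using metric_CauchyD[OF X] by blast
    then show "\<exists>M. \<forall>m\<ge>M. \<forall>n\<ge>M. dist (coeff (X m) k) (coeff (X n) k) < e"
      using coeff_le_norm[of "X _ - X _" k] unfolding dist_norm coeff_simps
      by (meson le_less_trans)
  qed
  then have "\<exists>l. (\<lambda>n. coeff (X n) k) \<longlonglongrightarrow> l" for k
    by (simp add: Cauchy_convergent_iff convergent_def)
  then obtain l where l: "\<And>k. (\<lambda>n. coeff (X n) k) \<longlonglongrightarrow> l k" by metis
  have bound: "(\<Sum>k\<in>F. cmod (coeff (X m) k - l k)) \<le> e"
    if M: "\<forall>m\<ge>M. \<forall>n\<ge>M. dist (X m) (X n) < e" and "m \<ge> M" "finite F" for F M m e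
  proof (rule tendsto_upperbound)
    show "(\<lambda>n. \<Sum>k\<in>F. cmod (coeff (X m) k - coeff (X n) k))
            \<longlonglongrightarrow> (\<Sum>k\<in>F. cmod (coeff (X m) k - l k))"
      by (intro tendsto_intros l)
    show "\<forall>\<^sub>F n in sequentially. (\<Sum>k\<in>F. cmod (coeff (X m) k - coeff (X n) k)) \<le> e"
      using eventually_ge_at_top[of M]
    proof eventually_elim
      case (elim n)
      have "(\<Sum>k\<in>F. cmod (coeff (X m) k - coeff (X n) k)) \<le> dist (X m) (X n)"
        using sum_coeff_le_norm[OF \<open>finite F\<close>, of "X m - X n"] by (simp add: dist_norm)
      then show ?case using M \<open>m \<ge> M\<close> elim by force
    qed
  qed simp
  have diff: "(\<lambda>k. coeff (X m) k - l k) abs_summable_on UNIV"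
    if M: "\<forall>m\<ge>M. \<forall>n\<ge>M. dist (X m) (X n) < e" and "m \<ge> M" for M m e
    unfolding abs_summable_iff_bdd_above using bound[OF M \<open>m \<ge> M\<close>]
    by (intro bdd_aboveI[of _ e]) auto
  obtain M0 where M0: "\<forall>m\<ge>M0. \<forall>n\<ge>M0. dist (X m) (X n) < 1"
    using metric_CauchyD[OF X, of 1] by auto
  have "l abs_summable_on UNIV"
    using abs_summable_add[OF coeff_summable[of "X M0"], of "\<lambda>k. - (coeff (X M0) k - l k)"]
      diff[OF M0, of M0] by (simp add: norm_minus_commute)
  then have cl: "coeff (Abs_ell1 l) = l" by (simp add: Abs_ell1_inverse)
  have "X \<longlonglongrightarrow> Abs_ell1 l"
  proof (rule metric_LIMSEQ_I)
    fix e :: real assume "0 < e"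
    then obtain M where M: "\<forall>m\<ge>M. \<forall>n\<ge>M. dist (X m) (X n) < e / 2"
      using metric_CauchyD[OF X, of "e / 2"] by auto
    have "dist (X m) (Abs_ell1 l) \<le> e / 2" if "m \<ge> M" for m
      unfolding dist_norm norm_ell1_eq coeff_simps cl
      by (rule infsum_le_finite_sums[OF diff[OF M that] bound[OF M that]])
    then show "\<exists>M. \<forall>m\<ge>M. dist (X m) (Abs_ell1 l) < e"
      using \<open>0 < e\<close> by (intro exI[of _ M]) force
  qed
  then show "convergent X" by (rule convergentI)
qed


section \<open>The evolution equation in the coordinates \<open>X\<^sub>c \<times> X\<^sub>s\<close>\<close>

definition omega :: real where "omega = 2 * pi"

text \<open>The space \<open>X\<^sub>c\<close> of sequences supported at index \<open>0\<close> is identified with \<^typ>\<open>complex\<close>.\<close>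

definition Xs :: "ell1 set" where "Xs = {a. coeff a 0 = 0}"

lemma abs_summable_fun_upd:
  fixes a :: "int \<Rightarrow> complex"
  assumes "a abs_summable_on UNIV"
  shows "a(0 := c) abs_summable_on UNIV"
proof -
  have "(\<lambda>k. if k = 0 then c - a 0 else 0) abs_summable_on UNIV"
    by (rule finite_nonzero_values_imp_summable_on) simp
  from abs_summable_add[OF assms this]
  show ?thesis by (rule summable_on_cong[THEN iffD1, rotated]) auto
qed

lift_definition join :: "complex \<Rightarrow> ell1 \<Rightarrow> ell1" is "\<lambda>xc xs. xs(0 := xc)"
  by (rule abs_summable_fun_upd)

lemma abs_summable_pairs:
  assumes "a abs_summable_on UNIV" "b abs_summable_on UNIV"
  shows "(\<lambda>(j :: int, l :: int). a j * b l :: complex) abs_summable_on UNIV \<times> UNIV"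
proof -
  have "norm (\<Sum>\<^sub>\<infinity>l. norm (case (j, l) of (j, l) \<Rightarrow> a j * b l)) =
        cmod (a j) * (\<Sum>\<^sub>\<infinity>l. cmod (b l))" for j
    by (simp add: norm_mult infsum_cmult_right' infsum_nonneg)
  then show ?thesis
    unfolding Infinite_Sum.abs_summable_on_Sigma_iff
    using summable_on_cmult_left[OF assms(1)] summable_on_cmult_right[OF assms(2)]
    by (simp add: norm_mult)
qed

lift_definition conv :: "ell1 \<Rightarrow> ell1 \<Rightarrow> ell1" is
  "\<lambda>a b k. \<Sum>\<^sub>\<infinity>(k1, k2)\<in>{(k1, k2). k1 + k2 = k}. a k1 * b k2"
proof -
  fix a b :: "int \<Rightarrow> complex"
  assume ab: "a abs_summable_on UNIV" "b abs_summable_on UNIV"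
  let ?f = "\<lambda>(k1, k2). a k1 * b k2"
  let ?D = "\<lambda>k :: int. {(k1, k2). k1 + k2 = k}"
  have "(\<lambda>(k, p). ?f p) abs_summable_on (SIGMA k:UNIV. ?D k) \<longleftrightarrow>
        ?f abs_summable_on UNIV \<times> UNIV"
    by (rule summable_on_reindex_bij_witness[of _ "\<lambda>p. (fst p + snd p, p)" snd]) auto
  then have "(\<lambda>(k, p). ?f p) abs_summable_on (SIGMA k:UNIV. ?D k)"
    using abs_summable_pairs[OF ab] by simp
  note * = this[unfolded Infinite_Sum.abs_summable_on_Sigma_iff, simplified prod.case]
  have D: "?f abs_summable_on ?D k" for k using * by blast
  have S: "(\<lambda>k. \<Sum>\<^sub>\<infinity>p\<in>?D k. norm (?f p)) abs_summable_on UNIV" using * by blast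
  have "(\<lambda>k. infsum ?f (?D k)) abs_summable_on UNIV"
  proof (rule Infinite_Sum.abs_summable_on_comparison_test[OF S])
    fix k :: int
    have "norm (infsum ?f (?D k)) \<le> (\<Sum>\<^sub>\<infinity>p\<in>?D k. norm (?f p))"
      by (rule norm_infsum_bound[OF D])
    then show "norm (infsum ?f (?D k)) \<le> norm (\<Sum>\<^sub>\<infinity>p\<in>?D k. norm (?f p))" by simp
  qed
  then show "(\<lambda>k. infsum ?f (?D k)) abs_summable_on UNIV" .
qed

definition Nc :: "real \<Rightarrow> complex \<Rightarrow> ell1 \<Rightarrow> complex" where
  "Nc \<theta> xc xs = cis \<theta> * (\<Sum>\<^sub>\<infinity>k. coeff (join xc xs) k * coeff (join xc xs) (- k))"

lift_definition cmul :: "complex \<Rightarrow> ell1 \<Rightarrow> ell1" is "\<lambda>c a k. c * a k"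
  by (simp add: norm_mult summable_on_cmult_right)

text \<open>\<open>join 0\<close> is the projection onto \<open>X\<^sub>s\<close>.\<close>

definition Ns :: "real \<Rightarrow> complex \<Rightarrow> ell1 \<Rightarrow> ell1" where
  "Ns \<theta> xc xs = join 0 (cmul (cis \<theta>) (conv (join xc xs) (join xc xs)))"

text \<open>Eigenvalues of the diagonal operator \<open>L\<close>.\<close>

definition L_eig :: "real \<Rightarrow> int \<Rightarrow> complex" where
  "L_eig \<theta> k = - cis \<theta> * of_int k ^ 2 * of_real omega ^ 2"

text \<open>The semigroup \<open>exp (t L)\<close>. It maps into \<open>\<ell>\<^sup>1\<close> only for \<open>t \<ge> 0\<close> and \<open>cos \<theta> \<ge> 0\<close>; other
  arguments are never used.\<close>

definition L_semigroup :: "real \<Rightarrow> real \<Rightarrow> ell1 \<Rightarrow> ell1" where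
  "L_semigroup \<theta> t a = Abs_ell1 (\<lambda>k. exp (of_real t * L_eig \<theta> k) * coeff a k)"

lemma coeff_L_semigroup:
  assumes "t \<ge> 0" "cos \<theta> \<ge> 0"
  shows "coeff (L_semigroup \<theta> t a) k = exp (of_real t * L_eig \<theta> k) * coeff a k"
proof -
  have "(\<lambda>k. exp (of_real t * L_eig \<theta> k) * coeff a k) abs_summable_on UNIV"
  proof (rule Infinite_Sum.abs_summable_on_comparison_test[OF coeff_summable[of a]])
    fix k
    have "L_eig \<theta> k = cis \<theta> * of_real (- (real_of_int k ^ 2 * omega ^ 2))"
      by (simp add: L_eig_def)
    then have "Re (L_eig \<theta> k) = - (cos \<theta> * (real_of_int k ^ 2 * omega ^ 2))"
      by (simp del: of_real_minus of_real_mult of_real_power)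
    then have "Re (of_real t * L_eig \<theta> k) \<le> 0" using assms by simp
    then have "cmod (exp (of_real t * L_eig \<theta> k)) \<le> 1" by simp
    then show "norm (exp (of_real t * L_eig \<theta> k) * coeff a k) \<le> norm (coeff a k)"
      by (simp only: norm_mult mult_left_le_one_le norm_ge_zero)
  qed
  then show ?thesis by (simp add: L_semigroup_def Abs_ell1_inverse)
qed


section \<open>The Lyapunov--Perron operator\<close>

definition Phi :: "real \<Rightarrow> real \<Rightarrow> complex \<Rightarrow> complex" where
  "Phi \<theta> t \<phi> = \<phi> / (1 - \<phi> * of_real t * cis \<theta>)"

definition Bc :: "real \<Rightarrow> real \<Rightarrow> complex set" where
  "Bc \<theta> rc = {xc. cmod xc \<le> rc \<and> Re (cis \<theta> * xc) \<le> 0}"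

definition Bs :: "real \<Rightarrow> ell1 set" where
  "Bs rs = {xs \<in> Xs. norm xs \<le> rs}"

text \<open>Maps with domain \<open>B\<^sub>c \<times> B\<^sub>s\<close> are represented by functions that are extensional (equal to
  \<^const>\<open>undefined\<close> outside this set), so that equality of maps is equality in HOL.\<close>

definition LP_maps :: "real \<Rightarrow> real \<Rightarrow> real \<Rightarrow> real \<Rightarrow> (complex \<times> ell1 \<Rightarrow> complex) set" where
  "LP_maps \<theta> rc rs \<rho> = {\<alpha> \<in> extensional (Bc \<theta> rc \<times> Bs rs).
     (\<exists>C. C-lipschitz_on (Bc \<theta> rc \<times> Bs rs) \<alpha>) \<and>
     (\<forall>xc\<in>Bc \<theta> rc. \<alpha> (xc, 0) = xc) \<and>
     (\<forall>xc\<in>Bc \<theta> rc. \<forall>x1\<in>Bs rs. \<forall>x2\<in>Bs rs.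
        cmod (\<alpha> (xc, x1) - \<alpha> (xc, x2)) \<le> \<rho> * norm (x1 - x2))}"

text \<open>A mild solution has to stay in \<open>B\<^sub>s\<close>, since \<open>\<alpha>\<close> is defined only there. The integral is
  that of an \<open>\<ell>\<^sup>1\<close>-valued function.\<close>

definition mild_solution ::
  "real \<Rightarrow> real \<Rightarrow> (complex \<times> ell1 \<Rightarrow> complex) \<Rightarrow> complex \<Rightarrow> ell1 \<Rightarrow> (real \<Rightarrow> ell1) \<Rightarrow> bool" where
  "mild_solution \<theta> rs \<alpha> \<phi> \<xi> x \<longleftrightarrow>
     continuous_on {0..} x \<and> (\<forall>t\<ge>0. x t \<in> Bs rs) \<and>
     (\<forall>t\<ge>0. x t = L_semigroup \<theta> t \<xi> +
        integral {0..t} (\<lambda>s. L_semigroup \<theta> (t - s) (Ns \<theta> (\<alpha> (Phi \<theta> s \<phi>, x s)) (x s))))"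

definition xsol ::
  "real \<Rightarrow> real \<Rightarrow> (complex \<times> ell1 \<Rightarrow> complex) \<Rightarrow> complex \<Rightarrow> ell1 \<Rightarrow> real \<Rightarrow> ell1" where
  "xsol \<theta> rs \<alpha> \<phi> \<xi> = (THE x. x \<in> extensional {0..} \<and> mild_solution \<theta> rs \<alpha> \<phi> \<xi> x)"

definition Psi ::
  "real \<Rightarrow> real \<Rightarrow> real \<Rightarrow> (complex \<times> ell1 \<Rightarrow> complex) \<Rightarrow> complex \<times> ell1 \<Rightarrow> complex" where
  "Psi \<theta> rc rs \<alpha> = (\<lambda>(\<phi>, \<xi>)\<in>Bc \<theta> rc \<times> Bs rs.
     - integral {0..} (\<lambda>t. let x = xsol \<theta> rs \<alpha> \<phi> \<xi> t in Nc \<theta> (\<alpha> (Phi \<theta> t \<phi>, x)) x))"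

end

theory Submission
  imports Defs
begin

text \<open>
  Write \<open>\<gamma>(\<phi>, \<xi>) = \<alpha>(\<phi>, \<xi>) - \<phi>\<close>. On \<open>X\<^sub>c \<times> X\<^sub>s\<close> the nonlinearities are
  \<open>N\<^sub>c = e\<^bsup>i\<theta>\<^esup> (c\<^sup>2 + (x * x)\<^sub>0)\<close> and \<open>N\<^sub>s = e\<^bsup>i\<theta>\<^esup> (2 c x + P(x * x))\<close>, where \<open>*\<close> is convolution and \<open>P\<close> the
  projection onto \<open>X\<^sub>s\<close>. Since \<open>\<Phi>' = e\<^bsup>i\<theta>\<^esup> \<Phi>\<^sup>2\<close> and \<open>\<Phi>\<close> tends to \<open>0\<close>, the part \<open>\<Phi>\<^sup>2\<close> of the integrand of the
  Lyapunov--Perron operator contributes exactly \<open>\<phi>\<close>, and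
  \<open>\<Psi>[\<alpha>](\<phi>, \<xi>) = \<phi> - \<integral> R\<close> with a remainder \<open>R = e\<^bsup>i\<theta>\<^esup> (2 \<Phi> \<gamma> + \<gamma>\<^sup>2 + (x * x)\<^sub>0)\<close> of size \<open>O(\<parallel>x\<parallel>)\<close>
  (\<open>Psi_eq_remainder\<close>). So everything reduces to estimates of integrals over the stable
  solution \<open>x\<close> and over differences of two such solutions.

  \<^emph>\<open>Stable solutions.\<close> The semigroup contracts \<open>X\<^sub>s\<close> at rate \<open>\<mu>\<close> and the forcing has size at most
  \<open>\<delta>\<^sub>1 \<parallel>x\<parallel>\<close> and Lipschitz constant \<open>\<delta>\<^sub>4\<close>. Hence the variation-of-constants map preserves the curves
  in \<open>B\<^sub>s\<close> and contracts the sup norm by \<open>\<delta>\<^sub>4 / \<mu>\<close>, which gives the unique mild solution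
  (\<open>ex1_mild_solution\<close>). All further information about it comes from one Gronwall inequality with a
  free weight, \<open>weighted_gronwall\<close>: decay at rate \<open>\<kappa> = \<mu> - \<delta>\<^sub>1\<close>, and bounds for
  \<open>\<integral> \<parallel>x\<parallel>\<close> and \<open>\<integral> \<parallel>x - y\<parallel>\<close>.

  \<^emph>\<open>Contraction.\<close> In the distance \<open>sup \<bar>\<alpha>(\<phi>, \<xi>) - \<beta>(\<phi>, \<xi>)\<bar> / \<parallel>\<xi>\<parallel>\<close>, finite because both
  maps stay within \<open>\<rho> \<parallel>\<xi>\<parallel>\<close> of \<open>\<phi>\<close>, the operator contracts with factor \<open>\<lambda>\<close> (\<open>Psi_contraction\<close>).
  This alone proves uniqueness. The set of all Lipschitz maps is not complete in this distance, as the Lipschitz constants may blow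
  up. The same perturbation estimate \<open>Psi_perturbation\<close>, applied to one map and two
  base points, shows however that the bound
  \<open>\<bar>\<gamma>(\<phi>, \<xi>) - \<gamma>(\<psi>, \<xi>)\<bar> \<le> C \<bar>\<phi> - \<psi>\<bar> \<parallel>\<xi>\<parallel>\<close> is reproduced with constant \<open>c\<^sub>0 + \<lambda> C\<close>,
  where \<open>c\<^sub>0\<close> is \<open>source_factor\<close> below. For
  \<open>C = c\<^sub>0 / (1 - \<lambda>)\<close> it therefore defines an invariant set that is closed under pointwise limits, and
  the fixed point is found there by iteration.

  \<^emph>\<open>The Lipschitz constant \<open>\<rho>\<close>.\<close> The operator must preserve the constant \<open>\<rho>\<close> in \<open>\<xi>\<close>. Two
  solutions that start at \<open>\<xi>\<close> and \<open>\<zeta>\<close> approach each other at rate \<open>\<mu> - \<delta>\<^sub>4\<close> at least, but the hypothesis provides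
  only \<open>\<delta>\<^sub>3 / (\<mu> - \<delta>\<^sub>2) < \<rho>\<close> with \<open>\<delta>\<^sub>2 < \<delta>\<^sub>4\<close>. The gap is closed by using that both solutions
  decay, so that the local Lipschitz constants of the forcing and of the integrand improve with
  time. A weight of the form \<open>const + const \<cdot> e\<^bsup>-\<kappa>t\<^esup>\<close> in the Gronwall inequality captures this
  (\<open>Psi_lipschitz_xs\<close>).
\<close>

section \<open>Convolution and the nonlinear terms\<close>

lemma norm_join0_le: "norm (join 0 a) \<le> norm a"
  unfolding norm_ell1_eq
  by (intro infsum_mono coeff_summable) (simp add: join.rep_eq)

lemma join0_in_Xs: "join 0 a \<in> Xs"
  by (simp add: Xs_def join.rep_eq)

lemma coeff_cmul: "coeff (cmul c a) k = c * coeff a k"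
  by (simp add: cmul.rep_eq)

lemma norm_cmul: "norm (cmul c a) = cmod c * norm a"
  unfolding norm_ell1_eq coeff_cmul norm_mult by (rule infsum_cmult_right')

lemma coeff_conv: "coeff (conv a b) k = (\<Sum>\<^sub>\<infinity>j. coeff a j * coeff b (k - j))"
proof -
  have "coeff (conv a b) k = (\<Sum>\<^sub>\<infinity>(k1, k2)\<in>{(k1, k2). k1 + k2 = k}. coeff a k1 * coeff b k2)"
    by (simp add: conv.rep_eq)
  also have "\<dots> = (\<Sum>\<^sub>\<infinity>j. coeff a j * coeff b (k - j))"
    by (rule infsum_reindex_bij_witness[of _ "\<lambda>j. (j, k - j)" fst]) auto
  finally show ?thesis .
qed

lemma conv_terms_summable:
  "(\<lambda>(k, j). coeff a j * coeff b (k - j)) abs_summable_on UNIV \<times> UNIV"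
proof -
  have "(\<lambda>(k, j). coeff a j * coeff b (k - j)) abs_summable_on UNIV \<times> UNIV \<longleftrightarrow>
        (\<lambda>(j, l). coeff a j * coeff b l) abs_summable_on UNIV \<times> UNIV"
    by (rule summable_on_reindex_bij_witness[of _ "\<lambda>(j, l). (j + l, j)" "\<lambda>(k, j). (j, k - j)"]) auto
  then show ?thesis using abs_summable_pairs[OF coeff_summable coeff_summable] by simp
qed

lemma conv_row_summable: "(\<lambda>j. coeff a j * coeff b (k - j)) abs_summable_on UNIV"
  using conv_terms_summable[of a b, unfolded Infinite_Sum.abs_summable_on_Sigma_iff] by simp

lemma conv_row_summable': "(\<lambda>j. coeff a j * coeff b (k - j)) summable_on UNIV"
  using conv_row_summable by (rule abs_summable_summable)

text \<open>Reindexing by \<open>(j, k) \<mapsto> (j, k - j)\<close> turns the sum over the rows of the convolution into the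
  sum over all pairs, which factors.\<close>

lemma norm_conv_le: "norm (conv a b) \<le> norm a * norm b"
proof -
  have S: "(\<lambda>(k, j). cmod (coeff a j * coeff b (k - j))) summable_on UNIV \<times> UNIV"
    using conv_terms_summable[of a b] by (simp add: case_prod_unfold)
  have pairs: "(\<lambda>(j, l). cmod (coeff a j * coeff b l)) summable_on UNIV \<times> UNIV"
    using abs_summable_pairs[OF coeff_summable[of a] coeff_summable[of b]]
    by (simp add: case_prod_unfold)
  have "norm (conv a b) \<le> (\<Sum>\<^sub>\<infinity>k. \<Sum>\<^sub>\<infinity>j. cmod (coeff a j * coeff b (k - j)))"
    unfolding norm_ell1_eq[of "conv a b"]
  proof (rule infsum_mono)
    show "coeff (conv a b) abs_summable_on UNIV" by (rule coeff_summable)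
    show "(\<lambda>k. \<Sum>\<^sub>\<infinity>j. cmod (coeff a j * coeff b (k - j))) summable_on UNIV"
      using summable_on_Sigma_banach[OF S] .
    show "cmod (coeff (conv a b) k) \<le> (\<Sum>\<^sub>\<infinity>j. cmod (coeff a j * coeff b (k - j)))" for k
      unfolding coeff_conv by (rule norm_infsum_bound[OF conv_row_summable])
  qed
  also have "\<dots> = (\<Sum>\<^sub>\<infinity>(k, j)\<in>UNIV \<times> UNIV. cmod (coeff a j * coeff b (k - j)))"
    by (rule infsum_Sigma'_banach[OF S])
  also have "\<dots> = (\<Sum>\<^sub>\<infinity>(j, l)\<in>UNIV \<times> UNIV. cmod (coeff a j * coeff b l))"
    by (rule infsum_reindex_bij_witness[of _ "\<lambda>(j, l). (j + l, j)" "\<lambda>(k, j). (j, k - j)"]) auto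
  also have "\<dots> = (\<Sum>\<^sub>\<infinity>j. \<Sum>\<^sub>\<infinity>l. cmod (coeff a j * coeff b l))"
    by (rule infsum_Sigma'_banach[OF pairs, symmetric])
  also have "\<dots> = norm a * norm b"
    by (simp add: norm_mult infsum_cmult_right' infsum_cmult_left' norm_ell1_eq)
  finally show ?thesis .
qed

lemma conv_add_left: "conv (a + b) c = conv a c + conv b c"
  by (rule ell1_eqI)
     (simp add: coeff_conv distrib_right infsum_add[OF conv_row_summable' conv_row_summable'])

lemma conv_commute: "conv a b = conv b a"
proof (rule ell1_eqI)
  fix k
  show "coeff (conv a b) k = coeff (conv b a) k"
    unfolding coeff_conv
    by (rule infsum_reindex_bij_witness[of _ "\<lambda>j. k - j" "\<lambda>j. k - j"]) (auto simp: mult.commute)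
qed

lemma conv_add_right: "conv c (a + b) = conv c a + conv c b"
  by (metis conv_add_left conv_commute)

lemma conv_diff_squares: "conv a a - conv b b = conv (a - b) a + conv b (a - b)"
proof -
  have "conv a a = conv (a - b) a + conv b (a - b) + conv b b"
    using conv_add_left[of "a - b" b a] conv_add_right[of b "a - b" b]
    by (simp add: algebra_simps)
  then show ?thesis by simp
qed

lemma norm_conv_diff_squares: "norm (conv a a - conv b b) \<le> (norm a + norm b) * norm (a - b)"
proof -
  have "norm (conv a a - conv b b) \<le> norm (conv (a - b) a) + norm (conv b (a - b))"
    unfolding conv_diff_squares by (rule norm_triangle_ineq)
  also have "\<dots> \<le> norm (a - b) * norm a + norm b * norm (a - b)"
    by (intro add_mono norm_conv_le)
  finally show ?thesis by (simp add: algebra_simps)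
qed

lemma conv_const: "conv (join c 0) a = cmul c a"
proof (rule ell1_eqI)
  fix k
  have "coeff (conv (join c 0) a) k = (\<Sum>\<^sub>\<infinity>j\<in>{0}. coeff (join c 0) j * coeff a (k - j))"
    unfolding coeff_conv by (rule infsum_cong_neutral) (auto simp: join.rep_eq)
  then show "coeff (conv (join c 0) a) k = coeff (cmul c a) k"
    by (simp add: join.rep_eq coeff_cmul)
qed

lemma conv_join_square:
  assumes "x \<in> Xs"
  shows "conv (join c x) (join c x) = cmul c (join c 0) + cmul (2 * c) x + conv x x"
proof -
  have j: "join c x = join c 0 + x"
    using assms by (intro ell1_eqI) (auto simp: join.rep_eq Xs_def)
  have "conv (join c x) (join c x) = cmul c (join c 0) + cmul c x + (cmul c x + conv x x)"
    unfolding j conv_add_left conv_add_right conv_const conv_commute[of x "join c 0"] by simp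
  also have "\<dots> = cmul c (join c 0) + cmul (2 * c) x + conv x x"
    by (rule ell1_eqI) (simp add: coeff_cmul)
  finally show ?thesis .
qed

text \<open>The term \<open>c\<^sup>2\<close> of \<open>conv_join_square\<close> lives at index \<open>0\<close> and is removed by the projection.\<close>

lemma Ns_eq:
  assumes "x \<in> Xs"
  shows "Ns \<theta> c x = cmul (cis \<theta>) (cmul (2 * c) x + join 0 (conv x x))"
  unfolding Ns_def conv_join_square[OF assms]
  using assms by (intro ell1_eqI) (auto simp: coeff_cmul join.rep_eq Xs_def)

lemma Ns_in_Xs: "Ns \<theta> c x \<in> Xs"
  unfolding Ns_def by (rule join0_in_Xs)

lemma Nc_eq:
  assumes "x \<in> Xs"
  shows "Nc \<theta> c x = cis \<theta> * (c\<^sup>2 + coeff (conv x x) 0)"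
proof -
  have "Nc \<theta> c x = cis \<theta> * coeff (conv (join c x) (join c x)) 0"
    by (simp add: Nc_def coeff_conv)
  then show ?thesis
    unfolding conv_join_square[OF assms]
    using assms by (simp add: coeff_cmul join.rep_eq Xs_def power2_eq_square)
qed

text \<open>The increment of \<open>c\<close> is paired with \<open>y\<close> alone and its size with \<open>x - y\<close> alone; this asymmetric
  splitting of \<open>c x - d y\<close> is what makes all later source terms proportional to \<open>\<parallel>y\<parallel>\<close>, hence
  integrable in time.\<close>

lemma norm_Ns_diff_le:
  assumes "x \<in> Xs" "y \<in> Xs"
  shows "norm (Ns \<theta> c x - Ns \<theta> d y)
           \<le> 2 * cmod (c - d) * norm y + (2 * cmod c + norm x + norm y) * norm (x - y)"
proof -
  have "Ns \<theta> c x - Ns \<theta> d y = cmul (cis \<theta>)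
          ((cmul (2 * c) (x - y) + cmul (2 * (c - d)) y) + join 0 (conv x x - conv y y))"
    unfolding Ns_eq[OF assms(1)] Ns_eq[OF assms(2)]
    by (rule ell1_eqI) (simp add: coeff_cmul join.rep_eq algebra_simps)
  then have "norm (Ns \<theta> c x - Ns \<theta> d y)
      = norm ((cmul (2 * c) (x - y) + cmul (2 * (c - d)) y) + join 0 (conv x x - conv y y))"
    by (simp add: norm_cmul)
  also have "\<dots> \<le> norm (cmul (2 * c) (x - y)) + norm (cmul (2 * (c - d)) y)
                + norm (join 0 (conv x x - conv y y))"
    using norm_triangle_ineq[of "cmul (2 * c) (x - y) + cmul (2 * (c - d)) y"
        "join 0 (conv x x - conv y y)"] norm_triangle_ineq[of "cmul (2 * c) (x - y)" "cmul (2 * (c - d)) y"]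
    by linarith
  also have "\<dots> \<le> 2 * cmod c * norm (x - y) + 2 * cmod (c - d) * norm y
                + (norm x + norm y) * norm (x - y)"
    by (intro add_mono order_trans[OF norm_join0_le norm_conv_diff_squares])
       (simp_all only: norm_cmul norm_mult norm_numeral order_refl)
  finally show ?thesis by (simp add: algebra_simps)
qed

lemma Ns_zero: "Ns \<theta> c 0 = 0"
proof -
  have "conv 0 0 = (0 :: ell1)" using norm_conv_le[of 0 0] by simp
  then show ?thesis
    by (subst Ns_eq) (auto simp: Xs_def intro!: ell1_eqI simp: coeff_cmul join.rep_eq)
qed

lemma norm_Ns_le:
  assumes "x \<in> Xs"
  shows "norm (Ns \<theta> c x) \<le> (2 * cmod c + norm x) * norm x"
  using norm_Ns_diff_le[OF assms, of 0 \<theta> c c] by (simp add: Ns_zero Xs_def)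

lemma continuous_on_Ns:
  assumes c: "continuous_on S c" and x: "continuous_on S x" and "\<And>t. t \<in> S \<Longrightarrow> x t \<in> Xs"
  shows "continuous_on S (\<lambda>t. Ns \<theta> (c t) (x t))"
  unfolding continuous_on_def
proof
  fix t assume t: "t \<in> S"
  let ?g = "\<lambda>s. 2 * cmod (c s - c t) * norm (x t) + (2 * cmod (c s) + norm (x s) + norm (x t)) * norm (x s - x t)"
  have "(?g \<longlongrightarrow> 2 * cmod (c t - c t) * norm (x t) + (2 * cmod (c t) + norm (x t) + norm (x t)) * norm (x t - x t)) (at t within S)"
    using c x t unfolding continuous_on_def by (intro tendsto_intros) auto
  then have g: "(?g \<longlongrightarrow> 0) (at t within S)" by simp
  have "((\<lambda>s. Ns \<theta> (c s) (x s) - Ns \<theta> (c t) (x t)) \<longlongrightarrow> 0) (at t within S)"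
  proof (rule Lim_null_comparison[OF _ g])
    show "\<forall>\<^sub>F s in at t within S. norm (Ns \<theta> (c s) (x s) - Ns \<theta> (c t) (x t)) \<le> ?g s"
      unfolding eventually_at_filter using assms(3) t norm_Ns_diff_le by (auto intro!: always_eventually)
  qed
  then show "((\<lambda>s. Ns \<theta> (c s) (x s)) \<longlongrightarrow> Ns \<theta> (c t) (x t)) (at t within S)"
    by (simp add: Lim_null[symmetric])
qed

lemma bounded_linear_coeff: "bounded_linear (\<lambda>a. coeff a k)"
  by (rule bounded_linear_intro[where K = 1]) (auto simp: coeff_le_norm)

lemma continuous_on_conv_coeff:
  assumes "continuous_on S x"
  shows "continuous_on S (\<lambda>t. coeff (conv (x t) (x t)) k)"
proof -
  have "continuous_on S (\<lambda>t. conv (x t) (x t))"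
    unfolding continuous_on_def
  proof
    fix t assume t: "t \<in> S"
    have "((\<lambda>s. (norm (x s) + norm (x t)) * norm (x s - x t)) \<longlongrightarrow>
        (norm (x t) + norm (x t)) * norm (x t - x t)) (at t within S)"
      using assms t unfolding continuous_on_def by (intro tendsto_intros) auto
    then have g: "((\<lambda>s. (norm (x s) + norm (x t)) * norm (x s - x t)) \<longlongrightarrow> 0) (at t within S)" by simp
    have "((\<lambda>s. conv (x s) (x s) - conv (x t) (x t)) \<longlongrightarrow> 0) (at t within S)"
      by (rule Lim_null_comparison[OF _ g]) (simp add: norm_conv_diff_squares)
    then show "((\<lambda>s. conv (x s) (x s)) \<longlongrightarrow> conv (x t) (x t)) (at t within S)"
      by (simp add: Lim_null[symmetric])
  qed
  then show ?thesis by (rule bounded_linear.continuous_on[OF bounded_linear_coeff])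
qed

section \<open>The linear semigroup\<close>

lemma Re_L_eig: "Re (L_eig \<theta> k) = - (cos \<theta> * (real_of_int k ^ 2 * omega ^ 2))"
proof -
  have "L_eig \<theta> k = cis \<theta> * of_real (- (real_of_int k ^ 2 * omega ^ 2))"
    by (simp add: L_eig_def)
  then show ?thesis
    by (simp del: of_real_minus of_real_mult of_real_power)
qed

lemma L_semigroup_diff:
  assumes "t \<ge> 0" "cos \<theta> \<ge> 0"
  shows "L_semigroup \<theta> t a - L_semigroup \<theta> t b = L_semigroup \<theta> t (a - b)"
  using assms by (intro ell1_eqI) (simp add: coeff_L_semigroup algebra_simps)

lemma L_semigroup_in_Xs:
  assumes "t \<ge> 0" "cos \<theta> \<ge> 0" "a \<in> Xs"
  shows "L_semigroup \<theta> t a \<in> Xs"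
  using assms by (simp add: Xs_def coeff_L_semigroup)

lemma norm_exp_L_eig_le1:
  assumes "t \<ge> 0" "cos \<theta> \<ge> 0"
  shows "cmod (exp (of_real t * L_eig \<theta> k)) \<le> 1"
  using assms by (simp add: Re_L_eig)

lemma norm_L_semigroup_le1:
  assumes "t \<ge> 0" "cos \<theta> \<ge> 0"
  shows "norm (L_semigroup \<theta> t a) \<le> norm a"
  unfolding norm_ell1_eq
  by (intro infsum_mono coeff_summable)
     (simp only: coeff_L_semigroup[OF assms] norm_mult mult_left_le_one_le norm_ge_zero
        norm_exp_L_eig_le1[OF assms])

text \<open>On \<open>X\<^sub>s\<close> only the modes with \<open>k\<^sup>2 \<ge> 1\<close> occur, so the slowest rate is \<open>\<omega>\<^sup>2 cos \<theta>\<close>.\<close>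

lemma norm_L_semigroup_le:
  assumes "t \<ge> 0" "cos \<theta> \<ge> 0" "a \<in> Xs"
  shows "norm (L_semigroup \<theta> t a) \<le> exp (- (omega\<^sup>2 * cos \<theta>) * t) * norm a"
proof -
  have "cmod (exp (of_real t * L_eig \<theta> k) * coeff a k) \<le> exp (- (omega\<^sup>2 * cos \<theta>) * t) * cmod (coeff a k)" for k
  proof (cases "k = 0")
    case True
    then show ?thesis using assms(3) by (simp add: Xs_def)
  next
    case False
    then have "1 \<le> \<bar>k\<bar>" by simp
    then have "1 \<le> k\<^sup>2" by (metis abs_1 abs_le_square_iff power_one abs_abs)
    then have "(1::real) \<le> (real_of_int k)\<^sup>2" by (metis of_int_1_le_iff of_int_power)
    then have "omega\<^sup>2 * cos \<theta> * t \<le> (omega\<^sup>2 * cos \<theta> * t) * (real_of_int k)\<^sup>2"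
      using assms mult_left_mono[of 1 "(real_of_int k)\<^sup>2" "omega\<^sup>2 * cos \<theta> * t"] by simp
    then have "Re (of_real t * L_eig \<theta> k) \<le> - (omega\<^sup>2 * cos \<theta>) * t"
      by (simp add: Re_L_eig algebra_simps)
    then show ?thesis by (simp add: norm_mult mult_right_mono)
  qed
  then have "norm (L_semigroup \<theta> t a) \<le> (\<Sum>\<^sub>\<infinity>k. exp (- (omega\<^sup>2 * cos \<theta>) * t) * cmod (coeff a k))"
    unfolding norm_ell1_eq
    by (intro infsum_mono coeff_summable summable_on_cmult_right)
       (simp only: coeff_L_semigroup[OF assms(1,2)])
  also have "\<dots> = exp (- (omega\<^sup>2 * cos \<theta>) * t) * norm a"
    unfolding norm_ell1_eq by (rule infsum_cmult_right')
  finally show ?thesis .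
qed

text \<open>Strong continuity: the norm of the difference is a sum of continuous functions of \<open>s\<close> dominated
  by the summable sequence \<open>2 \<bar>a\<^sub>k\<bar>\<close>, so the Weierstrass M-test applies.\<close>

lemma tendsto_L_semigroup:
  assumes t: "t \<ge> 0" and c: "cos \<theta> \<ge> 0"
  shows "((\<lambda>s. L_semigroup \<theta> s a) \<longlongrightarrow> L_semigroup \<theta> t a) (at t within {0..})"
proof -
  let ?f = "\<lambda>k s. cmod ((exp (of_real s * L_eig \<theta> k) - exp (of_real t * L_eig \<theta> k)) * coeff a k)"
  have bd: "norm (?f k s) \<le> 2 * cmod (coeff a k)" if "s \<in> {0..}" for k s
  proof -
    have "cmod (exp (of_real s * L_eig \<theta> k) - exp (of_real t * L_eig \<theta> k)) \<le> 1 + 1"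
      using norm_exp_L_eig_le1[of s \<theta> k] norm_exp_L_eig_le1[of t \<theta> k] that t c
      by (intro order_trans[OF norm_triangle_ineq4] add_mono) auto
    then show ?thesis by (simp add: norm_mult mult_right_mono)
  qed
  have "uniform_limit {0..} (\<lambda>F s. \<Sum>k\<in>F. ?f k s) (\<lambda>s. \<Sum>\<^sub>\<infinity>k. ?f k s) (finite_subsets_at_top UNIV)"
    by (rule Weierstrass_m_test_general[OF bd])
       (auto intro!: summable_on_cmult_right coeff_summable)
  then have "continuous_on {0..} (\<lambda>s. \<Sum>\<^sub>\<infinity>k. ?f k s)"
    by (rule uniform_limit_theorem[rotated])
       (auto intro!: always_eventually continuous_intros)
  then have lim: "((\<lambda>s. \<Sum>\<^sub>\<infinity>k. ?f k s) \<longlongrightarrow> (\<Sum>\<^sub>\<infinity>k. ?f k t)) (at t within {0..})"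
    using t unfolding continuous_on_def by blast
  have eq: "norm (L_semigroup \<theta> s a - L_semigroup \<theta> t a) = (\<Sum>\<^sub>\<infinity>k. ?f k s)" if "s \<ge> 0" for s
    unfolding norm_ell1_eq using that t c
    by (simp add: coeff_L_semigroup algebra_simps)
  have "((\<lambda>s. L_semigroup \<theta> s a - L_semigroup \<theta> t a) \<longlongrightarrow> 0) (at t within {0..})"
  proof (rule Lim_null_comparison)
    show "\<forall>\<^sub>F s in at t within {0..}. norm (L_semigroup \<theta> s a - L_semigroup \<theta> t a) \<le> (\<Sum>\<^sub>\<infinity>k. ?f k s)"
      unfolding eventually_at_filter using eq by (auto intro!: always_eventually)
    show "((\<lambda>s. \<Sum>\<^sub>\<infinity>k. ?f k s) \<longlongrightarrow> 0) (at t within {0..})" using lim by simp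
  qed
  then show ?thesis by (simp add: Lim_null[symmetric])
qed

lemma continuous_on_L_semigroup:
  assumes c: "cos \<theta> \<ge> 0" and g: "continuous_on S g" and f: "continuous_on S f"
    and pos: "\<And>z. z \<in> S \<Longrightarrow> 0 \<le> g z"
  shows "continuous_on S (\<lambda>z. L_semigroup \<theta> (g z) (f z))"
  unfolding continuous_on_def
proof
  fix z assume z: "z \<in> S"
  have "((\<lambda>w. L_semigroup \<theta> (g w) (f z)) \<longlongrightarrow> L_semigroup \<theta> (g z) (f z)) (at z within S)"
  proof -
    have "continuous_on {0..} (\<lambda>s. L_semigroup \<theta> s (f z))"
      unfolding continuous_on_def using tendsto_L_semigroup c by auto
    from continuous_on_compose2[OF this g] pos z show ?thesis
      unfolding continuous_on_def by auto
  qed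
  moreover have "((\<lambda>w. L_semigroup \<theta> (g w) (f w) - L_semigroup \<theta> (g w) (f z)) \<longlongrightarrow> 0) (at z within S)"
  proof (rule Lim_null_comparison)
    show "\<forall>\<^sub>F w in at z within S. norm (L_semigroup \<theta> (g w) (f w) - L_semigroup \<theta> (g w) (f z)) \<le> norm (f w - f z)"
      unfolding eventually_at_filter using pos c
      by (auto intro!: always_eventually simp: L_semigroup_diff norm_L_semigroup_le1)
    have "((\<lambda>w. norm (f w - f z)) \<longlongrightarrow> norm (f z - f z)) (at z within S)"
      using f z unfolding continuous_on_def by (intro tendsto_intros) auto
    then show "((\<lambda>w. norm (f w - f z)) \<longlongrightarrow> 0) (at z within S)" by simp
  qed
  ultimately show "((\<lambda>w. L_semigroup \<theta> (g w) (f w)) \<longlongrightarrow> L_semigroup \<theta> (g z) (f z)) (at z within S)"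
    using tendsto_add by fastforce
qed

section \<open>A Gronwall inequality with a weight\<close>

text \<open>The right-hand side \<open>W\<close> of the inequality for \<open>u\<close> dominates \<open>u\<close> and satisfies
  \<open>W' = - \<mu> W + f \<le> (K - \<mu>) W + p\<close>. If \<open>G' + (K - \<mu>) G \<le> - h\<close>, then
  \<open>(G W)' \<le> - h W + G p \<le> - h u + G p\<close>, and integration gives the claim. Thus \<open>G\<close> acts as a Lyapunov weight:
  an exponential with \<open>h = 0\<close> yields pointwise decay, a constant yields bounds for \<open>\<integral> u\<close>, and
  time-dependent weights exploit rates \<open>K\<close> that decrease with time.\<close>

lemma weighted_gronwall:
  fixes u f p K G G' h :: "real \<Rightarrow> real"
  assumes T: "0 \<le> T"
    and cont: "continuous_on {0..T} u" "continuous_on {0..T} f" "continuous_on {0..T} p"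
      "continuous_on {0..T} h"
    and mild: "\<And>t. t \<in> {0..T} \<Longrightarrow>
        u t \<le> exp (- \<mu> * t) * u0 + integral {0..t} (\<lambda>s. exp (- \<mu> * (t - s)) * f s)"
    and f: "\<And>t. t \<in> {0..T} \<Longrightarrow> f t \<le> K t * u t + p t"
    and nonneg: "\<And>t. t \<in> {0..T} \<Longrightarrow> 0 \<le> u t" "\<And>t. t \<in> {0..T} \<Longrightarrow> 0 \<le> K t"
      "\<And>t. t \<in> {0..T} \<Longrightarrow> 0 \<le> h t" "\<And>t. t \<in> {0..T} \<Longrightarrow> 0 \<le> G t"
    and G: "\<And>t. t \<in> {0..T} \<Longrightarrow> (G has_real_derivative G' t) (at t within {0..T})"
    and weight: "\<And>t. t \<in> {0..T} \<Longrightarrow> G' t + (K t - \<mu>) * G t \<le> - h t"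
  shows "G T * u T + integral {0..T} (\<lambda>t. h t * u t)
           \<le> G 0 * u0 + integral {0..T} (\<lambda>t. G t * p t)"
proof -
  define F where "F t = integral {0..t} (\<lambda>s. exp (\<mu> * s) * f s)" for t
  define W where "W t = exp (- \<mu> * t) * (u0 + F t)" for t
  have F: "(F has_real_derivative exp (\<mu> * t) * f t) (at t within {0..T})" if "t \<in> {0..T}" for t
    unfolding F_def by (intro integral_has_real_derivative continuous_intros cont that)
  have uW: "u t \<le> W t" if "t \<in> {0..T}" for t
  proof -
    have "integral {0..t} (\<lambda>s. exp (- \<mu> * (t - s)) * f s)
        = integral {0..t} (\<lambda>s. exp (- \<mu> * t) * (exp (\<mu> * s) * f s))"
    proof (rule integral_cong)
      fix s
      have "exp (- \<mu> * (t - s)) = exp (- \<mu> * t) * exp (\<mu> * s)"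
        unfolding exp_add[symmetric] by (simp add: algebra_simps)
      then show "exp (- \<mu> * (t - s)) * f s = exp (- \<mu> * t) * (exp (\<mu> * s) * f s)" by simp
    qed
    also have "\<dots> = exp (- \<mu> * t) * F t"
      unfolding F_def by (rule integral_mult_right)
    finally show ?thesis
      using mild[OF that] unfolding W_def by (simp only: distrib_left)
  qed
  have W: "(W has_real_derivative - \<mu> * W t + f t) (at t within {0..T})" if "t \<in> {0..T}" for t
  proof -
    have "(W has_real_derivative
        exp (- \<mu> * t) * (exp (\<mu> * t) * f t) + exp (- \<mu> * t) * - \<mu> * (u0 + F t)) (at t within {0..T})"
      unfolding W_def by (auto intro!: derivative_eq_intros F[OF that])
    moreover have "exp (- \<mu> * t) * (exp (\<mu> * t) * f t) = f t"
      by (simp add: exp_minus)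
    then have "exp (- \<mu> * t) * (exp (\<mu> * t) * f t) + exp (- \<mu> * t) * - \<mu> * (u0 + F t) = - \<mu> * W t + f t"
      by (simp add: W_def)
    ultimately show ?thesis by simp
  qed
  let ?D = "\<lambda>t. G' t * W t + (- \<mu> * W t + f t) * G t"
  have contG: "continuous_on {0..T} G"
    using G by (intro DERIV_continuous_on) auto
  \<comment> \<open>\<open>?D\<close> is the derivative of \<open>G W\<close>.\<close>
  have D: "(?D has_integral (G T * W T - G 0 * W 0)) {0..T}"
  proof (rule fundamental_theorem_of_calculus[OF T])
    fix t assume "t \<in> {0..T}"
    then show "((\<lambda>t. G t * W t) has_vector_derivative ?D t) (at t within {0..T})"
      unfolding has_real_derivative_iff_has_vector_derivative[symmetric]
      by (intro DERIV_mult G W)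
  qed
  have hu: "(\<lambda>t. h t * u t) integrable_on {0..T}"
    by (intro integrable_continuous_real continuous_intros cont)
  have Gp: "(\<lambda>t. G t * p t) integrable_on {0..T}"
    by (intro integrable_continuous_real continuous_intros cont contG)
  have le: "?D t \<le> G t * p t - h t * u t" if "t \<in> {0..T}" for t
  proof -
    have "f t * G t \<le> (K t * W t + p t) * G t"
      using f[OF that] mult_left_mono[OF uW[OF that] nonneg(2)[OF that]] nonneg(4)[OF that]
      by (intro mult_right_mono) auto
    then have "?D t \<le> (G' t + (K t - \<mu>) * G t) * W t + G t * p t"
      by (simp add: algebra_simps)
    also have "\<dots> \<le> - h t * W t + G t * p t"
      using weight[OF that] uW[OF that] nonneg(1)[OF that]
      by (intro add_right_mono mult_right_mono) auto
    also have "\<dots> \<le> G t * p t - h t * u t"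
      using mult_left_mono[OF uW[OF that] nonneg(3)[OF that]] by simp
    finally show ?thesis .
  qed
  have "G T * W T - G 0 * W 0
      \<le> integral {0..T} (\<lambda>t. G t * p t) - integral {0..T} (\<lambda>t. h t * u t)"
    by (rule has_integral_le[OF D has_integral_diff[OF integrable_integral[OF Gp] integrable_integral[OF hu]] le])
  moreover have "G T * u T \<le> G T * W T"
    using uW nonneg(4) T by (intro mult_left_mono) auto
  moreover have "W 0 = u0" by (simp add: W_def F_def)
  ultimately show ?thesis by simp
qed

section \<open>Contractions in a weighted sup norm\<close>

text \<open>The distance of \<open>f\<close> and \<open>g\<close> is the least \<open>D\<close> with \<open>norm (f z - g z) \<le> D * w z\<close> on \<open>A\<close>. The weight
  may vanish, and then it forces \<open>f z = g z\<close>; phrasing everything through this inequality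
  avoids quotients and suprema.\<close>

lemma weighted_fixed_point_unique:
  fixes w :: "'a \<Rightarrow> real" and f g :: "'a \<Rightarrow> 'b :: real_normed_vector"
  assumes c: "0 \<le> c" "c < 1"
    and contr: "\<And>D. 0 \<le> D \<Longrightarrow> \<forall>z\<in>A. norm (f z - g z) \<le> D * w z
                  \<Longrightarrow> \<forall>z\<in>A. norm (T f z - T g z) \<le> c * D * w z"
    and dist: "0 \<le> D" "\<forall>z\<in>A. norm (f z - g z) \<le> D * w z"
    and ext: "f \<in> extensional A" "g \<in> extensional A"
    and fixed: "T f = f" "T g = g"
  shows "f = g"
proof (rule extensionalityI[OF ext])
  fix z assume z: "z \<in> A"
  have "\<forall>z\<in>A. norm (f z - g z) \<le> (c ^ n * D) * w z" for n
  proof (induction n)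
    case (Suc n)
    from contr[OF _ this] c(1) dist(1) show ?case by (simp add: fixed mult.assoc)
  qed (use dist in simp)
  then have "norm (f z - g z) \<le> (c ^ n * D) * w z" for n using z by blast
  moreover have "(\<lambda>n. (c ^ n * D) * w z) \<longlonglongrightarrow> (0 * D) * w z"
    using c by (intro tendsto_intros LIMSEQ_realpow_zero)
  ultimately have "norm (f z - g z) \<le> 0"
    using LIMSEQ_le_const by fastforce
  then show "f z = g z" by simp
qed

text \<open>Picard iteration. Only limits that are uniform with respect to the weight have to
  stay in \<open>F\<close>; both uniformly closed sets of curves and pointwise closed sets of maps qualify.\<close>

lemma weighted_fixed_point_exists:
  fixes w :: "'a \<Rightarrow> real" and F :: "('a \<Rightarrow> 'b :: banach) set"
  assumes c: "0 \<le> c" "c < 1" and w: "\<And>z. z \<in> A \<Longrightarrow> 0 \<le> w z"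
    and ne: "f0 \<in> F" and ext: "F \<subseteq> extensional A"
    and self: "\<And>f. f \<in> F \<Longrightarrow> T f \<in> F"
    and contr: "\<And>f g D. f \<in> F \<Longrightarrow> g \<in> F \<Longrightarrow> 0 \<le> D \<Longrightarrow> \<forall>z\<in>A. norm (f z - g z) \<le> D * w z
                  \<Longrightarrow> \<forall>z\<in>A. norm (T f z - T g z) \<le> c * D * w z"
    and dist: "\<And>f g. f \<in> F \<Longrightarrow> g \<in> F \<Longrightarrow> \<exists>D. \<forall>z\<in>A. norm (f z - g z) \<le> D * w z"
    and closed: "\<And>X l. (\<And>n. X n \<in> F) \<Longrightarrow> l \<in> extensional A \<Longrightarrow>
        (\<And>e. 0 < e \<Longrightarrow> \<forall>\<^sub>F n in sequentially. \<forall>z\<in>A. norm (X n z - l z) \<le> e * w z) \<Longrightarrow> l \<in> F"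
  shows "\<exists>f\<in>F. T f = f"
proof -
  define X where "X n = (T ^^ n) f0" for n
  have X: "X n \<in> F" for n by (induction n) (auto simp: X_def ne self)
  have XS: "X (Suc n) = T (X n)" for n by (simp add: X_def)
  obtain D0 where D0: "\<forall>z\<in>A. norm (X (Suc 0) z - X 0 z) \<le> D0 * w z"
    using dist[OF X X] by blast
  define D where "D = max D0 0"
  have D: "0 \<le> D" by (simp add: D_def)
  have step: "\<forall>z\<in>A. norm (X (Suc n) z - X n z) \<le> (c ^ n * D) * w z" for n
  proof (induction n)
    case 0
    have "D0 * w z \<le> D * w z" if "z \<in> A" for z
      by (intro mult_right_mono w that) (simp add: D_def)
    then show ?case using D0 by force
  next
    case (Suc n)
    from contr[OF X X _ this] show ?case using D c(1) by (simp add: XS mult.assoc)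
  qed
  define B where "B n = c ^ n * D / (1 - c)" for n
  have B0: "B \<longlonglongrightarrow> 0"
  proof -
    have "(\<lambda>n. c ^ n * D / (1 - c)) \<longlonglongrightarrow> 0 * D / (1 - c)"
      using c by (intro tendsto_intros LIMSEQ_realpow_zero) auto
    then show ?thesis by (simp add: B_def[abs_def])
  qed
  have Bpos: "0 \<le> B n" for n using c D by (simp add: B_def)
  have tail: "norm (X (n + k) z - X n z) \<le> (B n - B (n + k)) * w z" if "z \<in> A" for n k z
  proof (induction k)
    case (Suc k)
    have "norm (X (n + Suc k) z - X n z)
        \<le> norm (X (Suc (n + k)) z - X (n + k) z) + norm (X (n + k) z - X n z)"
      using norm_triangle_ineq[of "X (Suc (n + k)) z - X (n + k) z" "X (n + k) z - X n z"] by simp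
    also have "\<dots> \<le> (c ^ (n + k) * D) * w z + (B n - B (n + k)) * w z"
      using step[of "n + k"] that Suc by (intro add_mono) auto
    also have "c ^ (n + k) * D = B (n + k) - B (n + Suc k)"
    proof -
      have "B (n + k) - B (n + Suc k) = (c ^ (n + k) * D * (1 - c)) / (1 - c)"
        unfolding B_def diff_divide_distrib[symmetric] by (simp add: algebra_simps)
      then show ?thesis using c by simp
    qed
    finally show ?case by (simp add: algebra_simps)
  qed simp
  have tail': "norm (X m z - X n z) \<le> B n * w z" if "z \<in> A" "n \<le> m" for z n m
  proof -
    have "(B n - B m) * w z \<le> B n * w z"
      using w[OF that(1)] Bpos[of m] by (intro mult_right_mono) auto
    then show ?thesis using tail[OF that(1), of n "m - n"] that(2) by simp
  qed
  have Bw: "(\<lambda>n. B n * w z) \<longlonglongrightarrow> 0" for z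
    using tendsto_mult_left_zero[OF B0] .
  have "Cauchy (\<lambda>n. X n z)" if z: "z \<in> A" for z
  proof (rule metric_CauchyI)
    fix e :: real assume "0 < e"
    then obtain N where N: "\<bar>B N * w z\<bar> < e / 2"
      using LIMSEQ_D[OF Bw, of "e / 2" z] by auto
    have "dist (X m z) (X n z) < e" if "m \<ge> N" "n \<ge> N" for m n
      using tail'[OF z that(1)] tail'[OF z that(2)] N
        norm_triangle_ineq4[of "X m z - X N z" "X n z - X N z"]
      by (simp add: dist_norm)
    then show "\<exists>M. \<forall>m\<ge>M. \<forall>n\<ge>M. dist (X m z) (X n z) < e" by blast
  qed
  then have "\<forall>z. \<exists>l. z \<in> A \<longrightarrow> (\<lambda>n. X n z) \<longlonglongrightarrow> l"
    by (auto simp: Cauchy_convergent_iff convergent_def)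
  then obtain l0 where l0: "\<And>z. z \<in> A \<Longrightarrow> (\<lambda>n. X n z) \<longlonglongrightarrow> l0 z" by metis
  define l where "l = restrict l0 A"
  have l: "(\<lambda>n. X n z) \<longlonglongrightarrow> l z" if "z \<in> A" for z using l0 that by (simp add: l_def)
  have near: "norm (X n z - l z) \<le> B n * w z" if z: "z \<in> A" for n z
  proof -
    have "(\<lambda>m. norm (X m z - X n z)) \<longlonglongrightarrow> norm (l z - X n z)"
      by (intro tendsto_intros l z)
    then have "norm (l z - X n z) \<le> B n * w z"
      by (rule Lim_bounded) (use tail'[OF z] in auto)
    then show ?thesis by (simp add: norm_minus_commute)
  qed
  have lF: "l \<in> F"
  proof (rule closed[OF X])
    show "l \<in> extensional A" by (simp add: l_def)
    fix e :: real assume "0 < e"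
    then have "\<forall>\<^sub>F n in sequentially. B n < e" using order_tendstoD(2)[OF B0] by blast
    then show "\<forall>\<^sub>F n in sequentially. \<forall>z\<in>A. norm (X n z - l z) \<le> e * w z"
    proof eventually_elim
      case (elim n)
      show ?case
      proof
        fix z assume z: "z \<in> A"
        show "norm (X n z - l z) \<le> e * w z"
          using near[OF z, of n] mult_right_mono[OF less_imp_le[OF elim] w[OF z]] by linarith
      qed
    qed
  qed
  have "T l z = l z" if z: "z \<in> A" for z
  proof -
    have "\<forall>z\<in>A. norm (X n z - l z) \<le> B n * w z" for n using near by simp
    from contr[OF X lF Bpos this] have "norm (T (X n) z - T l z) \<le> c * B n * w z" for n
      using z by simp
    then have "norm (X (Suc n) z - T l z) \<le> c * (B n * w z)" for n by (simp add: XS mult.assoc)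
    moreover have "(\<lambda>n. c * (B n * w z)) \<longlonglongrightarrow> 0" using tendsto_mult_right_zero[OF Bw] .
    ultimately have "(\<lambda>n. X (Suc n) z - T l z) \<longlonglongrightarrow> 0"
      by (intro Lim_null_comparison[of "\<lambda>n. X (Suc n) z - T l z" "\<lambda>n. c * (B n * w z)"]) auto
    then have "(\<lambda>n. X (Suc n) z) \<longlonglongrightarrow> T l z" by (simp add: Lim_null[symmetric])
    then show ?thesis using LIMSEQ_unique LIMSEQ_Suc[OF l[OF z]] by blast
  qed
  then have "T l = l"
    using extensionalityI[of "T l" A l] ext self[OF lF] lF by (simp add: subset_iff)
  then show ?thesis using lF by (intro bexI)
qed

section \<open>Integrals over half-lines\<close>

lemma tendsto_integral_at_top:
  fixes f :: "real \<Rightarrow> 'a :: euclidean_space"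
  assumes f: "f absolutely_integrable_on {a..}"
  shows "((\<lambda>b. integral {a..b} f) \<longlongrightarrow> integral {a..} f) at_top"
proof -
  have "((\<lambda>b. set_lebesgue_integral lebesgue {a..b} f) \<longlongrightarrow> set_lebesgue_integral lebesgue {a..} f) at_top"
    by (rule tendsto_set_lebesgue_integral_at_top[OF _ f]) auto
  moreover have "set_lebesgue_integral lebesgue {a..b} f = integral {a..b} f" for b
    using f by (intro set_lebesgue_integral_eq_integral(2) set_integrable_subset[OF f]) auto
  ultimately show ?thesis by (simp add: set_lebesgue_integral_eq_integral(2)[OF f])
qed

lemma norm_integral_at_top_le:
  fixes f :: "real \<Rightarrow> 'a :: euclidean_space"
  assumes f: "f absolutely_integrable_on {a..}"
    and le: "\<And>b. a \<le> b \<Longrightarrow> norm (integral {a..b} f) \<le> B"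
  shows "norm (integral {a..} f) \<le> B"
proof (rule tendsto_upperbound)
  show "((\<lambda>b. norm (integral {a..b} f)) \<longlongrightarrow> norm (integral {a..} f)) at_top"
    by (intro tendsto_norm tendsto_integral_at_top f)
  show "\<forall>\<^sub>F b in at_top. norm (integral {a..b} f) \<le> B"
    using eventually_ge_at_top[of a] by eventually_elim (rule le)
qed simp

lemma absolutely_integrable_continuous_dominated:
  fixes f :: "real \<Rightarrow> 'a :: euclidean_space"
  assumes f: "continuous_on {a..} f" and g: "g integrable_on {a..}"
    and le: "\<And>t. a \<le> t \<Longrightarrow> norm (f t) \<le> g t"
  shows "f absolutely_integrable_on {a..}"
  by (rule measurable_bounded_by_integrable_imp_absolutely_integrable[OF _ _ g])
     (auto intro!: continuous_imp_measurable_on_sets_lebesgue f le)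

section \<open>The flow on the center space\<close>

lemma cmod_one_minus_sq_ge:
  fixes w :: complex
  assumes "Re w \<le> 0"
  shows "1 + (cmod w)\<^sup>2 \<le> (cmod (1 - w))\<^sup>2"
proof -
  have "(cmod (1 - w))\<^sup>2 = 1 - 2 * Re w + (cmod w)\<^sup>2"
    by (simp add: cmod_power2) (simp add: power2_eq_square algebra_simps)
  then show ?thesis using assms by simp
qed

text \<open>The half-plane condition in \<^const>\<open>Bc\<close> keeps the pole of \<open>\<Phi>(\<cdot>, \<phi>)\<close> away from positive times; the
  quantitative form with the square gives integrability of \<open>\<Phi>\<^sup>2\<close>.\<close>

lemma Phi_denominator:
  assumes "\<phi> \<in> Bc \<theta> r" "0 \<le> t"
  shows "1 + t\<^sup>2 * (cmod \<phi>)\<^sup>2 \<le> (cmod (1 - \<phi> * of_real t * cis \<theta>))\<^sup>2"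
    and "1 \<le> cmod (1 - \<phi> * of_real t * cis \<theta>)"
    and "1 - \<phi> * of_real t * cis \<theta> \<noteq> 0"
proof -
  have "Re (\<phi> * of_real t * cis \<theta>) = t * Re (cis \<theta> * \<phi>)"
    by (simp add: algebra_simps)
  also have "\<dots> \<le> 0" using assms by (simp add: Bc_def mult_nonneg_nonpos)
  finally have "1 + (cmod (\<phi> * of_real t * cis \<theta>))\<^sup>2 \<le> (cmod (1 - \<phi> * of_real t * cis \<theta>))\<^sup>2"
    by (rule cmod_one_minus_sq_ge)
  then show 1: "1 + t\<^sup>2 * (cmod \<phi>)\<^sup>2 \<le> (cmod (1 - \<phi> * of_real t * cis \<theta>))\<^sup>2"
    by (simp add: norm_mult power_mult_distrib mult.commute)
  have "(1::real)\<^sup>2 \<le> (cmod (1 - \<phi> * of_real t * cis \<theta>))\<^sup>2"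
    using order_trans[OF _ 1, of 1] by simp
  then show 2: "1 \<le> cmod (1 - \<phi> * of_real t * cis \<theta>)"
    by (rule power2_le_imp_le) simp
  then show "1 - \<phi> * of_real t * cis \<theta> \<noteq> 0" by (metis norm_zero not_one_le_zero)
qed

lemma norm_Phi_le:
  assumes "\<phi> \<in> Bc \<theta> r" "0 \<le> t"
  shows "cmod (Phi \<theta> t \<phi>) \<le> cmod \<phi>"
proof -
  have "cmod \<phi> / cmod (1 - \<phi> * of_real t * cis \<theta>) \<le> cmod \<phi> / 1"
    using Phi_denominator(2)[OF assms] by (intro divide_left_mono) auto
  then show ?thesis by (simp add: Phi_def norm_divide)
qed

lemma norm_Phi_le_radius:
  assumes "\<phi> \<in> Bc \<theta> r" "0 \<le> t"
  shows "cmod (Phi \<theta> t \<phi>) \<le> r"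
  using norm_Phi_le[OF assms] assms(1) by (simp add: Bc_def)

lemma Phi_in_Bc:
  assumes "\<phi> \<in> Bc \<theta> r" "0 \<le> t"
  shows "Phi \<theta> t \<phi> \<in> Bc \<theta> r"
proof -
  define w where "w = cis \<theta> * \<phi>"
  have w: "Re w \<le> 0" using assms by (simp add: w_def Bc_def)
  have "cis \<theta> * Phi \<theta> t \<phi> = w / (1 - of_real t * w)"
    by (simp add: Phi_def w_def mult_ac)
  moreover have "Re (w / (1 - of_real t * w))
      = (Re w - t * ((Re w)\<^sup>2 + (Im w)\<^sup>2)) / (cmod (1 - of_real t * w))\<^sup>2"
    by (simp add: Re_divide cmod_power2) (simp add: power2_eq_square algebra_simps)
  moreover have "\<dots> \<le> 0"
  proof (rule divide_nonpos_nonneg)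
    have "0 \<le> t * ((Re w)\<^sup>2 + (Im w)\<^sup>2)" using assms(2) by (intro mult_nonneg_nonneg) auto
    then show "Re w - t * ((Re w)\<^sup>2 + (Im w)\<^sup>2) \<le> 0" using w by linarith
  qed simp
  ultimately have "Re (cis \<theta> * Phi \<theta> t \<phi>) \<le> 0" by metis
  then show ?thesis
    using norm_Phi_le_radius[OF assms] by (simp add: Bc_def)
qed

text \<open>\<open>\<Phi>(t, \<phi>) - \<Phi>(t, \<psi>)\<close> equals \<open>\<phi> - \<psi>\<close> divided by the product of the two denominators, each of modulus at
  least \<open>1\<close>.\<close>

lemma norm_Phi_diff_le:
  assumes "\<phi> \<in> Bc \<theta> r" "\<psi> \<in> Bc \<theta> r" "0 \<le> t"
  shows "cmod (Phi \<theta> t \<phi> - Phi \<theta> t \<psi>) \<le> cmod (\<phi> - \<psi>)"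
proof -
  let ?a = "1 - \<phi> * of_real t * cis \<theta>" and ?b = "1 - \<psi> * of_real t * cis \<theta>"
  have nz: "?a \<noteq> 0" "?b \<noteq> 0" using Phi_denominator(3) assms by blast+
  have "Phi \<theta> t \<phi> - Phi \<theta> t \<psi> = (\<phi> - \<psi>) / (?a * ?b)"
    using nz by (simp add: Phi_def diff_frac_eq) (simp add: algebra_simps)
  moreover have "1 \<le> cmod ?a * cmod ?b"
    using mult_mono[OF Phi_denominator(2)[OF assms(1,3)] Phi_denominator(2)[OF assms(2,3)]] by simp
  then have "cmod (\<phi> - \<psi>) / (cmod ?a * cmod ?b) \<le> cmod (\<phi> - \<psi>) / 1"
    by (intro divide_left_mono) auto
  ultimately show ?thesis by (simp add: norm_divide norm_mult)
qed

lemma Phi_has_vector_derivative: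
  assumes "\<phi> \<in> Bc \<theta> r" "0 \<le> t"
  shows "((\<lambda>t. Phi \<theta> t \<phi>) has_vector_derivative cis \<theta> * (Phi \<theta> t \<phi>)\<^sup>2) (at t within S)"
proof -
  have nz: "1 - \<phi> * of_real t * cis \<theta> \<noteq> 0" by (rule Phi_denominator(3)[OF assms])
  have "((\<lambda>z. \<phi> / (1 - \<phi> * z * cis \<theta>)) has_field_derivative
          cis \<theta> * (\<phi> / (1 - \<phi> * of_real t * cis \<theta>))\<^sup>2) (at (of_real t))"
    using nz by (auto intro!: derivative_eq_intros simp: power2_eq_square divide_simps)
  from has_vector_derivative_real_field[OF this]
  have "((\<lambda>t. Phi \<theta> t \<phi>) has_vector_derivative cis \<theta> * (Phi \<theta> t \<phi>)\<^sup>2) (at t)"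
    by (simp add: Phi_def)
  then show ?thesis by (rule has_vector_derivative_at_within)
qed

lemma continuous_on_Phi:
  assumes "\<phi> \<in> Bc \<theta> r"
  shows "continuous_on {0..} (\<lambda>t. Phi \<theta> t \<phi>)"
  using Phi_has_vector_derivative[OF assms] has_vector_derivative_continuous
  by (fastforce simp: continuous_on_eq_continuous_within)

text \<open>\<open>\<bar>\<Phi>\<bar>\<^sup>2\<close> is dominated by the derivative of \<open>\<bar>\<phi>\<bar> arctan (\<bar>\<phi>\<bar> t)\<close>, and the antiderivative \<open>\<Phi>\<close> of
  \<open>e\<^bsup>i\<theta>\<^esup> \<Phi>\<^sup>2\<close> decays like \<open>1 / t\<close>.\<close>

lemma Phi_square_integral:
  assumes "\<phi> \<in> Bc \<theta> r"
  shows "(\<lambda>t. cis \<theta> * (Phi \<theta> t \<phi>)\<^sup>2) absolutely_integrable_on {0..}"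
    and "integral {0..} (\<lambda>t. cis \<theta> * (Phi \<theta> t \<phi>)\<^sup>2) = - \<phi>"
proof -
  let ?f = "\<lambda>t. cis \<theta> * (Phi \<theta> t \<phi>)\<^sup>2"
  let ?g = "\<lambda>t. (cmod \<phi>)\<^sup>2 / (1 + (t * cmod \<phi>)\<^sup>2)"
  have nz: "1 + (t * cmod \<phi>)\<^sup>2 \<noteq> 0" for t :: real by (metis add_pos_nonneg less_irrefl zero_le_power2 zero_less_one)
  have gd: "((\<lambda>t. cmod \<phi> * arctan (t * cmod \<phi>)) has_vector_derivative ?g t) (at t within S)" for t S
    unfolding has_real_derivative_iff_has_vector_derivative[symmetric]
    using nz[of t] by (auto intro!: derivative_eq_intros simp: power2_eq_square field_simps)
  have gi: "(?g has_integral cmod \<phi> * (pi / 2)) {0..}"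
  proof (rule has_integral_to_inf)
    show "?g integrable_on {0..y}" for y
      using nz by (intro integrable_continuous_real continuous_intros) auto
    have "\<forall>\<^sub>F y in at_top. integral {0..y} ?g = cmod \<phi> * arctan (y * cmod \<phi>)"
      using eventually_ge_at_top[of 0]
    proof eventually_elim
      case (elim y)
      then have "(?g has_integral (cmod \<phi> * arctan (y * cmod \<phi>) - cmod \<phi> * arctan (0 * cmod \<phi>))) {0..y}"
        by (intro fundamental_theorem_of_calculus gd) auto
      then show ?case by (simp add: integral_unique)
    qed
    moreover have "((\<lambda>y. cmod \<phi> * arctan (y * cmod \<phi>)) \<longlongrightarrow> cmod \<phi> * (pi / 2)) at_top"
    proof (cases "\<phi> = 0")
      case False
      then have "filterlim (\<lambda>y. y * cmod \<phi>) at_top at_top"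
        by (intro filterlim_at_top_mult_tendsto_pos[OF tendsto_const] filterlim_ident) auto
      then show ?thesis
        by (intro tendsto_intros filterlim_compose[OF tendsto_arctan_at_top])
    qed simp
    ultimately show "((\<lambda>y. integral {0..y} ?g) \<longlongrightarrow> cmod \<phi> * (pi / 2)) at_top"
      by (simp add: tendsto_cong)
    show "0 \<le> ?g y" for y by (intro divide_nonneg_nonneg add_nonneg_nonneg) auto
  qed
  show ai: "?f absolutely_integrable_on {0..}"
  proof (rule absolutely_integrable_continuous_dominated)
    show "continuous_on {0..} ?f" by (intro continuous_intros continuous_on_Phi[OF assms])
    show "?g integrable_on {0..}" using gi by blast
    fix t :: real assume t: "0 \<le> t"
    have "cmod (?f t) = (cmod \<phi>)\<^sup>2 / (cmod (1 - \<phi> * of_real t * cis \<theta>))\<^sup>2"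
      by (simp add: norm_mult norm_power Phi_def norm_divide power_divide)
    also have "\<dots> \<le> ?g t"
    proof (rule divide_left_mono)
      show "1 + (t * cmod \<phi>)\<^sup>2 \<le> (cmod (1 - \<phi> * of_real t * cis \<theta>))\<^sup>2"
        using Phi_denominator(1)[OF assms t] by (simp add: power_mult_distrib)
      have "0 < 1 + (t * cmod \<phi>)\<^sup>2" by (simp add: add_pos_nonneg)
      moreover have "0 < (cmod (1 - \<phi> * of_real t * cis \<theta>))\<^sup>2"
        using Phi_denominator(3)[OF assms t] by simp
      ultimately show "0 < (cmod (1 - \<phi> * of_real t * cis \<theta>))\<^sup>2 * (1 + (t * cmod \<phi>)\<^sup>2)"
        by (intro mult_pos_pos)
    qed simp
    finally show "norm (?f t) \<le> ?g t" .
  qed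
  have "((\<lambda>b. integral {0..b} ?f) \<longlongrightarrow> - \<phi>) at_top"
  proof -
    have ev: "\<forall>\<^sub>F b in at_top. Phi \<theta> b \<phi> - \<phi> = integral {0..b} ?f"
      using eventually_ge_at_top[of 0]
    proof eventually_elim
      case (elim b)
      have "(?f has_integral (Phi \<theta> b \<phi> - Phi \<theta> 0 \<phi>)) {0..b}"
        using elim by (intro fundamental_theorem_of_calculus Phi_has_vector_derivative[OF assms]) auto
      then have "integral {0..b} ?f = Phi \<theta> b \<phi> - Phi \<theta> 0 \<phi>" by (rule integral_unique)
      then show ?case by (simp only: Phi_def) simp
    qed
    have "((\<lambda>b. Phi \<theta> b \<phi>) \<longlongrightarrow> 0) at_top"
    proof (rule Lim_null_comparison)
      show "((\<lambda>b. inverse b) \<longlongrightarrow> (0::real)) at_top"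
        by (rule tendsto_inverse_0_at_top[OF filterlim_ident])
      show "\<forall>\<^sub>F b in at_top. norm (Phi \<theta> b \<phi>) \<le> inverse b"
        using eventually_gt_at_top[of 0]
      proof eventually_elim
        case (elim b)
        have "(b * cmod \<phi>)\<^sup>2 \<le> (cmod (1 - \<phi> * of_real b * cis \<theta>))\<^sup>2"
          using Phi_denominator(1)[OF assms, of b] elim by (simp add: power_mult_distrib)
        then have "b * cmod \<phi> \<le> cmod (1 - \<phi> * of_real b * cis \<theta>)"
          by (rule power2_le_imp_le) simp
        moreover have "0 < cmod (1 - \<phi> * of_real b * cis \<theta>)"
          using Phi_denominator(3)[OF assms, of b] elim by simp
        ultimately show ?case using elim
          by (simp add: Phi_def norm_divide divide_le_eq inverse_eq_divide le_divide_eq mult.commute)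
      qed
    qed
    then have "((\<lambda>b. Phi \<theta> b \<phi> - \<phi>) \<longlongrightarrow> 0 - \<phi>) at_top" by (intro tendsto_intros)
    then show ?thesis using tendsto_cong[OF ev, of "- \<phi>"] by simp
  qed
  then show "integral {0..} ?f = - \<phi>"
    using tendsto_integral_at_top[OF ai] tendsto_unique by (metis trivial_limit_at_top_linorder)
qed

section \<open>Variation of constants\<close>

lemma continuous_on_duhamel_integrand:
  assumes "cos \<theta> \<ge> 0" "continuous_on {0..} f"
  shows "continuous_on {0..t} (\<lambda>s. L_semigroup \<theta> (t - s) (f s))"
  using assms by (intro continuous_on_L_semigroup continuous_intros) (auto elim: continuous_on_subset)

lemma duhamel_integrable:
  assumes "cos \<theta> \<ge> 0" "continuous_on {0..} f"
  shows "(\<lambda>s. L_semigroup \<theta> (t - s) (f s)) integrable_on {0..t}"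
  by (intro integrable_continuous_real continuous_on_duhamel_integrand assms)

text \<open>Rescaling \<open>s = t v\<close> moves the variable endpoint into the integrand, which is jointly continuous
  on \<open>[0, \<infinity>) \<times> [0, 1]\<close>.\<close>

lemma continuous_on_duhamel:
  assumes c: "cos \<theta> \<ge> 0" and f: "continuous_on {0..} f"
  shows "continuous_on {0..} (\<lambda>t. integral {0..t} (\<lambda>s. L_semigroup \<theta> (t - s) (f s)))"
proof -
  let ?g = "\<lambda>t s. L_semigroup \<theta> (t - s) (f s)"
  have "continuous_on ({0..} \<times> cbox 0 1) (\<lambda>(t, v). t *\<^sub>R ?g t (t * v))"
    unfolding case_prod_unfold
  proof (intro continuous_on_scaleR continuous_on_L_semigroup c)
    show "continuous_on ({0..} \<times> cbox 0 1) (\<lambda>p. f (fst p * snd p))"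
      by (rule continuous_on_compose2[OF f]) (auto intro!: continuous_intros)
    show "0 \<le> fst p - fst p * snd p" if "p \<in> {0..} \<times> cbox 0 1" for p :: "real \<times> real"
      using that by (auto simp: mult_left_le)
  qed (intro continuous_intros)+
  then have "continuous_on {0..} (\<lambda>t. integral (cbox 0 1) (\<lambda>v. t *\<^sub>R ?g t (t * v)))"
    by (rule integral_continuous_on_param)
  moreover have "integral (cbox 0 1) (\<lambda>v. t *\<^sub>R ?g t (t * v)) = integral {0..t} (?g t)" if "t \<in> {0..}" for t
  proof (cases "t = 0")
    case False
    with that have t: "t > 0" by simp
    have "(?g t has_integral integral {0..t} (?g t)) {0..t}"
      by (intro integrable_integral duhamel_integrable assms)
    from has_integral_stretch_real[OF this, of t] t
    have "((\<lambda>v. ?g t (t * v)) has_integral (1 / t) *\<^sub>R integral {0..t} (?g t)) {0..1}"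
      by (simp add: image_divide_atLeastAtMost)
    from has_integral_cmul[OF this, of t] t
    have "((\<lambda>v. t *\<^sub>R ?g t (t * v)) has_integral integral {0..t} (?g t)) {0..1}" by simp
    then show ?thesis unfolding cbox_interval by (rule integral_unique)
  qed simp
  ultimately show ?thesis by (rule continuous_on_eq)
qed

lemma duhamel_in_Xs:
  assumes "cos \<theta> \<ge> 0" "continuous_on {0..} f" "\<And>s. 0 \<le> s \<Longrightarrow> f s \<in> Xs"
  shows "integral {0..t} (\<lambda>s. L_semigroup \<theta> (t - s) (f s)) \<in> Xs"
proof -
  let ?g = "\<lambda>s. L_semigroup \<theta> (t - s) (f s)"
  have "coeff (integral {0..t} ?g) 0 = integral {0..t} ((\<lambda>a. coeff a 0) \<circ> ?g)"
    by (rule integral_linear[OF duhamel_integrable bounded_linear_coeff, symmetric]) (fact assms)+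
  also have "\<dots> = integral {0..t} (\<lambda>s. 0)"
    using L_semigroup_in_Xs[OF _ assms(1) assms(3)]
    by (intro integral_cong) (auto simp: Xs_def)
  finally show ?thesis by (simp add: Xs_def)
qed

lemma norm_duhamel_diff_le:
  assumes c: "cos \<theta> \<ge> 0" and f: "continuous_on {0..} f" "\<And>s. 0 \<le> s \<Longrightarrow> f s \<in> Xs"
    and g: "continuous_on {0..} g" "\<And>s. 0 \<le> s \<Longrightarrow> g s \<in> Xs"
  shows "norm (integral {0..t} (\<lambda>s. L_semigroup \<theta> (t - s) (f s))
             - integral {0..t} (\<lambda>s. L_semigroup \<theta> (t - s) (g s)))
           \<le> integral {0..t} (\<lambda>s. exp (- (omega\<^sup>2 * cos \<theta>) * (t - s)) * norm (f s - g s))"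
proof -
  have fg: "continuous_on {0..} (\<lambda>s. f s - g s)" by (intro continuous_intros f g)
  have "integral {0..t} (\<lambda>s. L_semigroup \<theta> (t - s) (f s)) - integral {0..t} (\<lambda>s. L_semigroup \<theta> (t - s) (g s))
      = integral {0..t} (\<lambda>s. L_semigroup \<theta> (t - s) (f s) - L_semigroup \<theta> (t - s) (g s))"
    by (intro integral_diff[symmetric] duhamel_integrable c f g)
  also have "\<dots> = integral {0..t} (\<lambda>s. L_semigroup \<theta> (t - s) (f s - g s))"
    using c by (intro integral_cong) (auto simp: L_semigroup_diff)
  also have "norm \<dots> \<le> integral {0..t} (\<lambda>s. exp (- (omega\<^sup>2 * cos \<theta>) * (t - s)) * norm (f s - g s))"
  proof (rule integral_norm_bound_integral)
    show "(\<lambda>s. L_semigroup \<theta> (t - s) (f s - g s)) integrable_on {0..t}"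
      by (rule duhamel_integrable[OF c fg])
    show "(\<lambda>s. exp (- (omega\<^sup>2 * cos \<theta>) * (t - s)) * norm (f s - g s)) integrable_on {0..t}"
      by (intro integrable_continuous_real continuous_intros continuous_on_subset[OF f(1)]
          continuous_on_subset[OF g(1)]) auto
    fix s assume s: "s \<in> {0..t}"
    then have "f s - g s \<in> Xs" using f(2)[of s] g(2)[of s] by (simp add: Xs_def)
    then show "norm (L_semigroup \<theta> (t - s) (f s - g s)) \<le> exp (- (omega\<^sup>2 * cos \<theta>) * (t - s)) * norm (f s - g s)"
      using s c by (intro norm_L_semigroup_le) auto
  qed
  finally show ?thesis .
qed

lemma integral_exp_kernel:
  fixes \<mu> t C :: real
  assumes "\<mu> \<noteq> 0" "0 \<le> t"
  shows "integral {0..t} (\<lambda>s. exp (- \<mu> * (t - s)) * C) = C * (1 - exp (- \<mu> * t)) / \<mu>"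
proof -
  have "((\<lambda>s. exp (- \<mu> * (t - s)) * C) has_integral
      (exp (- \<mu> * (t - t)) * C / \<mu> - exp (- \<mu> * (t - 0)) * C / \<mu>)) {0..t}"
  proof (rule fundamental_theorem_of_calculus[OF assms(2)])
    fix s
    show "((\<lambda>s. exp (- \<mu> * (t - s)) * C / \<mu>) has_vector_derivative exp (- \<mu> * (t - s)) * C) (at s within {0..t})"
      unfolding has_real_derivative_iff_has_vector_derivative[symmetric]
      using assms(1) by (auto intro!: derivative_eq_intros)
  qed
  then have "integral {0..t} (\<lambda>s. exp (- \<mu> * (t - s)) * C)
      = exp (- \<mu> * (t - t)) * C / \<mu> - exp (- \<mu> * (t - 0)) * C / \<mu>"
    by (rule integral_unique)
  also have "\<dots> = C * (1 - exp (- \<mu> * t)) / \<mu>"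
    by (simp add: diff_divide_distrib right_diff_distrib mult.commute)
  finally show ?thesis .
qed

lemma closed_Bs: "closed (Bs r)"
proof -
  have "Bs r = (\<lambda>a. coeff a 0) -` {0} \<inter> cball 0 r" by (auto simp: Bs_def Xs_def)
  moreover have "continuous_on UNIV (\<lambda>a. coeff a 0)"
    using bounded_linear_coeff by (rule linear_continuous_on)
  ultimately show ?thesis
    by (auto intro!: closed_Int closed_vimage)
qed

section \<open>Mild solutions of the stable equation\<close>

text \<open>\<open>\<kappa>\<close> bounds from below the decay rate of a solution in \<open>B\<^sub>s\<close>, and \<open>\<nu>\<close> the rate at which two such solutions
  approach each other.\<close>

locale slow_fast =
  fixes \<theta> r\<^sub>c r\<^sub>s \<rho> \<mu> \<kappa> \<nu> :: real
  assumes cos_pos: "0 < cos \<theta>" and mu: "\<mu> = omega\<^sup>2 * cos \<theta>"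
    and pos: "0 < r\<^sub>c" "0 < r\<^sub>s" "0 < \<rho>"
    and kappa: "\<kappa> = \<mu> - (2 * r\<^sub>c + (1 + 2 * \<rho>) * r\<^sub>s)" "0 < \<kappa>"
    and nu: "\<nu> = \<mu> - 2 * (r\<^sub>c + 2 * \<rho> * r\<^sub>s + r\<^sub>s)" "0 < \<nu>"
begin

lemma mu_pos: "0 < \<mu>"
  using cos_pos mu by (simp add: omega_def)

text \<open>Lipschitz continuity is weakened to continuity: the Lipschitz constant in \<open>\<phi>\<close> of a map in
  \<^const>\<open>LP_maps\<close> is not controlled, so no estimate may depend on it.\<close>

definition admissible :: "(complex \<times> ell1 \<Rightarrow> complex) \<Rightarrow> bool" where
  "admissible \<alpha> \<longleftrightarrow> continuous_on (Bc \<theta> r\<^sub>c \<times> Bs r\<^sub>s) \<alpha> \<and>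
     (\<forall>\<phi>\<in>Bc \<theta> r\<^sub>c. \<alpha> (\<phi>, 0) = \<phi>) \<and>
     (\<forall>\<phi>\<in>Bc \<theta> r\<^sub>c. \<forall>x\<in>Bs r\<^sub>s. \<forall>y\<in>Bs r\<^sub>s. cmod (\<alpha> (\<phi>, x) - \<alpha> (\<phi>, y)) \<le> \<rho> * norm (x - y))"

lemma LP_maps_admissible: "\<alpha> \<in> LP_maps \<theta> r\<^sub>c r\<^sub>s \<rho> \<Longrightarrow> admissible \<alpha>"
  by (auto simp: LP_maps_def admissible_def intro: lipschitz_on_continuous_on)

lemma zero_in_Bs: "0 \<in> Bs r\<^sub>s"
  using pos by (simp add: Bs_def Xs_def)

lemma admissible_lipschitz:
  assumes "admissible \<alpha>" "\<phi> \<in> Bc \<theta> r\<^sub>c" "x \<in> Bs r\<^sub>s" "y \<in> Bs r\<^sub>s"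
  shows "cmod (\<alpha> (\<phi>, x) - \<alpha> (\<phi>, y)) \<le> \<rho> * norm (x - y)"
  using assms by (simp add: admissible_def)

lemma admissible_near:
  assumes "admissible \<alpha>" "\<phi> \<in> Bc \<theta> r\<^sub>c" "x \<in> Bs r\<^sub>s"
  shows "cmod (\<alpha> (\<phi>, x) - \<phi>) \<le> \<rho> * norm x"
  using admissible_lipschitz[OF assms zero_in_Bs] assms by (simp add: admissible_def)

lemma admissible_bound:
  assumes "admissible \<alpha>" "\<phi> \<in> Bc \<theta> r\<^sub>c" "x \<in> Bs r\<^sub>s"
  shows "cmod (\<alpha> (\<phi>, x)) \<le> r\<^sub>c + \<rho> * norm x"
proof -
  have "cmod (\<alpha> (\<phi>, x)) \<le> cmod \<phi> + cmod (\<alpha> (\<phi>, x) - \<phi>)"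
    using norm_triangle_ineq[of \<phi> "\<alpha> (\<phi>, x) - \<phi>"] by simp
  then show ?thesis using admissible_near[OF assms] assms(2) by (simp add: Bc_def)
qed

definition curve :: "(real \<Rightarrow> ell1) \<Rightarrow> bool" where
  "curve x \<longleftrightarrow> continuous_on {0..} x \<and> (\<forall>t\<ge>0. x t \<in> Bs r\<^sub>s)"

definition forcing :: "(complex \<times> ell1 \<Rightarrow> complex) \<Rightarrow> complex \<Rightarrow> (real \<Rightarrow> ell1) \<Rightarrow> real \<Rightarrow> ell1" where
  "forcing \<alpha> \<phi> x t = Ns \<theta> (\<alpha> (Phi \<theta> t \<phi>, x t)) (x t)"

lemma curve_in_Xs: "curve x \<Longrightarrow> 0 \<le> t \<Longrightarrow> x t \<in> Xs"
  by (simp add: curve_def Bs_def)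

lemma curve_norm_le: "curve x \<Longrightarrow> 0 \<le> t \<Longrightarrow> norm (x t) \<le> r\<^sub>s"
  by (simp add: curve_def Bs_def)

lemma continuous_on_alpha_curve:
  assumes "admissible \<alpha>" "\<phi> \<in> Bc \<theta> r\<^sub>c" "curve x"
  shows "continuous_on {0..} (\<lambda>t. \<alpha> (Phi \<theta> t \<phi>, x t))"
  by (rule continuous_on_compose2[of "Bc \<theta> r\<^sub>c \<times> Bs r\<^sub>s" \<alpha>])
     (use assms in \<open>auto simp: admissible_def curve_def Phi_in_Bc
        intro!: continuous_on_Pair continuous_on_Phi\<close>)

lemma continuous_on_forcing:
  assumes "admissible \<alpha>" "\<phi> \<in> Bc \<theta> r\<^sub>c" "curve x"
  shows "continuous_on {0..} (forcing \<alpha> \<phi> x)"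
  unfolding forcing_def[abs_def]
  using assms(3) curve_in_Xs by (intro continuous_on_Ns continuous_on_alpha_curve assms) (auto simp: curve_def)

lemma forcing_in_Xs: "forcing \<alpha> \<phi> x t \<in> Xs"
  by (simp add: forcing_def Ns_in_Xs)

lemma norm_forcing_le:
  assumes "admissible \<alpha>" "\<phi> \<in> Bc \<theta> r\<^sub>c" "curve x" "0 \<le> t"
  shows "norm (forcing \<alpha> \<phi> x t) \<le> (\<mu> - \<kappa>) * norm (x t)"
proof -
  have xB: "x t \<in> Bs r\<^sub>s" using assms by (simp add: curve_def)
  have "norm (forcing \<alpha> \<phi> x t) \<le> (2 * cmod (\<alpha> (Phi \<theta> t \<phi>, x t)) + norm (x t)) * norm (x t)"
    unfolding forcing_def by (rule norm_Ns_le) (rule curve_in_Xs[OF assms(3,4)])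
  also have "\<dots> \<le> (2 * (r\<^sub>c + \<rho> * r\<^sub>s) + r\<^sub>s) * norm (x t)"
  proof (rule mult_right_mono)
    have "\<rho> * norm (x t) \<le> \<rho> * r\<^sub>s"
      using pos by (intro mult_left_mono curve_norm_le[OF assms(3,4)]) auto
    then have "cmod (\<alpha> (Phi \<theta> t \<phi>, x t)) \<le> r\<^sub>c + \<rho> * r\<^sub>s"
      using admissible_bound[OF assms(1) Phi_in_Bc[OF assms(2,4)] xB] by linarith
    then show "2 * cmod (\<alpha> (Phi \<theta> t \<phi>, x t)) + norm (x t) \<le> 2 * (r\<^sub>c + \<rho> * r\<^sub>s) + r\<^sub>s"
      using curve_norm_le[OF assms(3,4)] by (intro add_mono mult_left_mono) auto
  qed simp
  also have "\<dots> = (\<mu> - \<kappa>) * norm (x t)" by (simp add: kappa algebra_simps)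
  finally show ?thesis .
qed

text \<open>The Lipschitz factor keeps the actual norms of \<open>x t\<close> and \<open>y t\<close>. Bounding them by \<open>r\<^sub>s\<close> gives the
  constant \<open>\<mu> - \<nu>\<close> of \<open>local_rate_le\<close>; keeping them is essential in \<open>Psi_lipschitz_xs\<close>.\<close>

lemma norm_forcing_diff_le:
  assumes \<alpha>: "admissible \<alpha>" and \<beta>: "admissible \<beta>" and \<phi>: "\<phi> \<in> Bc \<theta> r\<^sub>c" and \<psi>: "\<psi> \<in> Bc \<theta> r\<^sub>c"
    and x: "curve x" and y: "curve y" and t: "0 \<le> t"
    and E: "cmod (\<alpha> (Phi \<theta> t \<phi>, y t) - \<beta> (Phi \<theta> t \<psi>, y t)) \<le> E"
  shows "norm (forcing \<alpha> \<phi> x t - forcing \<beta> \<psi> y t)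
           \<le> (2 * r\<^sub>c + (2 * \<rho> + 1) * (norm (x t) + norm (y t))) * norm (x t - y t) + 2 * E * norm (y t)"
proof -
  have B: "x t \<in> Bs r\<^sub>s" "y t \<in> Bs r\<^sub>s" using x y t by (simp_all add: curve_def)
  let ?c = "\<alpha> (Phi \<theta> t \<phi>, x t)" and ?d = "\<beta> (Phi \<theta> t \<psi>, y t)"
  have cd: "cmod (?c - ?d) \<le> \<rho> * norm (x t - y t) + E"
    using admissible_lipschitz[OF \<alpha> Phi_in_Bc[OF \<phi> t] B] E
      norm_triangle_ineq[of "?c - \<alpha> (Phi \<theta> t \<phi>, y t)" "\<alpha> (Phi \<theta> t \<phi>, y t) - ?d"]
    by simp
  have "norm (forcing \<alpha> \<phi> x t - forcing \<beta> \<psi> y t)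
      \<le> 2 * cmod (?c - ?d) * norm (y t) + (2 * cmod ?c + norm (x t) + norm (y t)) * norm (x t - y t)"
    unfolding forcing_def by (intro norm_Ns_diff_le curve_in_Xs x y t)
  also have "\<dots> \<le> 2 * (\<rho> * norm (x t - y t) + E) * norm (y t)
      + (2 * (r\<^sub>c + \<rho> * norm (x t)) + norm (x t) + norm (y t)) * norm (x t - y t)"
    using cd admissible_bound[OF \<alpha> Phi_in_Bc[OF \<phi> t] B(1)] by (intro add_mono mult_right_mono) auto
  finally show ?thesis by (simp add: algebra_simps)
qed

lemma local_rate_le:
  assumes "curve x" "curve y" "0 \<le> t"
  shows "2 * r\<^sub>c + (2 * \<rho> + 1) * (norm (x t) + norm (y t)) \<le> \<mu> - \<nu>"
proof -
  have "(2 * \<rho> + 1) * (norm (x t) + norm (y t)) \<le> (2 * \<rho> + 1) * (r\<^sub>s + r\<^sub>s)"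
    using pos assms by (intro mult_left_mono add_mono curve_norm_le) auto
  then show ?thesis by (simp add: nu algebra_simps)
qed

text \<open>Restricted to \<open>[0, \<infinity>)\<close>, so that its fixed points are exactly the extensional mild solutions.\<close>

definition mild_map ::
  "(complex \<times> ell1 \<Rightarrow> complex) \<Rightarrow> complex \<Rightarrow> ell1 \<Rightarrow> (real \<Rightarrow> ell1) \<Rightarrow> real \<Rightarrow> ell1" where
  "mild_map \<alpha> \<phi> \<xi> x = (\<lambda>t\<in>{0..}. L_semigroup \<theta> t \<xi>
     + integral {0..t} (\<lambda>s. L_semigroup \<theta> (t - s) (forcing \<alpha> \<phi> x s)))"

lemma mild_solution_iff:
  "mild_solution \<theta> r\<^sub>s \<alpha> \<phi> \<xi> x \<longleftrightarrow> curve x \<and> (\<forall>t\<ge>0. x t = mild_map \<alpha> \<phi> \<xi> x t)"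
  unfolding mild_solution_def curve_def mild_map_def forcing_def by simp

lemma norm_mild_map_diff_le:
  assumes "admissible \<alpha>" "\<phi> \<in> Bc \<theta> r\<^sub>c" "curve x" "admissible \<beta>" "\<psi> \<in> Bc \<theta> r\<^sub>c" "curve y"
    and "\<xi> \<in> Bs r\<^sub>s" "\<zeta> \<in> Bs r\<^sub>s" "0 \<le> t"
  shows "norm (mild_map \<alpha> \<phi> \<xi> x t - mild_map \<beta> \<psi> \<zeta> y t) \<le> exp (- \<mu> * t) * norm (\<xi> - \<zeta>)
           + integral {0..t} (\<lambda>s. exp (- \<mu> * (t - s)) * norm (forcing \<alpha> \<phi> x s - forcing \<beta> \<psi> y s))"
proof -
  let ?I = "\<lambda>f. integral {0..t} (\<lambda>s. L_semigroup \<theta> (t - s) (f s))"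
  have "mild_map \<alpha> \<phi> \<xi> x t - mild_map \<beta> \<psi> \<zeta> y t
      = L_semigroup \<theta> t (\<xi> - \<zeta>) + (?I (forcing \<alpha> \<phi> x) - ?I (forcing \<beta> \<psi> y))"
    using assms cos_pos by (simp add: mild_map_def L_semigroup_diff[symmetric])
  then have "norm (mild_map \<alpha> \<phi> \<xi> x t - mild_map \<beta> \<psi> \<zeta> y t)
      \<le> norm (L_semigroup \<theta> t (\<xi> - \<zeta>)) + norm (?I (forcing \<alpha> \<phi> x) - ?I (forcing \<beta> \<psi> y))"
    by (simp only: norm_triangle_ineq)
  moreover have "norm (L_semigroup \<theta> t (\<xi> - \<zeta>)) \<le> exp (- \<mu> * t) * norm (\<xi> - \<zeta>)"
  proof -
    have "\<xi> - \<zeta> \<in> Xs" using assms(7,8) by (simp add: Bs_def Xs_def)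
    then show ?thesis unfolding mu using assms(9) cos_pos by (intro norm_L_semigroup_le) simp_all
  qed
  moreover have "norm (?I (forcing \<alpha> \<phi> x) - ?I (forcing \<beta> \<psi> y))
      \<le> integral {0..t} (\<lambda>s. exp (- \<mu> * (t - s)) * norm (forcing \<alpha> \<phi> x s - forcing \<beta> \<psi> y s))"
    unfolding mu using cos_pos
    by (intro norm_duhamel_diff_le continuous_on_forcing forcing_in_Xs assms(1-6)) simp
  ultimately show ?thesis by linarith
qed

lemma curve_zero: "curve (\<lambda>t. 0)"
  using zero_in_Bs by (simp add: curve_def)

lemma mild_map_zero: "0 \<le> t \<Longrightarrow> mild_map \<alpha> \<phi> 0 (\<lambda>t. 0) t = 0"
proof -
  assume t: "0 \<le> t"
  have L0: "L_semigroup \<theta> s 0 = 0" if "0 \<le> s" for s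
    using norm_L_semigroup_le1[of s \<theta> 0] that cos_pos by simp
  have "integral {0..t} (\<lambda>s. L_semigroup \<theta> (t - s) (forcing \<alpha> \<phi> (\<lambda>t. 0) s)) = integral {0..t} (\<lambda>s. 0)"
    using L0 by (intro integral_cong) (auto simp: forcing_def Ns_zero)
  then show ?thesis using t L0 by (simp add: mild_map_def)
qed

text \<open>Comparison with the zero solution, which has the initial value \<open>0\<close>.\<close>

lemma norm_mild_map_le:
  assumes "admissible \<alpha>" "\<phi> \<in> Bc \<theta> r\<^sub>c" "curve x" "\<xi> \<in> Bs r\<^sub>s" "0 \<le> t"
  shows "norm (mild_map \<alpha> \<phi> \<xi> x t) \<le> exp (- \<mu> * t) * norm \<xi>
           + integral {0..t} (\<lambda>s. exp (- \<mu> * (t - s)) * norm (forcing \<alpha> \<phi> x s))"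
  using norm_mild_map_diff_le[OF assms(1,2,3) assms(1,2) curve_zero assms(4) zero_in_Bs assms(5)] assms(5)
  by (simp add: mild_map_zero forcing_def[of _ _ "\<lambda>t. 0"] Ns_zero)

lemma kernel_integral_le:
  assumes "continuous_on {0..} f" "\<And>s. 0 \<le> s \<Longrightarrow> f s \<le> C" "0 \<le> t"
  shows "integral {0..t} (\<lambda>s. exp (- \<mu> * (t - s)) * f s) \<le> C * (1 - exp (- \<mu> * t)) / \<mu>"
proof -
  have "integral {0..t} (\<lambda>s. exp (- \<mu> * (t - s)) * f s) \<le> integral {0..t} (\<lambda>s. exp (- \<mu> * (t - s)) * C)"
  proof (rule integral_le)
    show "(\<lambda>s. exp (- \<mu> * (t - s)) * f s) integrable_on {0..t}"
      by (intro integrable_continuous_real continuous_intros continuous_on_subset[OF assms(1)]) auto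
    show "(\<lambda>s. exp (- \<mu> * (t - s)) * C) integrable_on {0..t}"
      by (intro integrable_continuous_real continuous_intros)
  qed (simp add: assms(2))
  then show ?thesis using integral_exp_kernel[of \<mu> t C] mu_pos assms(3) by simp
qed

text \<open>\<open>B\<^sub>s\<close> is invariant because the forcing is at most \<open>\<delta>\<^sub>1 r\<^sub>s \<le> \<mu> r\<^sub>s\<close>: the norm is then bounded by the
  convex combination \<open>e\<^bsup>-\<mu>t\<^esup> r\<^sub>s + (1 - e\<^bsup>-\<mu>t\<^esup>) r\<^sub>s\<close>. This lets the fixed-point argument
  run inside \<open>B\<^sub>s\<close>, where \<open>\<alpha>\<close> is defined.\<close>

lemma curve_mild_map:
  assumes "admissible \<alpha>" "\<phi> \<in> Bc \<theta> r\<^sub>c" "curve x" "\<xi> \<in> Bs r\<^sub>s"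
  shows "curve (mild_map \<alpha> \<phi> \<xi> x)"
  unfolding curve_def
proof (intro conjI allI impI)
  have "continuous_on {0..} (\<lambda>t. L_semigroup \<theta> t \<xi>
     + integral {0..t} (\<lambda>s. L_semigroup \<theta> (t - s) (forcing \<alpha> \<phi> x s)))"
    using cos_pos by (intro continuous_intros continuous_on_L_semigroup continuous_on_duhamel
        continuous_on_forcing assms) auto
  then show "continuous_on {0..} (mild_map \<alpha> \<phi> \<xi> x)"
    by (rule continuous_on_eq) (simp add: mild_map_def)
  fix t :: real assume t: "0 \<le> t"
  have "norm (forcing \<alpha> \<phi> x s) \<le> \<mu> * r\<^sub>s" if "0 \<le> s" for s
  proof -
    have "norm (forcing \<alpha> \<phi> x s) \<le> (\<mu> - \<kappa>) * norm (x s)" by (rule norm_forcing_le[OF assms(1-3) that])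
    also have "\<dots> \<le> \<mu> * r\<^sub>s"
      using kappa(2) mu_pos curve_norm_le[OF assms(3) that] by (intro mult_mono) auto
    finally show ?thesis .
  qed
  then have "integral {0..t} (\<lambda>s. exp (- \<mu> * (t - s)) * norm (forcing \<alpha> \<phi> x s))
      \<le> \<mu> * r\<^sub>s * (1 - exp (- \<mu> * t)) / \<mu>"
    by (intro kernel_integral_le continuous_on_norm continuous_on_forcing assms t)
  moreover have "exp (- \<mu> * t) * norm \<xi> \<le> exp (- \<mu> * t) * r\<^sub>s"
    using assms(4) by (intro mult_left_mono) (auto simp: Bs_def)
  moreover have "\<mu> * r\<^sub>s * (1 - exp (- \<mu> * t)) / \<mu> = r\<^sub>s * (1 - exp (- \<mu> * t))"
    using mu_pos by simp
  ultimately have "norm (mild_map \<alpha> \<phi> \<xi> x t) \<le> exp (- \<mu> * t) * r\<^sub>s + r\<^sub>s * (1 - exp (- \<mu> * t))"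
    using norm_mild_map_le[OF assms t] by linarith
  then have "norm (mild_map \<alpha> \<phi> \<xi> x t) \<le> r\<^sub>s" by (simp add: algebra_simps)
  moreover have "mild_map \<alpha> \<phi> \<xi> x t \<in> Xs"
  proof -
    have "L_semigroup \<theta> t \<xi> \<in> Xs"
      using L_semigroup_in_Xs t cos_pos assms(4) by (simp add: Bs_def)
    moreover have "integral {0..t} (\<lambda>s. L_semigroup \<theta> (t - s) (forcing \<alpha> \<phi> x s)) \<in> Xs"
      using cos_pos by (intro duhamel_in_Xs continuous_on_forcing forcing_in_Xs assms) auto
    ultimately show ?thesis using t by (simp add: mild_map_def Xs_def)
  qed
  ultimately show "mild_map \<alpha> \<phi> \<xi> x t \<in> Bs r\<^sub>s" by (simp add: Bs_def)
qed

lemma mild_map_contraction: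
  assumes \<alpha>: "admissible \<alpha>" "\<phi> \<in> Bc \<theta> r\<^sub>c" and x: "curve x" and y: "curve y" and \<xi>: "\<xi> \<in> Bs r\<^sub>s"
    and D: "\<And>t. 0 \<le> t \<Longrightarrow> norm (x t - y t) \<le> D" and t: "0 \<le> t"
  shows "norm (mild_map \<alpha> \<phi> \<xi> x t - mild_map \<alpha> \<phi> \<xi> y t) \<le> (\<mu> - \<nu>) / \<mu> * D"
proof -
  have D0: "0 \<le> D" using order_trans[OF norm_ge_zero D[OF order_refl]] .
  have rate: "0 \<le> \<mu> - \<nu>" using pos by (simp add: nu)
  have "norm (forcing \<alpha> \<phi> x s - forcing \<alpha> \<phi> y s) \<le> (\<mu> - \<nu>) * D" if "0 \<le> s" for s
  proof -
    have "norm (forcing \<alpha> \<phi> x s - forcing \<alpha> \<phi> y s)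
        \<le> (2 * r\<^sub>c + (2 * \<rho> + 1) * (norm (x s) + norm (y s))) * norm (x s - y s) + 2 * 0 * norm (y s)"
      using that by (intro norm_forcing_diff_le \<alpha> x y) auto
    also have "\<dots> \<le> (\<mu> - \<nu>) * D"
      using mult_mono[OF local_rate_le[OF x y that] D[OF that] rate] by simp
    finally show ?thesis .
  qed
  then have "integral {0..t} (\<lambda>s. exp (- \<mu> * (t - s)) * norm (forcing \<alpha> \<phi> x s - forcing \<alpha> \<phi> y s))
      \<le> (\<mu> - \<nu>) * D * (1 - exp (- \<mu> * t)) / \<mu>"
    using t by (intro kernel_integral_le continuous_on_norm continuous_on_diff continuous_on_forcing \<alpha> x y)
  also have "\<dots> \<le> (\<mu> - \<nu>) * D * 1 / \<mu>"
    using D0 rate mu_pos by (intro divide_right_mono mult_left_mono) auto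
  finally show ?thesis
    using norm_mild_map_diff_le[OF \<alpha> x \<alpha> y \<xi> \<xi> t] by simp
qed

lemma mild_map_extensional: "mild_map \<alpha> \<phi> \<xi> x \<in> extensional {0..}"
  by (simp add: mild_map_def)

lemma curve_dist_le: "curve x \<Longrightarrow> curve y \<Longrightarrow> 0 \<le> t \<Longrightarrow> norm (x t - y t) \<le> 2 * r\<^sub>s"
  using norm_triangle_ineq4[of "x t" "y t"] curve_norm_le[of x t] curve_norm_le[of y t] by simp

lemma curve_uniform_limit:
  assumes X: "\<And>n. curve (X n)"
    and l: "\<And>e. 0 < e \<Longrightarrow> \<forall>\<^sub>F n in sequentially. \<forall>t\<in>{0..}. norm (X n t - l t) \<le> e"
  shows "curve l"
proof -
  have U: "uniform_limit {0..} X l sequentially"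
  proof (rule uniform_limitI)
    fix e :: real assume "0 < e"
    then have "\<forall>\<^sub>F n in sequentially. \<forall>t\<in>{0..}. norm (X n t - l t) \<le> e / 2" by (intro l) simp
    then show "\<forall>\<^sub>F n in sequentially. \<forall>t\<in>{0..}. dist (X n t) (l t) < e"
    proof eventually_elim
      case (elim n)
      show ?case
      proof
        fix t :: real assume "t \<in> {0..}"
        then have "norm (X n t - l t) \<le> e / 2" using elim by blast
        then show "dist (X n t) (l t) < e" using \<open>0 < e\<close> by (simp add: dist_norm)
      qed
    qed
  qed
  have "continuous_on {0..} l"
    using X by (intro uniform_limit_theorem[OF _ U]) (auto simp: curve_def)
  moreover have "l t \<in> Bs r\<^sub>s" if "0 \<le> t" for t
  proof (rule closed_sequentially[OF closed_Bs])
    show "X n t \<in> Bs r\<^sub>s" for n using X[of n] that by (simp add: curve_def)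
    show "(\<lambda>n. X n t) \<longlonglongrightarrow> l t" using tendsto_uniform_limitI[OF U, of t] that by simp
  qed
  ultimately show ?thesis by (simp add: curve_def)
qed

lemma ex1_mild_solution:
  assumes \<alpha>: "admissible \<alpha>" "\<phi> \<in> Bc \<theta> r\<^sub>c" and \<xi>: "\<xi> \<in> Bs r\<^sub>s"
  shows "\<exists>!x. x \<in> extensional {0..} \<and> mild_solution \<theta> r\<^sub>s \<alpha> \<phi> \<xi> x"
proof -
  let ?T = "mild_map \<alpha> \<phi> \<xi>" and ?F = "{x \<in> extensional {0..}. curve x}"
  have c: "0 \<le> (\<mu> - \<nu>) / \<mu>" "(\<mu> - \<nu>) / \<mu> < 1" using mu_pos nu pos by auto
  have sol: "x \<in> extensional {0..} \<and> mild_solution \<theta> r\<^sub>s \<alpha> \<phi> \<xi> x \<longleftrightarrow> x \<in> ?F \<and> ?T x = x" for x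
  proof -
    have "(\<forall>t\<ge>0. x t = ?T x t) \<longleftrightarrow> ?T x = x" if "x \<in> extensional {0..}"
    proof
      assume "\<forall>t\<ge>0. x t = ?T x t"
      then show "?T x = x"
        by (intro extensionalityI[OF mild_map_extensional that]) simp
    qed simp
    then show ?thesis unfolding mild_solution_iff by blast
  qed
  have contr: "\<forall>t\<in>{0..}. norm (?T x t - ?T y t) \<le> (\<mu> - \<nu>) / \<mu> * D * 1"
    if "x \<in> ?F" "y \<in> ?F" "\<forall>t\<in>{0..}. norm (x t - y t) \<le> D * 1" for x y D
    using that mild_map_contraction[OF \<alpha>, of x y \<xi> D] \<xi> by simp
  have "\<exists>x\<in>?F. ?T x = x"
  proof (rule weighted_fixed_point_exists[where w = "\<lambda>_. 1" and A = "{0..}", OF c])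
    show "restrict (\<lambda>_. 0) {0..} \<in> ?F"
    proof -
      have "continuous_on {0..} (restrict (\<lambda>_. 0) {0..} :: real \<Rightarrow> ell1)"
        by (rule continuous_on_eq[OF continuous_on_const]) (simp add: restrict_def)
      then show ?thesis using zero_in_Bs by (simp add: curve_def)
    qed
    show "?T x \<in> ?F" if "x \<in> ?F" for x
      using that curve_mild_map[OF \<alpha> _ \<xi>] mild_map_extensional by blast
    show "\<exists>D. \<forall>t\<in>{0..}. norm (x t - y t) \<le> D * 1" if "x \<in> ?F" "y \<in> ?F" for x y
      using that curve_dist_le by (intro exI[of _ "2 * r\<^sub>s"]) auto
    show "l \<in> ?F" if "\<And>n. X n \<in> ?F" "l \<in> extensional {0..}"
      "\<And>e. 0 < e \<Longrightarrow> \<forall>\<^sub>F n in sequentially. \<forall>t\<in>{0..}. norm (X n t - l t) \<le> e * 1" for X l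
      using that curve_uniform_limit[of X l] by simp
  qed (use contr in auto)
  moreover have "x = y" if "x \<in> ?F" "?T x = x" "y \<in> ?F" "?T y = y" for x y
  proof (rule weighted_fixed_point_unique[where w = "\<lambda>_. 1" and A = "{0..}" and T = ?T and D = "2 * r\<^sub>s", OF c])
    show "\<forall>t\<in>{0..}. norm (?T x t - ?T y t) \<le> (\<mu> - \<nu>) / \<mu> * D * 1"
      if "\<forall>t\<in>{0..}. norm (x t - y t) \<le> D * 1" for D
      by (rule contr[OF \<open>x \<in> ?F\<close> \<open>y \<in> ?F\<close> that])
    show "\<forall>t\<in>{0..}. norm (x t - y t) \<le> 2 * r\<^sub>s * 1"
      using that curve_dist_le by simp
  qed (use that pos in simp_all)
  ultimately show ?thesis unfolding sol by blast
qed

lemma xsol_mild: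
  assumes "admissible \<alpha>" "\<phi> \<in> Bc \<theta> r\<^sub>c" "\<xi> \<in> Bs r\<^sub>s"
  shows "mild_solution \<theta> r\<^sub>s \<alpha> \<phi> \<xi> (xsol \<theta> r\<^sub>s \<alpha> \<phi> \<xi>)"
  using theI'[OF ex1_mild_solution[OF assms]] by (simp add: xsol_def)

lemma curve_xsol:
  assumes "admissible \<alpha>" "\<phi> \<in> Bc \<theta> r\<^sub>c" "\<xi> \<in> Bs r\<^sub>s"
  shows "curve (xsol \<theta> r\<^sub>s \<alpha> \<phi> \<xi>)"
  using xsol_mild[OF assms] unfolding mild_solution_iff by blast

lemma xsol_eq:
  assumes "admissible \<alpha>" "\<phi> \<in> Bc \<theta> r\<^sub>c" "\<xi> \<in> Bs r\<^sub>s" "0 \<le> t"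
  shows "xsol \<theta> r\<^sub>s \<alpha> \<phi> \<xi> t = mild_map \<alpha> \<phi> \<xi> (xsol \<theta> r\<^sub>s \<alpha> \<phi> \<xi>) t"
  using xsol_mild[OF assms(1-3)] assms(4) unfolding mild_solution_iff by blast

section \<open>Decay and dependence on the data\<close>

lemma xsol_gronwall:
  assumes \<alpha>: "admissible \<alpha>" "\<phi> \<in> Bc \<theta> r\<^sub>c" "\<xi> \<in> Bs r\<^sub>s" and T: "0 \<le> T"
    and G: "\<And>t. t \<in> {0..T} \<Longrightarrow> (G has_real_derivative G' t) (at t within {0..T})"
      "\<And>t. t \<in> {0..T} \<Longrightarrow> 0 \<le> G t" "\<And>t. t \<in> {0..T} \<Longrightarrow> G' t - \<kappa> * G t \<le> - h" and h: "0 \<le> h"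
  shows "G T * norm (xsol \<theta> r\<^sub>s \<alpha> \<phi> \<xi> T) + h * integral {0..T} (\<lambda>t. norm (xsol \<theta> r\<^sub>s \<alpha> \<phi> \<xi> t))
           \<le> G 0 * norm \<xi>"
proof -
  let ?x = "xsol \<theta> r\<^sub>s \<alpha> \<phi> \<xi>"
  have x: "curve ?x" by (rule curve_xsol[OF \<alpha>])
  have sub: "{0..T} \<subseteq> {0..}" by auto
  have "G T * norm (?x T) + integral {0..T} (\<lambda>t. h * norm (?x t))
      \<le> G 0 * norm \<xi> + integral {0..T} (\<lambda>t. G t * 0)"
  proof (rule weighted_gronwall[where \<mu> = \<mu> and K = "\<lambda>_. \<mu> - \<kappa>" and f = "\<lambda>t. norm (forcing \<alpha> \<phi> ?x t)" and G' = G'])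
    show "continuous_on {0..T} (\<lambda>t. norm (?x t))"
      using x by (intro continuous_on_norm continuous_on_subset[OF _ sub]) (simp add: curve_def)
    show "continuous_on {0..T} (\<lambda>t. norm (forcing \<alpha> \<phi> ?x t))"
      by (intro continuous_on_norm continuous_on_subset[OF continuous_on_forcing sub] \<alpha> x)
    show "norm (?x t) \<le> exp (- \<mu> * t) * norm \<xi> + integral {0..t} (\<lambda>s. exp (- \<mu> * (t - s)) * norm (forcing \<alpha> \<phi> ?x s))"
      if "t \<in> {0..T}" for t
      using norm_mild_map_le[OF \<alpha>(1,2) x \<alpha>(3), of t] that
      by (simp add: xsol_eq[OF \<alpha>, of t, symmetric])
    show "norm (forcing \<alpha> \<phi> ?x t) \<le> (\<mu> - \<kappa>) * norm (?x t) + 0" if "t \<in> {0..T}" for t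
      using norm_forcing_le[OF \<alpha>(1,2) x, of t] that by simp
    show "0 \<le> \<mu> - \<kappa>" using pos by (simp add: kappa)
    show "G' t + (\<mu> - \<kappa> - \<mu>) * G t \<le> - h" if "t \<in> {0..T}" for t
      using G(3)[OF that] by simp
  qed (use T G h in auto)
  then show ?thesis by simp
qed

text \<open>The weight \<open>e\<^bsup>\<kappa>t\<^esup>\<close> with \<open>h = 0\<close>.\<close>

lemma xsol_decay:
  assumes "admissible \<alpha>" "\<phi> \<in> Bc \<theta> r\<^sub>c" "\<xi> \<in> Bs r\<^sub>s" "0 \<le> t"
  shows "norm (xsol \<theta> r\<^sub>s \<alpha> \<phi> \<xi> t) \<le> exp (- \<kappa> * t) * norm \<xi>"
proof -
  have "exp (\<kappa> * t) * norm (xsol \<theta> r\<^sub>s \<alpha> \<phi> \<xi> t) + 0 * integral {0..t} (\<lambda>t. norm (xsol \<theta> r\<^sub>s \<alpha> \<phi> \<xi> t))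
      \<le> exp (\<kappa> * 0) * norm \<xi>"
    by (rule xsol_gronwall[OF assms, where G' = "\<lambda>t. \<kappa> * exp (\<kappa> * t)"])
       (auto intro!: derivative_eq_intros)
  then have "exp (- \<kappa> * t) * (exp (\<kappa> * t) * norm (xsol \<theta> r\<^sub>s \<alpha> \<phi> \<xi> t)) \<le> exp (- \<kappa> * t) * norm \<xi>"
    by (intro mult_left_mono) auto
  then show ?thesis by (simp add: exp_minus field_simps)
qed

text \<open>The constant weight \<open>1 / \<kappa>\<close>, for which \<open>h = 1\<close>.\<close>

lemma xsol_integral_le:
  assumes "admissible \<alpha>" "\<phi> \<in> Bc \<theta> r\<^sub>c" "\<xi> \<in> Bs r\<^sub>s" "0 \<le> T"
  shows "integral {0..T} (\<lambda>t. norm (xsol \<theta> r\<^sub>s \<alpha> \<phi> \<xi> t)) \<le> norm \<xi> / \<kappa>"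
proof -
  have "1 / \<kappa> * norm (xsol \<theta> r\<^sub>s \<alpha> \<phi> \<xi> T) + 1 * integral {0..T} (\<lambda>t. norm (xsol \<theta> r\<^sub>s \<alpha> \<phi> \<xi> t))
      \<le> 1 / \<kappa> * norm \<xi>"
    using kappa(2) by (intro xsol_gronwall[OF assms, where G' = "\<lambda>t. 0"]) auto
  moreover have "0 \<le> 1 / \<kappa> * norm (xsol \<theta> r\<^sub>s \<alpha> \<phi> \<xi> T)" using kappa(2) by simp
  ultimately show ?thesis by simp
qed

text \<open>Maps, base points and initial values may all differ here; \<open>E\<close> measures the difference of the
  two center components along equal stable components. The function \<open>K\<close> may be any bound for the
  local Lipschitz factor of the forcing.\<close>

lemma xsol_diff_gronwall:
  assumes \<alpha>: "admissible \<alpha>" "\<phi> \<in> Bc \<theta> r\<^sub>c" "\<xi> \<in> Bs r\<^sub>s"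
    and \<beta>: "admissible \<beta>" "\<psi> \<in> Bc \<theta> r\<^sub>c" "\<zeta> \<in> Bs r\<^sub>s" and T: "0 \<le> T"
    and E: "\<And>t y. 0 \<le> t \<Longrightarrow> y \<in> Bs r\<^sub>s \<Longrightarrow> cmod (\<alpha> (Phi \<theta> t \<phi>, y) - \<beta> (Phi \<theta> t \<psi>, y)) \<le> E"
    and K: "\<And>t. t \<in> {0..T} \<Longrightarrow>
      2 * r\<^sub>c + (2 * \<rho> + 1) * (norm (xsol \<theta> r\<^sub>s \<alpha> \<phi> \<xi> t) + norm (xsol \<theta> r\<^sub>s \<beta> \<psi> \<zeta> t)) \<le> K t"
    and G: "\<And>t. t \<in> {0..T} \<Longrightarrow> (G has_real_derivative G' t) (at t within {0..T})"
      "\<And>t. t \<in> {0..T} \<Longrightarrow> 0 \<le> G t" "\<And>t. t \<in> {0..T} \<Longrightarrow> G' t + (K t - \<mu>) * G t \<le> - h t"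
    and h: "continuous_on {0..T} h" "\<And>t. t \<in> {0..T} \<Longrightarrow> 0 \<le> h t"
  shows "integral {0..T} (\<lambda>t. h t * norm (xsol \<theta> r\<^sub>s \<alpha> \<phi> \<xi> t - xsol \<theta> r\<^sub>s \<beta> \<psi> \<zeta> t))
           \<le> G 0 * norm (\<xi> - \<zeta>) + integral {0..T} (\<lambda>t. G t * (2 * E * norm (xsol \<theta> r\<^sub>s \<beta> \<psi> \<zeta> t)))"
proof -
  let ?x = "xsol \<theta> r\<^sub>s \<alpha> \<phi> \<xi>" and ?y = "xsol \<theta> r\<^sub>s \<beta> \<psi> \<zeta>"
  have x: "curve ?x" by (rule curve_xsol[OF \<alpha>])
  have y: "curve ?y" by (rule curve_xsol[OF \<beta>])
  have sub: "{0..T} \<subseteq> {0..}" by auto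
  have xc: "continuous_on {0..T} ?x" "continuous_on {0..T} ?y"
    using x y by (auto simp: curve_def intro: continuous_on_subset[OF _ sub])
  have "G T * norm (?x T - ?y T) + integral {0..T} (\<lambda>t. h t * norm (?x t - ?y t))
      \<le> G 0 * norm (\<xi> - \<zeta>) + integral {0..T} (\<lambda>t. G t * (2 * E * norm (?y t)))"
  proof (rule weighted_gronwall[where \<mu> = \<mu> and K = K and G' = G'
        and f = "\<lambda>t. norm (forcing \<alpha> \<phi> ?x t - forcing \<beta> \<psi> ?y t)"])
    show "continuous_on {0..T} (\<lambda>t. norm (forcing \<alpha> \<phi> ?x t - forcing \<beta> \<psi> ?y t))"
      by (intro continuous_on_norm continuous_on_diff continuous_on_subset[OF continuous_on_forcing sub] \<alpha> \<beta> x y)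
    show "norm (?x t - ?y t) \<le> exp (- \<mu> * t) * norm (\<xi> - \<zeta>)
        + integral {0..t} (\<lambda>s. exp (- \<mu> * (t - s)) * norm (forcing \<alpha> \<phi> ?x s - forcing \<beta> \<psi> ?y s))"
      if "t \<in> {0..T}" for t
      using norm_mild_map_diff_le[OF \<alpha>(1,2) x \<beta>(1,2) y \<alpha>(3) \<beta>(3), of t] that
      by (simp add: xsol_eq[OF \<alpha>, of t, symmetric] xsol_eq[OF \<beta>, of t, symmetric])
    show "norm (forcing \<alpha> \<phi> ?x t - forcing \<beta> \<psi> ?y t) \<le> K t * norm (?x t - ?y t) + 2 * E * norm (?y t)"
      if "t \<in> {0..T}" for t
    proof -
      have "norm (forcing \<alpha> \<phi> ?x t - forcing \<beta> \<psi> ?y t)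
          \<le> (2 * r\<^sub>c + (2 * \<rho> + 1) * (norm (?x t) + norm (?y t))) * norm (?x t - ?y t) + 2 * E * norm (?y t)"
        using that y by (intro norm_forcing_diff_le \<alpha> \<beta> x y E) (auto simp: curve_def)
      also have "\<dots> \<le> K t * norm (?x t - ?y t) + 2 * E * norm (?y t)"
        by (intro add_right_mono mult_right_mono K that) simp
      finally show ?thesis .
    qed
    show "0 \<le> K t" if "t \<in> {0..T}" for t
      using K[OF that] pos by (intro order_trans[OF _ K[OF that]]) simp
  qed (use T G h in \<open>auto intro!: continuous_intros xc\<close>)
  moreover have "0 \<le> G T * norm (?x T - ?y T)" using G(2)[of T] T by simp
  ultimately show ?thesis by linarith
qed

lemma xsol_perturbation:
  assumes \<alpha>: "admissible \<alpha>" "\<phi> \<in> Bc \<theta> r\<^sub>c" and \<beta>: "admissible \<beta>" "\<psi> \<in> Bc \<theta> r\<^sub>c"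
    and \<xi>: "\<xi> \<in> Bs r\<^sub>s" and T: "0 \<le> T"
    and E: "\<And>t y. 0 \<le> t \<Longrightarrow> y \<in> Bs r\<^sub>s \<Longrightarrow> cmod (\<alpha> (Phi \<theta> t \<phi>, y) - \<beta> (Phi \<theta> t \<psi>, y)) \<le> E"
  shows "integral {0..T} (\<lambda>t. norm (xsol \<theta> r\<^sub>s \<alpha> \<phi> \<xi> t - xsol \<theta> r\<^sub>s \<beta> \<psi> \<xi> t))
           \<le> 2 * E * norm \<xi> / (\<kappa> * \<nu>)"
proof -
  have E0: "0 \<le> E" using order_trans[OF norm_ge_zero E[OF order_refl zero_in_Bs]] .
  have "integral {0..T} (\<lambda>t. 1 * norm (xsol \<theta> r\<^sub>s \<alpha> \<phi> \<xi> t - xsol \<theta> r\<^sub>s \<beta> \<psi> \<xi> t))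
      \<le> 1 / \<nu> * norm (\<xi> - \<xi>) + integral {0..T} (\<lambda>t. 1 / \<nu> * (2 * E * norm (xsol \<theta> r\<^sub>s \<beta> \<psi> \<xi> t)))"
  proof (rule xsol_diff_gronwall[OF \<alpha> \<xi> \<beta> \<xi> T E, where K = "\<lambda>_. \<mu> - \<nu>" and G' = "\<lambda>_. 0"])
    show "2 * r\<^sub>c + (2 * \<rho> + 1) * (norm (xsol \<theta> r\<^sub>s \<alpha> \<phi> \<xi> t) + norm (xsol \<theta> r\<^sub>s \<beta> \<psi> \<xi> t)) \<le> \<mu> - \<nu>"
      if "t \<in> {0..T}" for t
      using that by (intro local_rate_le curve_xsol \<alpha> \<beta> \<xi>) auto
  qed (use nu(2) in \<open>auto intro!: continuous_intros\<close>)
  also have "\<dots> = 2 * E / \<nu> * integral {0..T} (\<lambda>t. norm (xsol \<theta> r\<^sub>s \<beta> \<psi> \<xi> t))"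
    by simp
  also have "\<dots> \<le> 2 * E / \<nu> * (norm \<xi> / \<kappa>)"
    using E0 nu(2) by (intro mult_left_mono xsol_integral_le \<beta> \<xi> T) auto
  finally show ?thesis by (simp add: mult.commute)
qed

end

context slow_fast
begin

section \<open>The Lyapunov--Perron operator\<close>

text \<open>The integrand of the Lyapunov--Perron operator minus \<open>e\<^bsup>i\<theta>\<^esup> \<Phi>\<^sup>2\<close>, the integrand for \<open>x = 0\<close>.\<close>

definition remainder :: "(complex \<times> ell1 \<Rightarrow> complex) \<Rightarrow> complex \<Rightarrow> (real \<Rightarrow> ell1) \<Rightarrow> real \<Rightarrow> complex" where
  "remainder \<alpha> \<phi> x t =
     cis \<theta> * ((\<alpha> (Phi \<theta> t \<phi>, x t))\<^sup>2 - (Phi \<theta> t \<phi>)\<^sup>2 + coeff (conv (x t) (x t)) 0)"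

lemma continuous_on_remainder:
  assumes "admissible \<alpha>" "\<phi> \<in> Bc \<theta> r\<^sub>c" "curve x"
  shows "continuous_on {0..} (remainder \<alpha> \<phi> x)"
  unfolding remainder_def[abs_def]
  using assms(3) by (intro continuous_intros continuous_on_alpha_curve[OF assms]
      continuous_on_Phi[OF assms(2)] continuous_on_conv_coeff) (simp add: curve_def)

lemma norm_remainder_le:
  assumes \<alpha>: "admissible \<alpha>" "\<phi> \<in> Bc \<theta> r\<^sub>c" and x: "curve x" and t: "0 \<le> t"
  shows "cmod (remainder \<alpha> \<phi> x t) \<le> (\<rho> * (2 * r\<^sub>c + \<rho> * r\<^sub>s) + r\<^sub>s) * norm (x t)"
proof -
  let ?P = "Phi \<theta> t \<phi>" and ?a = "\<alpha> (Phi \<theta> t \<phi>, x t)" and ?m = "norm (x t)"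
  have B: "x t \<in> Bs r\<^sub>s" "?m \<le> r\<^sub>s" using x t curve_norm_le by (simp_all add: curve_def)
  have P: "?P \<in> Bc \<theta> r\<^sub>c" by (rule Phi_in_Bc[OF \<alpha>(2) t])
  have \<rho>m: "\<rho> * ?m \<le> \<rho> * r\<^sub>s" using pos B by (intro mult_left_mono) auto
  have "cmod (?a + ?P) \<le> 2 * r\<^sub>c + \<rho> * r\<^sub>s"
    using norm_triangle_ineq[of ?a ?P] admissible_bound[OF \<alpha>(1) P B(1)] norm_Phi_le_radius[OF \<alpha>(2) t] \<rho>m
    by linarith
  then have "cmod (?a - ?P) * cmod (?a + ?P) \<le> (\<rho> * ?m) * (2 * r\<^sub>c + \<rho> * r\<^sub>s)"
    using pos by (intro mult_mono admissible_near[OF \<alpha>(1) P B(1)]) auto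
  moreover have "?a\<^sup>2 - ?P\<^sup>2 = (?a - ?P) * (?a + ?P)" by (simp add: power2_eq_square algebra_simps)
  ultimately have "cmod (?a\<^sup>2 - ?P\<^sup>2) \<le> (\<rho> * ?m) * (2 * r\<^sub>c + \<rho> * r\<^sub>s)" by (simp add: norm_mult)
  moreover have "cmod (coeff (conv (x t) (x t)) 0) \<le> r\<^sub>s * ?m"
    using order_trans[OF coeff_le_norm norm_conv_le, of "x t" "x t" 0] mult_right_mono[OF B(2), of ?m] by simp
  moreover have "cmod (remainder \<alpha> \<phi> x t) = cmod (?a\<^sup>2 - ?P\<^sup>2 + coeff (conv (x t) (x t)) 0)"
    by (simp add: remainder_def norm_mult)
  ultimately have "cmod (remainder \<alpha> \<phi> x t) \<le> (\<rho> * ?m) * (2 * r\<^sub>c + \<rho> * r\<^sub>s) + r\<^sub>s * ?m"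
    using norm_triangle_ineq[of "?a\<^sup>2 - ?P\<^sup>2" "coeff (conv (x t) (x t)) 0"] by linarith
  then show ?thesis by (simp add: algebra_simps)
qed

lemma remainder_absolutely_integrable:
  assumes \<alpha>: "admissible \<alpha>" "\<phi> \<in> Bc \<theta> r\<^sub>c" "\<xi> \<in> Bs r\<^sub>s"
  shows "remainder \<alpha> \<phi> (xsol \<theta> r\<^sub>s \<alpha> \<phi> \<xi>) absolutely_integrable_on {0..}"
proof (rule absolutely_integrable_continuous_dominated)
  let ?x = "xsol \<theta> r\<^sub>s \<alpha> \<phi> \<xi>" and ?C = "\<rho> * (2 * r\<^sub>c + \<rho> * r\<^sub>s) + r\<^sub>s"
  have x: "curve ?x" by (rule curve_xsol[OF \<alpha>])
  show "continuous_on {0..} (remainder \<alpha> \<phi> ?x)" by (rule continuous_on_remainder[OF \<alpha>(1,2) x])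
  have "(\<lambda>t. exp (- \<kappa> * t)) integrable_on {0..}"
    using has_integral_exp_minus_to_infinity[OF kappa(2), of 0] by blast
  then show "(\<lambda>t. ?C * norm \<xi> * exp (- \<kappa> * t)) integrable_on {0..}"
    by (rule integrable_on_mult_right)
  fix t :: real assume t: "0 \<le> t"
  have "cmod (remainder \<alpha> \<phi> ?x t) \<le> ?C * norm (?x t)" by (rule norm_remainder_le[OF \<alpha>(1,2) x t])
  also have "\<dots> \<le> ?C * (exp (- \<kappa> * t) * norm \<xi>)"
    using pos by (intro mult_left_mono xsol_decay[OF \<alpha> t]) simp
  finally show "norm (remainder \<alpha> \<phi> ?x t) \<le> ?C * norm \<xi> * exp (- \<kappa> * t)" by (simp add: mult_ac)
qed

lemma Psi_eq_remainder:
  assumes \<alpha>: "admissible \<alpha>" "\<phi> \<in> Bc \<theta> r\<^sub>c" "\<xi> \<in> Bs r\<^sub>s"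
  shows "Psi \<theta> r\<^sub>c r\<^sub>s \<alpha> (\<phi>, \<xi>) = \<phi> - integral {0..} (remainder \<alpha> \<phi> (xsol \<theta> r\<^sub>s \<alpha> \<phi> \<xi>))"
proof -
  let ?x = "xsol \<theta> r\<^sub>s \<alpha> \<phi> \<xi>"
  have "Psi \<theta> r\<^sub>c r\<^sub>s \<alpha> (\<phi>, \<xi>) = - integral {0..} (\<lambda>t. Nc \<theta> (\<alpha> (Phi \<theta> t \<phi>, ?x t)) (?x t))"
    using \<alpha> by (simp add: Psi_def Let_def)
  also have "integral {0..} (\<lambda>t. Nc \<theta> (\<alpha> (Phi \<theta> t \<phi>, ?x t)) (?x t))
      = integral {0..} (\<lambda>t. cis \<theta> * (Phi \<theta> t \<phi>)\<^sup>2 + remainder \<alpha> \<phi> ?x t)"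
    using curve_in_Xs[OF curve_xsol[OF \<alpha>]]
    by (intro integral_cong) (simp add: Nc_eq remainder_def algebra_simps)
  also have "\<dots> = - \<phi> + integral {0..} (remainder \<alpha> \<phi> ?x)"
    unfolding Phi_square_integral(2)[OF \<alpha>(2), symmetric]
    by (intro integral_add set_lebesgue_integral_eq_integral(1)
        Phi_square_integral(1)[OF \<alpha>(2)] remainder_absolutely_integrable[OF \<alpha>])
  finally show ?thesis by simp
qed

lemma Psi_zero:
  assumes "admissible \<alpha>" "\<phi> \<in> Bc \<theta> r\<^sub>c"
  shows "Psi \<theta> r\<^sub>c r\<^sub>s \<alpha> (\<phi>, 0) = \<phi>"
proof -
  have "remainder \<alpha> \<phi> (xsol \<theta> r\<^sub>s \<alpha> \<phi> 0) t = 0" if "0 \<le> t" for t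
    using norm_remainder_le[OF assms curve_xsol[OF assms zero_in_Bs] that]
      xsol_decay[OF assms zero_in_Bs that] by simp
  then have "integral {0..} (remainder \<alpha> \<phi> (xsol \<theta> r\<^sub>s \<alpha> \<phi> 0)) = integral {0..} (\<lambda>t :: real. 0)"
    by (intro integral_cong) simp
  then show ?thesis by (simp add: Psi_eq_remainder[OF assms zero_in_Bs])
qed

text \<open>Subtracting \<open>\<phi>\<close> and \<open>\<psi>\<close> leaves the integrals of the remainders only.\<close>

lemma Psi_diff_le:
  assumes \<alpha>: "admissible \<alpha>" "\<phi> \<in> Bc \<theta> r\<^sub>c" "\<xi> \<in> Bs r\<^sub>s" and \<beta>: "admissible \<beta>" "\<psi> \<in> Bc \<theta> r\<^sub>c" "\<zeta> \<in> Bs r\<^sub>s"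
    and g: "continuous_on {0..} g" "\<And>T. 0 \<le> T \<Longrightarrow> integral {0..T} g \<le> B"
    and le: "\<And>t. 0 \<le> t \<Longrightarrow> cmod (remainder \<alpha> \<phi> (xsol \<theta> r\<^sub>s \<alpha> \<phi> \<xi>) t - remainder \<beta> \<psi> (xsol \<theta> r\<^sub>s \<beta> \<psi> \<zeta>) t) \<le> g t"
  shows "cmod ((Psi \<theta> r\<^sub>c r\<^sub>s \<alpha> (\<phi>, \<xi>) - \<phi>) - (Psi \<theta> r\<^sub>c r\<^sub>s \<beta> (\<psi>, \<zeta>) - \<psi>)) \<le> B"
proof -
  let ?R = "remainder \<alpha> \<phi> (xsol \<theta> r\<^sub>s \<alpha> \<phi> \<xi>)" and ?S = "remainder \<beta> \<psi> (xsol \<theta> r\<^sub>s \<beta> \<psi> \<zeta>)"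
  have R: "?R absolutely_integrable_on {0..}" and S: "?S absolutely_integrable_on {0..}"
    by (intro remainder_absolutely_integrable \<alpha> \<beta>)+
  have "cmod (integral {0..} (\<lambda>t. ?R t - ?S t)) \<le> B"
  proof (rule norm_integral_at_top_le)
    show "(\<lambda>t. ?R t - ?S t) absolutely_integrable_on {0..}" by (rule set_integral_diff(1)[OF R S])
    fix T :: real assume T: "0 \<le> T"
    have sub: "{0..T} \<subseteq> {0..}" by auto
    have "cmod (integral {0..T} (\<lambda>t. ?R t - ?S t)) \<le> integral {0..T} g"
    proof (rule integral_norm_bound_integral)
      show "(\<lambda>t. ?R t - ?S t) integrable_on {0..T}"
        by (intro integrable_continuous_real continuous_on_diff continuous_on_subset[OF continuous_on_remainder sub]
            curve_xsol \<alpha> \<beta>)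
      show "g integrable_on {0..T}"
        by (intro integrable_continuous_real continuous_on_subset[OF g(1) sub])
    qed (use le in auto)
    also have "\<dots> \<le> B" by (rule g(2)[OF T])
    finally show "cmod (integral {0..T} (\<lambda>t. ?R t - ?S t)) \<le> B" .
  qed
  moreover have "integral {0..} (\<lambda>t. ?R t - ?S t) = integral {0..} ?R - integral {0..} ?S"
    using R S by (intro integral_diff set_lebesgue_integral_eq_integral(1))
  ultimately show ?thesis
    by (simp add: Psi_eq_remainder[OF \<alpha>] Psi_eq_remainder[OF \<beta>] norm_minus_commute)
qed

lemma norm_conv_coeff_diff_le:
  "cmod (coeff (conv x x) k - coeff (conv y y) k) \<le> (norm x + norm y) * norm (x - y)"
  using order_trans[OF coeff_le_norm norm_conv_diff_squares, of x y k] by simp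

text \<open>With \<open>p\<close> and \<open>q\<close> the deviations of the center components from \<open>\<Phi>(t, \<phi>)\<close> and \<open>\<Phi>(t, \<psi>)\<close>, the difference of
  \<open>2 \<Phi> p + p\<^sup>2\<close> and its counterpart is
  \<open>2 (\<Phi>(t, \<phi>) - \<Phi>(t, \<psi>)) q + (p - q) (2 \<Phi>(t, \<phi>) + p + q)\<close>. Every term is bounded by multiples of
  \<open>\<parallel>y\<parallel>\<close> and \<open>\<parallel>x - y\<parallel>\<close>, whose time integrals are controlled.\<close>

lemma norm_remainder_diff_le:
  assumes \<alpha>: "admissible \<alpha>" "\<phi> \<in> Bc \<theta> r\<^sub>c" and \<beta>: "admissible \<beta>" "\<psi> \<in> Bc \<theta> r\<^sub>c"
    and x: "curve x" and y: "curve y" and t: "0 \<le> t" and e: "0 \<le> e"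
    and near: "cmod ((\<alpha> (Phi \<theta> t \<phi>, y t) - Phi \<theta> t \<phi>) - (\<beta> (Phi \<theta> t \<psi>, y t) - Phi \<theta> t \<psi>)) \<le> e * norm (y t)"
  shows "cmod (remainder \<alpha> \<phi> x t - remainder \<beta> \<psi> y t)
           \<le> (2 * \<rho> * cmod (\<phi> - \<psi>) + 2 * (r\<^sub>c + \<rho> * r\<^sub>s) * e) * norm (y t)
             + 2 * (\<rho> * (r\<^sub>c + \<rho> * r\<^sub>s) + r\<^sub>s) * norm (x t - y t)"
proof -
  let ?P = "Phi \<theta> t \<phi>" and ?Q = "Phi \<theta> t \<psi>"
  let ?m = "norm (y t)" and ?u = "norm (x t - y t)"
  define p where "p = \<alpha> (?P, x t) - ?P"
  define q where "q = \<beta> (?Q, y t) - ?Q"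
  have B: "x t \<in> Bs r\<^sub>s" "y t \<in> Bs r\<^sub>s" "norm (x t) \<le> r\<^sub>s" "?m \<le> r\<^sub>s"
    using x y t curve_norm_le by (simp_all add: curve_def)
  have P: "?P \<in> Bc \<theta> r\<^sub>c" "?Q \<in> Bc \<theta> r\<^sub>c" using Phi_in_Bc \<alpha> \<beta> t by blast+
  have p: "cmod p \<le> \<rho> * norm (x t)" unfolding p_def by (rule admissible_near[OF \<alpha>(1) P(1) B(1)])
  have q: "cmod q \<le> \<rho> * ?m" unfolding q_def by (rule admissible_near[OF \<beta>(1) P(2) B(2)])
  have pq: "cmod (p - q) \<le> \<rho> * ?u + e * ?m"
    using admissible_lipschitz[OF \<alpha>(1) P(1) B(1,2)] near
      norm_triangle_ineq[of "\<alpha> (?P, x t) - \<alpha> (?P, y t)" "(\<alpha> (?P, y t) - ?P) - (\<beta> (?Q, y t) - ?Q)"]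
    unfolding p_def q_def by (simp add: algebra_simps)
  have \<rho>rs: "\<rho> * norm (x t) \<le> \<rho> * r\<^sub>s" "\<rho> * ?m \<le> \<rho> * r\<^sub>s"
    using pos B by (auto intro!: mult_left_mono)
  have "cmod (2 * (?P - ?Q) * q) \<le> 2 * cmod (\<phi> - \<psi>) * (\<rho> * ?m)"
    using norm_Phi_diff_le[OF \<alpha>(2) \<beta>(2) t] q unfolding norm_mult by (intro mult_mono) auto
  moreover have "cmod ((p - q) * (2 * ?P + (p + q))) \<le> (\<rho> * ?u + e * ?m) * (2 * (r\<^sub>c + \<rho> * r\<^sub>s))"
  proof -
    have "cmod (2 * ?P + (p + q)) \<le> cmod (2 * ?P) + (cmod p + cmod q)"
      by (meson norm_triangle_ineq order_trans add_left_mono)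
    also have "\<dots> \<le> 2 * (r\<^sub>c + \<rho> * r\<^sub>s)"
      using norm_Phi_le_radius[OF \<alpha>(2) t] p q \<rho>rs by (simp add: norm_mult)
    finally show ?thesis
      unfolding norm_mult using pq pos e by (intro mult_mono) auto
  qed
  moreover have "cmod (coeff (conv (x t) (x t)) 0 - coeff (conv (y t) (y t)) 0) \<le> (2 * r\<^sub>s) * ?u"
    using norm_conv_coeff_diff_le[of "x t" 0 "y t"] mult_right_mono[of "norm (x t) + ?m" "2 * r\<^sub>s" ?u] B by simp
  moreover have "cmod (remainder \<alpha> \<phi> x t - remainder \<beta> \<psi> y t)
      = cmod (2 * (?P - ?Q) * q + (p - q) * (2 * ?P + (p + q))
          + (coeff (conv (x t) (x t)) 0 - coeff (conv (y t) (y t)) 0))"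
  proof -
    have "remainder \<alpha> \<phi> x t - remainder \<beta> \<psi> y t = cis \<theta> * (2 * (?P - ?Q) * q + (p - q) * (2 * ?P + (p + q))
          + (coeff (conv (x t) (x t)) 0 - coeff (conv (y t) (y t)) 0))"
      unfolding remainder_def p_def q_def by (simp add: power2_eq_square algebra_simps)
    then show ?thesis by (simp add: norm_mult)
  qed
  ultimately have "cmod (remainder \<alpha> \<phi> x t - remainder \<beta> \<psi> y t)
      \<le> 2 * cmod (\<phi> - \<psi>) * (\<rho> * ?m) + (\<rho> * ?u + e * ?m) * (2 * (r\<^sub>c + \<rho> * r\<^sub>s)) + (2 * r\<^sub>s) * ?u"
    using norm_triangle_ineq[of "2 * (?P - ?Q) * q + (p - q) * (2 * ?P + (p + q))"
        "coeff (conv (x t) (x t)) 0 - coeff (conv (y t) (y t)) 0"]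
      norm_triangle_ineq[of "2 * (?P - ?Q) * q" "(p - q) * (2 * ?P + (p + q))"] by linarith
  then show ?thesis by (simp add: algebra_simps)
qed

section \<open>Dependence of the operator on the map and on the base point\<close>

text \<open>The number \<open>\<lambda>\<close> of the theorem.\<close>

definition contraction_factor :: real where
  "contraction_factor = 2 * (\<rho> * (r\<^sub>c + \<rho> * r\<^sub>s) + r\<^sub>s) * 2 * r\<^sub>s / (\<kappa> * \<nu>) + 2 * (r\<^sub>c + \<rho> * r\<^sub>s) / \<kappa>"

text \<open>The contribution of \<open>\<bar>\<phi> - \<psi>\<bar>\<close> to the difference of two integrals when the deviations \<open>\<gamma>\<close>
  coincide.\<close>

definition source_factor :: real where
  "source_factor = 2 * (\<rho> * (r\<^sub>c + \<rho> * r\<^sub>s) + r\<^sub>s) * 2 / (\<kappa> * \<nu>) + 2 * \<rho> / \<kappa>"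

lemma factors_nonneg: "0 \<le> contraction_factor" "0 \<le> source_factor"
  using pos kappa(2) nu(2) by (simp_all add: contraction_factor_def source_factor_def)

text \<open>The central estimate. It is used with \<open>\<phi> = \<psi>\<close> and two maps, where it is the contraction property,
  and with \<open>\<alpha> = \<beta>\<close> and two base points, where it controls the Lipschitz constant in \<open>\<phi>\<close>. Measuring
  the discrepancy \<open>e\<close> relative to \<open>\<parallel>y\<parallel>\<close> makes the source terms integrable and the result
  proportional to \<open>\<parallel>\<xi>\<parallel>\<close>.\<close>

lemma Psi_perturbation:
  assumes \<alpha>: "admissible \<alpha>" "\<phi> \<in> Bc \<theta> r\<^sub>c" and \<beta>: "admissible \<beta>" "\<psi> \<in> Bc \<theta> r\<^sub>c"
    and \<xi>: "\<xi> \<in> Bs r\<^sub>s" and e: "0 \<le> e"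
    and near: "\<And>t y. 0 \<le> t \<Longrightarrow> y \<in> Bs r\<^sub>s \<Longrightarrow>
      cmod ((\<alpha> (Phi \<theta> t \<phi>, y) - Phi \<theta> t \<phi>) - (\<beta> (Phi \<theta> t \<psi>, y) - Phi \<theta> t \<psi>)) \<le> e * norm y"
  shows "cmod ((Psi \<theta> r\<^sub>c r\<^sub>s \<alpha> (\<phi>, \<xi>) - \<phi>) - (Psi \<theta> r\<^sub>c r\<^sub>s \<beta> (\<psi>, \<xi>) - \<psi>))
           \<le> (source_factor * cmod (\<phi> - \<psi>) + contraction_factor * e) * norm \<xi>"
proof -
  let ?x = "xsol \<theta> r\<^sub>s \<alpha> \<phi> \<xi>" and ?y = "xsol \<theta> r\<^sub>s \<beta> \<psi> \<xi>"
  define a where "a = 2 * \<rho> * cmod (\<phi> - \<psi>) + 2 * (r\<^sub>c + \<rho> * r\<^sub>s) * e"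
  define d where "d = 2 * (\<rho> * (r\<^sub>c + \<rho> * r\<^sub>s) + r\<^sub>s)"
  define E where "E = cmod (\<phi> - \<psi>) + e * r\<^sub>s"
  have x: "curve ?x" and y: "curve ?y" by (intro curve_xsol \<alpha> \<beta> \<xi>)+
  have xc: "continuous_on {0..} ?x" "continuous_on {0..} ?y" using x y by (auto simp: curve_def)
  have ad: "0 \<le> a" "0 \<le> d" using pos e by (auto simp: a_def d_def)
  have E: "cmod (\<alpha> (Phi \<theta> t \<phi>, z) - \<beta> (Phi \<theta> t \<psi>, z)) \<le> E" if "0 \<le> t" "z \<in> Bs r\<^sub>s" for t z
  proof -
    have "e * norm z \<le> e * r\<^sub>s" using e that by (intro mult_left_mono) (auto simp: Bs_def)
    then show ?thesis
      using near[OF that] norm_Phi_diff_le[OF \<alpha>(2) \<beta>(2) that(1)]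
        norm_triangle_ineq[of "Phi \<theta> t \<phi> - Phi \<theta> t \<psi>"
          "(\<alpha> (Phi \<theta> t \<phi>, z) - Phi \<theta> t \<phi>) - (\<beta> (Phi \<theta> t \<psi>, z) - Phi \<theta> t \<psi>)"]
      by (simp add: E_def)
  qed
  have "cmod ((Psi \<theta> r\<^sub>c r\<^sub>s \<alpha> (\<phi>, \<xi>) - \<phi>) - (Psi \<theta> r\<^sub>c r\<^sub>s \<beta> (\<psi>, \<xi>) - \<psi>))
      \<le> a * (norm \<xi> / \<kappa>) + d * (2 * E * norm \<xi> / (\<kappa> * \<nu>))"
  proof (rule Psi_diff_le[OF \<alpha> \<xi> \<beta> \<xi>, where g = "\<lambda>t. a * norm (?y t) + d * norm (?x t - ?y t)"])
    show "continuous_on {0..} (\<lambda>t. a * norm (?y t) + d * norm (?x t - ?y t))"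
      by (intro continuous_intros xc)
    show "cmod (remainder \<alpha> \<phi> ?x t - remainder \<beta> \<psi> ?y t) \<le> a * norm (?y t) + d * norm (?x t - ?y t)"
      if "0 \<le> t" for t
      unfolding a_def d_def using that y
      by (intro norm_remainder_diff_le \<alpha> \<beta> x y e near) (auto simp: curve_def)
    fix T :: real assume T: "0 \<le> T"
    have sub: "{0..T} \<subseteq> {0..}" by auto
    have "integral {0..T} (\<lambda>t. a * norm (?y t) + d * norm (?x t - ?y t))
        = integral {0..T} (\<lambda>t. a * norm (?y t)) + integral {0..T} (\<lambda>t. d * norm (?x t - ?y t))"
      by (intro integral_add integrable_continuous_real continuous_intros continuous_on_subset[OF xc(1) sub]
          continuous_on_subset[OF xc(2) sub])
    also have "\<dots> = a * integral {0..T} (\<lambda>t. norm (?y t)) + d * integral {0..T} (\<lambda>t. norm (?x t - ?y t))"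
      by simp
    also have "\<dots> \<le> a * (norm \<xi> / \<kappa>) + d * (2 * E * norm \<xi> / (\<kappa> * \<nu>))"
      by (intro add_mono mult_left_mono xsol_integral_le xsol_perturbation E \<alpha> \<beta> \<xi> T ad)
    finally show "integral {0..T} (\<lambda>t. a * norm (?y t) + d * norm (?x t - ?y t))
        \<le> a * (norm \<xi> / \<kappa>) + d * (2 * E * norm \<xi> / (\<kappa> * \<nu>))" .
  qed
  also have "a * (norm \<xi> / \<kappa>) + d * (2 * E * norm \<xi> / (\<kappa> * \<nu>))
      = (source_factor * cmod (\<phi> - \<psi>) + contraction_factor * e) * norm \<xi>"
    unfolding a_def E_def source_factor_def contraction_factor_def d_def[symmetric]
    by (simp add: add_divide_distrib algebra_simps)
  finally show ?thesis .
qed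

lemma Psi_contraction:
  assumes \<alpha>: "admissible \<alpha>" and \<beta>: "admissible \<beta>" and \<phi>: "\<phi> \<in> Bc \<theta> r\<^sub>c" and \<xi>: "\<xi> \<in> Bs r\<^sub>s" and D: "0 \<le> D"
    and near: "\<And>\<phi> y. \<phi> \<in> Bc \<theta> r\<^sub>c \<Longrightarrow> y \<in> Bs r\<^sub>s \<Longrightarrow> cmod (\<alpha> (\<phi>, y) - \<beta> (\<phi>, y)) \<le> D * norm y"
  shows "cmod (Psi \<theta> r\<^sub>c r\<^sub>s \<alpha> (\<phi>, \<xi>) - Psi \<theta> r\<^sub>c r\<^sub>s \<beta> (\<phi>, \<xi>)) \<le> contraction_factor * D * norm \<xi>"
  using Psi_perturbation[OF \<alpha> \<phi> \<beta> \<phi> \<xi> D] near Phi_in_Bc[OF \<phi>] by simp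

section \<open>Preservation of the Lipschitz constant in the stable variable\<close>

text \<open>Let \<open>u = \<parallel>x - y\<parallel>\<close>, \<open>s = \<parallel>x\<parallel> + \<parallel>y\<parallel>\<close>. The difference of the integrands is at most
  \<open>(2 \<rho> r\<^sub>c + (\<rho>\<^sup>2 + 1) s) u\<close>, the local Lipschitz factor of the forcing is \<open>2 r\<^sub>c + (2 \<rho> + 1) s\<close>, and
  \<open>s \<le> 2 r\<^sub>s E\<close> with \<open>E = e\<^bsup>-\<kappa>t\<^esup>\<close>. We look for a weight \<open>G = (\<rho> - c) + c E\<close>, so that \<open>G 0 = \<rho>\<close> is the
  desired constant. The weight condition is the nonnegativity of a quadratic polynomial in \<open>E\<close> on
  \<open>[0, 1]\<close> that is concave because \<open>c \<ge> 0\<close>, so it suffices to look at the end points. At \<open>E = 1\<close> the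
  choice \<open>c = 2 \<rho>\<^sup>2 r\<^sub>s / \<kappa>\<close> makes the condition equivalent to the hypothesis \<open>\<delta>\<^sub>3 \<le> \<rho> (\<mu> - \<delta>\<^sub>2)\<close>, and at
  \<open>E = 0\<close> the same hypothesis leaves room to spare.\<close>

lemma Psi_lipschitz_xs:
  assumes endo: "2 * (\<rho> * (r\<^sub>c + \<rho> * r\<^sub>s) + r\<^sub>s) < \<rho> * (\<mu> - (2 * r\<^sub>c + 2 * (1 + \<rho>) * r\<^sub>s))"
    and \<alpha>: "admissible \<alpha>" "\<phi> \<in> Bc \<theta> r\<^sub>c" and \<xi>: "\<xi> \<in> Bs r\<^sub>s" and \<zeta>: "\<zeta> \<in> Bs r\<^sub>s"
  shows "cmod (Psi \<theta> r\<^sub>c r\<^sub>s \<alpha> (\<phi>, \<xi>) - Psi \<theta> r\<^sub>c r\<^sub>s \<alpha> (\<phi>, \<zeta>)) \<le> \<rho> * norm (\<xi> - \<zeta>)"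
proof -
  let ?x = "xsol \<theta> r\<^sub>s \<alpha> \<phi> \<xi>" and ?y = "xsol \<theta> r\<^sub>s \<alpha> \<phi> \<zeta>"
  define M where "M = \<mu> - 2 * r\<^sub>c"
  define c where "c = 2 * \<rho>\<^sup>2 * r\<^sub>s / \<kappa>"
  define P where "P = (2 * \<rho> + 1) * (2 * r\<^sub>s)"
  define h where "h t = 2 * \<rho> * r\<^sub>c + (\<rho>\<^sup>2 + 1) * (2 * r\<^sub>s * exp (- \<kappa> * t))" for t
  define G where "G t = (\<rho> - c) + c * exp (- \<kappa> * t)" for t
  define K where "K t = 2 * r\<^sub>c + (2 * \<rho> + 1) * (2 * r\<^sub>s * exp (- \<kappa> * t))" for t
  have x: "curve ?x" and y: "curve ?y" by (intro curve_xsol \<alpha> \<xi> \<zeta>)+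
  have xc: "continuous_on {0..} ?x" "continuous_on {0..} ?y" using x y by (auto simp: curve_def)
  have endo': "2 * \<rho> * r\<^sub>c + 4 * \<rho>\<^sup>2 * r\<^sub>s + 2 * \<rho> * r\<^sub>s + 2 * r\<^sub>s < \<rho> * M"
    using endo by (simp add: M_def power2_eq_square algebra_simps)
  have c\<kappa>: "c * \<kappa> = 2 * \<rho>\<^sup>2 * r\<^sub>s" "0 \<le> c" using kappa(2) pos by (simp_all add: c_def)
  have M\<kappa>: "M = \<kappa> + (1 + 2 * \<rho>) * r\<^sub>s" by (simp add: M_def kappa)
  have "(\<rho> - c) * \<kappa> = \<rho> * M - \<rho> * r\<^sub>s - 4 * \<rho>\<^sup>2 * r\<^sub>s"
    using c\<kappa> by (simp add: M\<kappa> power2_eq_square algebra_simps)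
  moreover have "0 < \<rho> * r\<^sub>s" "0 < \<rho> * r\<^sub>c" using pos by auto
  ultimately have a\<kappa>: "2 * \<rho> * r\<^sub>c \<le> (\<rho> - c) * \<kappa>" "0 < (\<rho> - c) * \<kappa>"
    using endo' pos by linarith+
  have a: "0 < \<rho> - c" using a\<kappa>(2) kappa(2) by (simp add: zero_less_mult_iff)
  have Q0: "2 * \<rho> * r\<^sub>c \<le> (\<rho> - c) * M"
  proof -
    have "(\<rho> - c) * \<kappa> \<le> (\<rho> - c) * M" using a pos by (intro mult_left_mono) (auto simp: M\<kappa>)
    then show ?thesis using a\<kappa>(1) by linarith
  qed
  \<comment> \<open>The bound is the chord of the quadratic plus \<open>P c E (1 - E)\<close>; it is nonnegative at the end points by \<open>Q0\<close> and \<open>endo'\<close>.\<close>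
  have weight: "- \<kappa> * c * E + (2 * r\<^sub>c + P * E - \<mu>) * ((\<rho> - c) + c * E)
      \<le> - (2 * \<rho> * r\<^sub>c + (\<rho>\<^sup>2 + 1) * (2 * r\<^sub>s * E))" if E: "0 \<le> E" "E \<le> 1" for E
  proof -
    have "0 \<le> (1 - E) * ((\<rho> - c) * M - 2 * \<rho> * r\<^sub>c)" using E Q0 by (intro mult_nonneg_nonneg) auto
    moreover have "0 \<le> E * (\<rho> * M - (2 * \<rho> * r\<^sub>c + 4 * \<rho>\<^sup>2 * r\<^sub>s + 2 * \<rho> * r\<^sub>s + 2 * r\<^sub>s))"
      using E endo' by (intro mult_nonneg_nonneg) auto
    moreover have "0 \<le> P * c * (E * (1 - E))" using E c\<kappa>(2) pos by (simp add: P_def)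
    moreover have "- (2 * \<rho> * r\<^sub>c + (\<rho>\<^sup>2 + 1) * (2 * r\<^sub>s * E))
          - (- (c * \<kappa>) * E + (P * E - M) * ((\<rho> - c) + c * E))
        = (1 - E) * ((\<rho> - c) * M - 2 * \<rho> * r\<^sub>c)
          + E * (\<rho> * M - (2 * \<rho> * r\<^sub>c + 4 * \<rho>\<^sup>2 * r\<^sub>s + 2 * \<rho> * r\<^sub>s + 2 * r\<^sub>s)) + P * c * (E * (1 - E))"
      unfolding c\<kappa>(1) by (simp add: P_def power2_eq_square algebra_simps)
    moreover have "- \<kappa> * c * E + (2 * r\<^sub>c + P * E - \<mu>) * ((\<rho> - c) + c * E)
        = - (c * \<kappa>) * E + (P * E - M) * ((\<rho> - c) + c * E)"
      by (simp add: M_def algebra_simps)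
    ultimately show ?thesis by linarith
  qed
  have s: "norm (?x t) + norm (?y t) \<le> 2 * r\<^sub>s * exp (- \<kappa> * t)" if "0 \<le> t" for t
  proof -
    have "norm (xsol \<theta> r\<^sub>s \<alpha> \<phi> \<eta> t) \<le> exp (- \<kappa> * t) * r\<^sub>s" if \<eta>: "\<eta> \<in> Bs r\<^sub>s" for \<eta>
    proof -
      have "exp (- \<kappa> * t) * norm \<eta> \<le> exp (- \<kappa> * t) * r\<^sub>s"
        using \<eta> by (intro mult_left_mono) (auto simp: Bs_def)
      then show ?thesis using xsol_decay[OF \<alpha> \<eta> \<open>0 \<le> t\<close>] by linarith
    qed
    from add_mono[OF this[OF \<xi>] this[OF \<zeta>]] show ?thesis by (simp add: mult_ac)
  qed
  have "cmod ((Psi \<theta> r\<^sub>c r\<^sub>s \<alpha> (\<phi>, \<xi>) - \<phi>) - (Psi \<theta> r\<^sub>c r\<^sub>s \<alpha> (\<phi>, \<zeta>) - \<phi>)) \<le> \<rho> * norm (\<xi> - \<zeta>)"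
  proof (rule Psi_diff_le[OF \<alpha> \<xi> \<alpha> \<zeta>, where g = "\<lambda>t. h t * norm (?x t - ?y t)"])
    show "continuous_on {0..} (\<lambda>t. h t * norm (?x t - ?y t))"
      unfolding h_def by (intro continuous_intros xc)
    show "integral {0..T} (\<lambda>t. h t * norm (?x t - ?y t)) \<le> \<rho> * norm (\<xi> - \<zeta>)" if T: "0 \<le> T" for T
    proof -
      have "integral {0..T} (\<lambda>t. h t * norm (?x t - ?y t))
          \<le> G 0 * norm (\<xi> - \<zeta>) + integral {0..T} (\<lambda>t. G t * (2 * 0 * norm (?y t)))"
      proof (rule xsol_diff_gronwall[OF \<alpha> \<xi> \<alpha> \<zeta> T, where K = K and G' = "\<lambda>t. - \<kappa> * c * exp (- \<kappa> * t)"])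
        show "2 * r\<^sub>c + (2 * \<rho> + 1) * (norm (?x t) + norm (?y t)) \<le> K t" if "t \<in> {0..T}" for t
          unfolding K_def using s[of t] that pos by (intro add_left_mono mult_left_mono) auto
        show "(G has_real_derivative - \<kappa> * c * exp (- \<kappa> * t)) (at t within {0..T})" for t
          unfolding G_def[abs_def] by (auto intro!: derivative_eq_intros)
        show "0 \<le> G t" for t using a c\<kappa>(2) by (simp add: G_def)
        show "- \<kappa> * c * exp (- \<kappa> * t) + (K t - \<mu>) * G t \<le> - h t" if "t \<in> {0..T}" for t
          using weight[of "exp (- \<kappa> * t)"] kappa(2) that by (simp add: K_def G_def h_def P_def mult.assoc)
        show "continuous_on {0..T} h" unfolding h_def[abs_def] by (intro continuous_intros)
        show "0 \<le> h t" for t using pos by (simp add: h_def)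
      qed simp
      then show ?thesis by (simp add: G_def)
    qed
    fix t :: real assume t: "0 \<le> t"
    let ?a = "\<alpha> (Phi \<theta> t \<phi>, ?x t)" and ?b = "\<alpha> (Phi \<theta> t \<phi>, ?y t)"
    let ?s = "norm (?x t) + norm (?y t)" and ?u = "norm (?x t - ?y t)"
    have B: "?x t \<in> Bs r\<^sub>s" "?y t \<in> Bs r\<^sub>s" using x y t by (simp_all add: curve_def)
    have Ph: "Phi \<theta> t \<phi> \<in> Bc \<theta> r\<^sub>c" by (rule Phi_in_Bc[OF \<alpha>(2) t])
    have "cmod (?a + ?b) \<le> 2 * r\<^sub>c + \<rho> * ?s"
      using norm_triangle_ineq[of ?a ?b] admissible_bound[OF \<alpha>(1) Ph B(1)] admissible_bound[OF \<alpha>(1) Ph B(2)]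
      by (simp add: distrib_left)
    then have "cmod (?a - ?b) * cmod (?a + ?b) \<le> (\<rho> * ?u) * (2 * r\<^sub>c + \<rho> * ?s)"
      using pos by (intro mult_mono admissible_lipschitz[OF \<alpha>(1) Ph B]) auto
    moreover have "cmod (remainder \<alpha> \<phi> ?x t - remainder \<alpha> \<phi> ?y t)
        = cmod ((?a - ?b) * (?a + ?b) + (coeff (conv (?x t) (?x t)) 0 - coeff (conv (?y t) (?y t)) 0))"
    proof -
      have "remainder \<alpha> \<phi> ?x t - remainder \<alpha> \<phi> ?y t
          = cis \<theta> * ((?a - ?b) * (?a + ?b) + (coeff (conv (?x t) (?x t)) 0 - coeff (conv (?y t) (?y t)) 0))"
        by (simp add: remainder_def power2_eq_square algebra_simps)
      then show ?thesis by (simp add: norm_mult)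
    qed
    ultimately have "cmod (remainder \<alpha> \<phi> ?x t - remainder \<alpha> \<phi> ?y t)
        \<le> (\<rho> * ?u) * (2 * r\<^sub>c + \<rho> * ?s) + ?s * ?u"
      using norm_triangle_ineq[of "(?a - ?b) * (?a + ?b)"
          "coeff (conv (?x t) (?x t)) 0 - coeff (conv (?y t) (?y t)) 0"]
        norm_conv_coeff_diff_le[of "?x t" 0 "?y t"] by (simp add: norm_mult)
    also have "\<dots> = (2 * \<rho> * r\<^sub>c + (\<rho>\<^sup>2 + 1) * ?s) * ?u"
      by (simp add: power2_eq_square algebra_simps)
    also have "\<dots> \<le> h t * ?u"
      unfolding h_def using s[OF t] by (intro mult_right_mono add_left_mono mult_left_mono) auto
    finally show "cmod (remainder \<alpha> \<phi> ?x t - remainder \<alpha> \<phi> ?y t) \<le> h t * ?u" .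
  qed
  then show ?thesis by simp
qed

section \<open>The fixed point\<close>

text \<open>The last condition bounds the Lipschitz constant of \<open>\<gamma>(\<cdot>, x)\<close> by \<open>C \<parallel>x\<parallel>\<close>. With the factor \<open>\<parallel>x\<parallel>\<close>
  it is stable under the operator by \<open>Psi_perturbation\<close>; as an inequality at fixed points it
  survives pointwise limits, unlike the existence of some Lipschitz constant.\<close>

definition regular_maps :: "real \<Rightarrow> (complex \<times> ell1 \<Rightarrow> complex) set" where
  "regular_maps C = {\<alpha> \<in> extensional (Bc \<theta> r\<^sub>c \<times> Bs r\<^sub>s).
     (\<forall>\<phi>\<in>Bc \<theta> r\<^sub>c. \<alpha> (\<phi>, 0) = \<phi>) \<and>
     (\<forall>\<phi>\<in>Bc \<theta> r\<^sub>c. \<forall>x\<in>Bs r\<^sub>s. \<forall>y\<in>Bs r\<^sub>s. cmod (\<alpha> (\<phi>, x) - \<alpha> (\<phi>, y)) \<le> \<rho> * norm (x - y)) \<and>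
     (\<forall>\<phi>\<in>Bc \<theta> r\<^sub>c. \<forall>\<psi>\<in>Bc \<theta> r\<^sub>c. \<forall>x\<in>Bs r\<^sub>s.
        cmod ((\<alpha> (\<phi>, x) - \<phi>) - (\<alpha> (\<psi>, x) - \<psi>)) \<le> C * cmod (\<phi> - \<psi>) * norm x)}"

lemma regular_maps_subset:
  assumes C: "0 \<le> C"
  shows "regular_maps C \<subseteq> LP_maps \<theta> r\<^sub>c r\<^sub>s \<rho>"
proof
  fix \<alpha> assume \<alpha>: "\<alpha> \<in> regular_maps C"
  have "(1 + C * r\<^sub>s + \<rho>)-lipschitz_on (Bc \<theta> r\<^sub>c \<times> Bs r\<^sub>s) \<alpha>"
  proof (rule lipschitz_onI)
    fix z w assume "z \<in> Bc \<theta> r\<^sub>c \<times> Bs r\<^sub>s" "w \<in> Bc \<theta> r\<^sub>c \<times> Bs r\<^sub>s"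
    then obtain \<phi> x \<psi> y where z: "z = (\<phi>, x)" "\<phi> \<in> Bc \<theta> r\<^sub>c" "x \<in> Bs r\<^sub>s"
      and w: "w = (\<psi>, y)" "\<psi> \<in> Bc \<theta> r\<^sub>c" "y \<in> Bs r\<^sub>s" by auto
    have 1: "cmod ((\<alpha> (\<phi>, x) - \<phi>) - (\<alpha> (\<psi>, x) - \<psi>)) \<le> C * cmod (\<phi> - \<psi>) * norm x"
      and 2: "cmod (\<alpha> (\<psi>, x) - \<alpha> (\<psi>, y)) \<le> \<rho> * norm (x - y)"
      using \<alpha> z w by (simp_all add: regular_maps_def)
    have 3: "C * cmod (\<phi> - \<psi>) * norm x \<le> C * cmod (\<phi> - \<psi>) * r\<^sub>s"
      using z C by (intro mult_left_mono) (auto simp: Bs_def)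
    have "cmod (\<alpha> (\<phi>, x) - \<alpha> (\<psi>, y)) \<le> cmod (\<phi> - \<psi>)
        + cmod ((\<alpha> (\<phi>, x) - \<phi>) - (\<alpha> (\<psi>, x) - \<psi>)) + cmod (\<alpha> (\<psi>, x) - \<alpha> (\<psi>, y))"
      using norm_triangle_ineq[of "(\<phi> - \<psi>) + ((\<alpha> (\<phi>, x) - \<phi>) - (\<alpha> (\<psi>, x) - \<psi>))" "\<alpha> (\<psi>, x) - \<alpha> (\<psi>, y)"]
        norm_triangle_ineq[of "\<phi> - \<psi>" "(\<alpha> (\<phi>, x) - \<phi>) - (\<alpha> (\<psi>, x) - \<psi>)"] by simp
    also have "\<dots> \<le> (1 + C * r\<^sub>s) * dist \<phi> \<psi> + \<rho> * dist x y"
      using 1 2 3 by (simp add: dist_norm algebra_simps)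
    also have "\<dots> \<le> (1 + C * r\<^sub>s) * dist z w + \<rho> * dist z w"
      using C pos dist_fst_le[of z w] dist_snd_le[of z w] z w by (intro add_mono mult_left_mono) auto
    finally show "dist (\<alpha> z) (\<alpha> w) \<le> (1 + C * r\<^sub>s + \<rho>) * dist z w"
      by (simp add: dist_norm z w algebra_simps)
  qed (use C pos in simp)
  then show "\<alpha> \<in> LP_maps \<theta> r\<^sub>c r\<^sub>s \<rho>"
    using \<alpha> by (auto simp: LP_maps_def regular_maps_def)
qed

text \<open>The operator turns the constant \<open>C\<close> into \<open>source_factor + contraction_factor * C\<close>.\<close>

lemma Psi_regular:
  assumes endo: "2 * (\<rho> * (r\<^sub>c + \<rho> * r\<^sub>s) + r\<^sub>s) < \<rho> * (\<mu> - (2 * r\<^sub>c + 2 * (1 + \<rho>) * r\<^sub>s))"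
    and C: "0 \<le> C" "source_factor + contraction_factor * C \<le> C" and \<alpha>: "\<alpha> \<in> regular_maps C"
  shows "Psi \<theta> r\<^sub>c r\<^sub>s \<alpha> \<in> regular_maps C"
proof -
  have adm: "admissible \<alpha>" using \<alpha> regular_maps_subset[OF C(1)] LP_maps_admissible by blast
  have "cmod ((Psi \<theta> r\<^sub>c r\<^sub>s \<alpha> (\<phi>, \<xi>) - \<phi>) - (Psi \<theta> r\<^sub>c r\<^sub>s \<alpha> (\<psi>, \<xi>) - \<psi>)) \<le> C * cmod (\<phi> - \<psi>) * norm \<xi>"
    if \<phi>: "\<phi> \<in> Bc \<theta> r\<^sub>c" and \<psi>: "\<psi> \<in> Bc \<theta> r\<^sub>c" and \<xi>: "\<xi> \<in> Bs r\<^sub>s" for \<phi> \<psi> \<xi>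
  proof -
    have "cmod ((Psi \<theta> r\<^sub>c r\<^sub>s \<alpha> (\<phi>, \<xi>) - \<phi>) - (Psi \<theta> r\<^sub>c r\<^sub>s \<alpha> (\<psi>, \<xi>) - \<psi>))
        \<le> (source_factor * cmod (\<phi> - \<psi>) + contraction_factor * (C * cmod (\<phi> - \<psi>))) * norm \<xi>"
    proof (rule Psi_perturbation[OF adm \<phi> adm \<psi> \<xi>])
      fix t :: real and y assume t: "0 \<le> t" and y: "y \<in> Bs r\<^sub>s"
      have "cmod ((\<alpha> (Phi \<theta> t \<phi>, y) - Phi \<theta> t \<phi>) - (\<alpha> (Phi \<theta> t \<psi>, y) - Phi \<theta> t \<psi>))
          \<le> C * cmod (Phi \<theta> t \<phi> - Phi \<theta> t \<psi>) * norm y"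
        using \<alpha> y Phi_in_Bc[OF \<phi> t] Phi_in_Bc[OF \<psi> t] by (simp add: regular_maps_def)
      also have "\<dots> \<le> C * cmod (\<phi> - \<psi>) * norm y"
        using C by (intro mult_right_mono mult_left_mono norm_Phi_diff_le[OF \<phi> \<psi> t]) auto
      finally show "cmod ((\<alpha> (Phi \<theta> t \<phi>, y) - Phi \<theta> t \<phi>) - (\<alpha> (Phi \<theta> t \<psi>, y) - Phi \<theta> t \<psi>))
          \<le> C * cmod (\<phi> - \<psi>) * norm y" .
    qed (use C in simp)
    also have "\<dots> = (source_factor + contraction_factor * C) * cmod (\<phi> - \<psi>) * norm \<xi>"
      by (simp add: algebra_simps)
    also have "\<dots> \<le> C * cmod (\<phi> - \<psi>) * norm \<xi>"
      by (intro mult_right_mono C(2)) auto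
    finally show ?thesis .
  qed
  then show ?thesis
    using Psi_zero[OF adm] Psi_lipschitz_xs[OF endo adm] by (simp add: regular_maps_def) (simp add: Psi_def)
qed

lemma regular_maps_closed:
  assumes X: "\<And>n. X n \<in> regular_maps C" and l: "l \<in> extensional (Bc \<theta> r\<^sub>c \<times> Bs r\<^sub>s)"
    and lim: "\<And>z. z \<in> Bc \<theta> r\<^sub>c \<times> Bs r\<^sub>s \<Longrightarrow> (\<lambda>n. X n z) \<longlonglongrightarrow> l z"
  shows "l \<in> regular_maps C"
  unfolding regular_maps_def
proof (intro CollectI conjI ballI l)
  fix \<phi> assume \<phi>: "\<phi> \<in> Bc \<theta> r\<^sub>c"
  have "(\<lambda>n. X n (\<phi>, 0)) \<longlonglongrightarrow> l (\<phi>, 0)" using \<phi> zero_in_Bs by (intro lim) simp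
  moreover have "X n (\<phi>, 0) = \<phi>" for n using X[of n] \<phi> by (simp add: regular_maps_def)
  ultimately show "l (\<phi>, 0) = \<phi>" by (simp add: LIMSEQ_const_iff)
next
  fix \<phi> x y assume z: "\<phi> \<in> Bc \<theta> r\<^sub>c" "x \<in> Bs r\<^sub>s" "y \<in> Bs r\<^sub>s"
  have "(\<lambda>n. cmod (X n (\<phi>, x) - X n (\<phi>, y))) \<longlonglongrightarrow> cmod (l (\<phi>, x) - l (\<phi>, y))"
    using z by (intro tendsto_intros lim) auto
  then show "cmod (l (\<phi>, x) - l (\<phi>, y)) \<le> \<rho> * norm (x - y)"
    by (rule LIMSEQ_le_const2) (use X z in \<open>auto simp: regular_maps_def\<close>)
next
  fix \<phi> \<psi> x assume z: "\<phi> \<in> Bc \<theta> r\<^sub>c" "\<psi> \<in> Bc \<theta> r\<^sub>c" "x \<in> Bs r\<^sub>s"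
  have "(\<lambda>n. cmod ((X n (\<phi>, x) - \<phi>) - (X n (\<psi>, x) - \<psi>))) \<longlonglongrightarrow> cmod ((l (\<phi>, x) - \<phi>) - (l (\<psi>, x) - \<psi>))"
    using z by (intro tendsto_intros lim) auto
  then show "cmod ((l (\<phi>, x) - \<phi>) - (l (\<psi>, x) - \<psi>)) \<le> C * cmod (\<phi> - \<psi>) * norm x"
    by (rule LIMSEQ_le_const2) (use X z in \<open>auto simp: regular_maps_def\<close>)
qed

lemma admissible_dist_le:
  assumes "admissible \<alpha>" "admissible \<beta>" "\<phi> \<in> Bc \<theta> r\<^sub>c" "x \<in> Bs r\<^sub>s"
  shows "cmod (\<alpha> (\<phi>, x) - \<beta> (\<phi>, x)) \<le> 2 * \<rho> * norm x"
  using admissible_near[OF assms(1,3,4)] admissible_near[OF assms(2,3,4)]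
    norm_triangle_ineq4[of "\<alpha> (\<phi>, x) - \<phi>" "\<beta> (\<phi>, x) - \<phi>"] by simp

lemma Psi_contraction_weighted:
  assumes "\<alpha> \<in> LP_maps \<theta> r\<^sub>c r\<^sub>s \<rho>" "\<beta> \<in> LP_maps \<theta> r\<^sub>c r\<^sub>s \<rho>" "0 \<le> D"
    and "\<forall>z\<in>Bc \<theta> r\<^sub>c \<times> Bs r\<^sub>s. cmod (\<alpha> z - \<beta> z) \<le> D * norm (snd z)"
  shows "\<forall>z\<in>Bc \<theta> r\<^sub>c \<times> Bs r\<^sub>s. cmod (Psi \<theta> r\<^sub>c r\<^sub>s \<alpha> z - Psi \<theta> r\<^sub>c r\<^sub>s \<beta> z)
           \<le> contraction_factor * D * norm (snd z)"
proof
  fix z assume "z \<in> Bc \<theta> r\<^sub>c \<times> Bs r\<^sub>s"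
  then obtain \<phi> \<xi> where z: "z = (\<phi>, \<xi>)" "\<phi> \<in> Bc \<theta> r\<^sub>c" "\<xi> \<in> Bs r\<^sub>s" by auto
  show "cmod (Psi \<theta> r\<^sub>c r\<^sub>s \<alpha> z - Psi \<theta> r\<^sub>c r\<^sub>s \<beta> z) \<le> contraction_factor * D * norm (snd z)"
    unfolding z(1) snd_conv
    by (rule Psi_contraction) (use assms z LP_maps_admissible in auto)
qed

text \<open>Existence comes from iteration inside \<^const>\<open>regular_maps\<close>, uniqueness from the contraction property
  on all of \<^const>\<open>LP_maps\<close>.\<close>

theorem ex1_fixed_point:
  assumes endo: "2 * (\<rho> * (r\<^sub>c + \<rho> * r\<^sub>s) + r\<^sub>s) < \<rho> * (\<mu> - (2 * r\<^sub>c + 2 * (1 + \<rho>) * r\<^sub>s))"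
    and contr: "contraction_factor < 1"
  shows "\<exists>!\<alpha>. \<alpha> \<in> LP_maps \<theta> r\<^sub>c r\<^sub>s \<rho> \<and> Psi \<theta> r\<^sub>c r\<^sub>s \<alpha> = \<alpha>"
proof -
  let ?A = "Bc \<theta> r\<^sub>c \<times> Bs r\<^sub>s" and ?w = "\<lambda>z :: complex \<times> ell1. norm (snd z)"
  let ?T = "Psi \<theta> r\<^sub>c r\<^sub>s"
  \<comment> \<open>The solution of \<open>source_factor + contraction_factor * C = C\<close>.\<close>
  define C where "C = source_factor / (1 - contraction_factor)"
  have C0: "0 \<le> C" using factors_nonneg contr by (simp add: C_def)
  have "C * (1 - contraction_factor) = source_factor" using contr by (simp add: C_def)
  then have C: "source_factor + contraction_factor * C \<le> C" by (simp add: algebra_simps)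
  have sub: "regular_maps C \<subseteq> LP_maps \<theta> r\<^sub>c r\<^sub>s \<rho>" by (rule regular_maps_subset[OF C0])
  have dist: "\<forall>z\<in>?A. cmod (\<alpha> z - \<beta> z) \<le> 2 * \<rho> * ?w z"
    if "\<alpha> \<in> LP_maps \<theta> r\<^sub>c r\<^sub>s \<rho>" "\<beta> \<in> LP_maps \<theta> r\<^sub>c r\<^sub>s \<rho>" for \<alpha> \<beta>
    using admissible_dist_le[OF that[THEN LP_maps_admissible]] by auto
  have "\<exists>\<alpha>\<in>regular_maps C. ?T \<alpha> = \<alpha>"
  proof (rule weighted_fixed_point_exists[where w = ?w and A = ?A, OF factors_nonneg(1) contr])
    show "restrict fst ?A \<in> regular_maps C"
      using zero_in_Bs C0 pos by (auto simp: regular_maps_def)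
    show "regular_maps C \<subseteq> extensional ?A" by (auto simp: regular_maps_def)
    show "?T \<alpha> \<in> regular_maps C" if "\<alpha> \<in> regular_maps C" for \<alpha>
      by (rule Psi_regular[OF endo C0 C that])
    show "\<forall>z\<in>?A. cmod (?T \<alpha> z - ?T \<beta> z) \<le> contraction_factor * D * ?w z"
      if "\<alpha> \<in> regular_maps C" "\<beta> \<in> regular_maps C" "0 \<le> D" "\<forall>z\<in>?A. cmod (\<alpha> z - \<beta> z) \<le> D * ?w z" for \<alpha> \<beta> D
      by (rule Psi_contraction_weighted) (use that sub in auto)
    show "\<exists>D. \<forall>z\<in>?A. cmod (\<alpha> z - \<beta> z) \<le> D * ?w z" if "\<alpha> \<in> regular_maps C" "\<beta> \<in> regular_maps C" for \<alpha> \<beta>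
      using dist[of \<alpha> \<beta>] that sub by blast
    show "l \<in> regular_maps C" if X: "\<And>n. X n \<in> regular_maps C" and l: "l \<in> extensional ?A"
      and lim: "\<And>e. 0 < e \<Longrightarrow> \<forall>\<^sub>F n in sequentially. \<forall>z\<in>?A. cmod (X n z - l z) \<le> e * ?w z" for X l
    proof (rule regular_maps_closed[OF X l])
      fix z assume z: "z \<in> ?A"
      show "(\<lambda>n. X n z) \<longlonglongrightarrow> l z"
      proof (rule tendstoI)
        fix e :: real assume e: "0 < e"
        \<comment> \<open>Adding \<open>1\<close> covers the points where the weight vanishes.\<close>
        have small: "e / (?w z + 1) * ?w z < e"
          using e by (simp add: divide_simps add_nonneg_pos)
        have "\<forall>\<^sub>F n in sequentially. \<forall>z'\<in>?A. cmod (X n z' - l z') \<le> e / (?w z + 1) * ?w z'"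
          using e by (intro lim) (simp add: add_nonneg_pos)
        then show "\<forall>\<^sub>F n in sequentially. dist (X n z) (l z) < e"
        proof (rule eventually_mono)
          fix n assume "\<forall>z'\<in>?A. cmod (X n z' - l z') \<le> e / (?w z + 1) * ?w z'"
          then have "cmod (X n z - l z) \<le> e / (?w z + 1) * ?w z" using z by blast
          also note small
          finally show "dist (X n z) (l z) < e" by (simp add: dist_norm)
        qed
      qed
    qed
  qed simp
  then obtain \<alpha> where \<alpha>: "\<alpha> \<in> LP_maps \<theta> r\<^sub>c r\<^sub>s \<rho>" "?T \<alpha> = \<alpha>" using sub by blast
  show ?thesis
  proof (rule ex1I[of _ \<alpha>])
    show "\<alpha> \<in> LP_maps \<theta> r\<^sub>c r\<^sub>s \<rho> \<and> ?T \<alpha> = \<alpha>" using \<alpha> by simp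
    fix \<beta> assume \<beta>: "\<beta> \<in> LP_maps \<theta> r\<^sub>c r\<^sub>s \<rho> \<and> ?T \<beta> = \<beta>"
    show "\<beta> = \<alpha>"
    proof (rule weighted_fixed_point_unique[where w = ?w and A = ?A and T = ?T and D = "2 * \<rho>",
          OF factors_nonneg(1) contr])
      show "\<forall>z\<in>?A. cmod (?T \<beta> z - ?T \<alpha> z) \<le> contraction_factor * D * ?w z"
        if "0 \<le> D" "\<forall>z\<in>?A. cmod (\<beta> z - \<alpha> z) \<le> D * ?w z" for D
        by (rule Psi_contraction_weighted) (use that \<alpha> \<beta> in auto)
      show "\<forall>z\<in>?A. cmod (\<beta> z - \<alpha> z) \<le> 2 * \<rho> * ?w z" using dist \<alpha> \<beta> by blast
    qed (use \<alpha> \<beta> pos in \<open>auto simp: LP_maps_def\<close>)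
  qed
qed

end

theorem theorem6p1:
  fixes \<theta> \<mu> r\<^sub>c r\<^sub>s \<rho> \<delta>\<^sub>1 \<delta>\<^sub>2 \<delta>\<^sub>3 \<delta>\<^sub>4 lam :: real
  assumes theta: "- (pi / 2) < \<theta>" "\<theta> < pi / 2"
    and mu: "\<mu> = omega\<^sup>2 * cos \<theta>"
    and pos: "r\<^sub>c > 0" "r\<^sub>s > 0" "\<rho> > 0"
    and delta1: "\<delta>\<^sub>1 = 2 * r\<^sub>c + (1 + 2 * \<rho>) * r\<^sub>s"
    and delta2: "\<delta>\<^sub>2 = 2 * r\<^sub>c + 2 * (1 + \<rho>) * r\<^sub>s"
    and delta3: "\<delta>\<^sub>3 = 2 * (\<rho> * (r\<^sub>c + \<rho> * r\<^sub>s) + r\<^sub>s)"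
    and delta4: "\<delta>\<^sub>4 = 2 * (r\<^sub>c + 2 * \<rho> * r\<^sub>s + r\<^sub>s)"
    and lam: "lam = 2 * (\<rho> * (r\<^sub>c + \<rho> * r\<^sub>s) + r\<^sub>s) * 2 * r\<^sub>s / ((\<mu> - \<delta>\<^sub>1) * (\<mu> - \<delta>\<^sub>4))
                    + 2 * (r\<^sub>c + \<rho> * r\<^sub>s) / (\<mu> - \<delta>\<^sub>1)"
    and small: "\<delta>\<^sub>1 < \<mu>" "\<delta>\<^sub>2 < \<mu>" "\<delta>\<^sub>4 < \<mu>"
    and endo: "\<delta>\<^sub>3 / (\<mu> - \<delta>\<^sub>2) < \<rho>"
    and contr: "lam < 1"
  shows "\<exists>!\<alpha>. \<alpha> \<in> LP_maps \<theta> r\<^sub>c r\<^sub>s \<rho> \<and> Psi \<theta> r\<^sub>c r\<^sub>s \<alpha> = \<alpha>"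
proof -
  have "0 < cos \<theta>" using theta by (intro cos_gt_zero_pi) auto
  then interpret slow_fast \<theta> r\<^sub>c r\<^sub>s \<rho> \<mu> "\<mu> - \<delta>\<^sub>1" "\<mu> - \<delta>\<^sub>4"
    using mu pos small by unfold_locales (simp_all add: delta1 delta4)
  show ?thesis
  proof (rule ex1_fixed_point)
    show "2 * (\<rho> * (r\<^sub>c + \<rho> * r\<^sub>s) + r\<^sub>s) < \<rho> * (\<mu> - (2 * r\<^sub>c + 2 * (1 + \<rho>) * r\<^sub>s))"
      using endo small(2) unfolding delta3[symmetric] delta2[symmetric] by (simp add: divide_less_eq)
    show "contraction_factor < 1"
      using contr unfolding contraction_factor_def lam .
  qed
qed

end
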